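(* Write $J_\lambda(\alpha)=\sum_\mu v_{\lambda\mu}(\alpha)m_\mu$ and $Q_\mu(\alpha)=\sum_\lambda C_{\mu\lambda}(\alpha)q_\lambda(\alpha)$. Then for partitions $\mu<\lambda$, $$v_{\lambda\mu}(\alpha)=v_{\lambda\lambda}(\alpha)\sum_\delta f^\lambda(\delta),\qquad C_{\mu\lambda}(\alpha)=C_{\mu\mu}(\alpha)\sum_\delta f_\mu(\delta),$$ where both sums run over all moving up filtrations $\delta$ of partitions starting from $\mu$ and ending at $\lambda$.
   Context: $F=\mathbb{Q}(\alpha)$, $\Lambda_F=F[p_1,p_2,\dots]$ ($p_n$ power sums), $m_\mu$ monomial symmetric functions. For a partition $\lambda$: $l(\lambda)$ number of parts, $\lambda'$ conjugate, $m_a(\lambda)$ number of parts equal to $a$, $z_\lambda=\prod_ii^{m_i(\lambda)}m_i(\lambda)!$. Dominance order $\le$. Scalar product $\langle p_\lambda,p_\mu\rangle=\delta_{\lambda\mu}\alpha^{l(\lambda)}z_\lambda$. Jack $P_\lambda(\alpha)$: the pairwise orthogonal functions of the form $m_\lambda+\sum_{\mu<\lambda}c_{\lambda\mu}m_\mu$; $Q_\lambda=\langle P_\lambda,P_\lambda\rangle^{-1}P_\lambda$; $J_\lambda=\big(\prod_{(i,j)\in\lambda}(\alpha(\lambda_i-j)+\lambda'_j-i+1)\big)P_\lambda$. $Q_n(\alpha)=\sum_{\lambda\vdash n}\alpha^{-l(\lambda)}z_\lambda^{-1}p_\lambda$ ($Q_0=1$), $q_\lambda=Q_{\lambda_1}Q_{\lambda_2}\cdots$.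 $e'_\lambda(\alpha)=\frac12\alpha\sum_i\lambda_i^2-\sum_ii\lambda_i$. Moving up operator: for $i<j$ and $0<k\le\lambda_j$, $r^i_j(k).\lambda$ is the rearrangement in decreasing order of $(\lambda_1,\dots,\lambda_i+k,\dots,\lambda_j-k,\dots)$; $M^*(\lambda)$ is the set of all such. For $\mu=r^i_j(k).\lambda$, $r_{\lambda\mu}=(1+\delta_{\lambda_i\lambda_j})^{-1}m_{\lambda_i}(\lambda)(m_{\lambda_j}(\lambda)-\delta_{\lambda_i\lambda_j})(\lambda_i-\lambda_j+2k)$. A moving up filtration from $\lambda^0$ to $\lambda^s$ is a sequence $\delta=(\lambda^0,\lambda^1,\dots,\lambda^s)$ with $\lambda^i\in M^*(\lambda^{i-1})$ for $i=1,\dots,s$. For such $\delta$ and $\lambda\ge\lambda^s$, $\mu\le\lambda^0$: $$f^\lambda(\delta)=\prod_{i=0}^{s-1}\frac{r_{\lambda^i\lambda^{i+1}}}{e'_\lambda(\alpha)-e'_{\lambda^i}(\alpha)},\qquad f_\mu(\delta)=\prod_{i=0}^{s-1}\frac{r_{\lambda^i\lambda^{i+1}}}{e'_\mu(\alpha)-e'_{\lambda^{i+1}}(\alpha)}.$$ *)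

theory Defs
  imports Main "HOL-Library.Poly_Mapping" "HOL-Computational_Algebra.Polynomial"
    "HOL-Computational_Algebra.Fraction_Field"
begin

type_synonym F = "rat poly fract"

definition alpha :: F where "alpha = Fract [:0, 1:] 1"

definition is_partition :: "nat list \<Rightarrow> bool" where
  "is_partition la \<longleftrightarrow> sorted (rev la) \<and> (\<forall>x\<in>set la. 0 < x)"

definition partitions :: "nat \<Rightarrow> nat list set" where
  "partitions n = {la. is_partition la \<and> sum_list la = n}"

definition psum :: "nat list \<Rightarrow> nat \<Rightarrow> nat" where
  "psum la i = sum_list (take i la)"

definition dom_le :: "nat list \<Rightarrow> nat list \<Rightarrow> bool" where
  "dom_le mu la \<longleftrightarrow> is_partition mu \<and> is_partition la \<and> sum_list mu = sum_list la
     \<and> (\<forall>i. psum mu i \<le> psum la i)"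

definition dom_less :: "nat list \<Rightarrow> nat list \<Rightarrow> bool" where
  "dom_less mu la \<longleftrightarrow> dom_le mu la \<and> mu \<noteq> la"

text \<open>conjugate partition, 0-indexed column j: lambda'_{j+1}\<close>
definition conj_part :: "nat list \<Rightarrow> nat \<Rightarrow> nat" where
  "conj_part la j = length (filter (\<lambda>x. j < x) la)"

definition mult :: "nat list \<Rightarrow> nat \<Rightarrow> nat" where
  "mult la a = count_list la a"

definition zee :: "nat list \<Rightarrow> nat" where
  "zee la = (\<Prod>i\<in>set la. i ^ mult la i * fact (mult la i))"

text \<open>An element of the ring of formal power series in the countably many variables
  x_0, x_1, ... over F is its coefficient function on exponent vectors (monomials).
  Lambda_F is the subring of symmetric functions of bounded degree, generated by
  the power sums.\<close>

type_synonym sf = "(nat \<Rightarrow>\<^sub>0 nat) \<Rightarrow> F"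

definition mdeg :: "(nat \<Rightarrow>\<^sub>0 nat) \<Rightarrow> nat" where
  "mdeg a = sum (Poly_Mapping.lookup a) (Poly_Mapping.keys a)"

definition sf_mult :: "sf \<Rightarrow> sf \<Rightarrow> sf" where
  "sf_mult f g = (\<lambda>a. \<Sum>(b, c) \<in> {(b, c). b + c = a}. f b * g c)"

definition sf_one :: sf where
  "sf_one = (\<lambda>a. if a = 0 then 1 else 0)"

definition sf_smult :: "F \<Rightarrow> sf \<Rightarrow> sf" where
  "sf_smult c f = (\<lambda>a. c * f a)"

definition psf :: "nat \<Rightarrow> sf" where
  "psf k = (\<lambda>a. if \<exists>i. a = Poly_Mapping.single i k then 1 else 0)"

fun p_list :: "nat list \<Rightarrow> sf" where
  "p_list [] = sf_one"
| "p_list (k # ks) = sf_mult (psf k) (p_list ks)"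

definition shape :: "(nat \<Rightarrow>\<^sub>0 nat) \<Rightarrow> nat list" where
  "shape a = rev (sort (map (Poly_Mapping.lookup a) (sorted_list_of_set (Poly_Mapping.keys a))))"

definition msf :: "nat list \<Rightarrow> sf" where
  "msf la = (\<lambda>a. if shape a = la then 1 else 0)"

definition mono_of :: "nat list \<Rightarrow> (nat \<Rightarrow>\<^sub>0 nat)" where
  "mono_of la = (\<Sum>i<length la. Poly_Mapping.single i (la ! i))"

definition hom :: "nat \<Rightarrow> sf \<Rightarrow> sf" where
  "hom n f = (\<lambda>a. if mdeg a = n then f a else 0)"

definition coords :: "(nat list \<Rightarrow> sf) \<Rightarrow> nat \<Rightarrow> sf \<Rightarrow> nat list \<Rightarrow> F" where
  "coords b n f = (THE c. (\<forall>la. c la \<noteq> 0 \<longrightarrow> la \<in> partitions n)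
      \<and> f = (\<lambda>a. \<Sum>la\<in>partitions n. c la * b la a))"

text \<open>scalar product <p_lambda, p_mu> = delta alpha^{l(lambda)} z_lambda\<close>
definition sprod :: "sf \<Rightarrow> sf \<Rightarrow> F" where
  "sprod f g = (\<Sum>n\<in>{n. \<exists>a. mdeg a = n \<and> (f a \<noteq> 0 \<or> g a \<noteq> 0)}.
      \<Sum>la\<in>partitions n. coords p_list n (hom n f) la * coords p_list n (hom n g) la
          * alpha ^ length la * of_nat (zee la))"

definition jack_family :: "(nat list \<Rightarrow> sf) \<Rightarrow> bool" where
  "jack_family P \<longleftrightarrow>
     (\<forall>la. \<not> is_partition la \<longrightarrow> P la = (\<lambda>_. 0)) \<and>
     (\<forall>la. is_partition la \<longrightarrow> (\<exists>c. P la = (\<lambda>a. msf la a +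
          (\<Sum>mu\<in>{mu. dom_less mu la}. c mu * msf mu a)))) \<and>
     (\<forall>la mu. is_partition la \<longrightarrow> is_partition mu \<longrightarrow> la \<noteq> mu \<longrightarrow> sprod (P la) (P mu) = 0)"

definition jackP :: "nat list \<Rightarrow> sf" where
  "jackP = (THE P. jack_family P)"

definition jackQ :: "nat list \<Rightarrow> sf" where
  "jackQ la = sf_smult (inverse (sprod (jackP la) (jackP la))) (jackP la)"

text \<open>hook product; 0-indexed cell (i,j) corresponds to the cell (i+1,j+1)\<close>
definition hook_coeff :: "nat list \<Rightarrow> F" where
  "hook_coeff la = (\<Prod>(i, j)\<in>{(i, j). i < length la \<and> j < la ! i}.
      alpha * of_nat (la ! i - (j + 1)) + of_nat (conj_part la j) - of_nat (i + 1) + 1)"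

definition jackJ :: "nat list \<Rightarrow> sf" where
  "jackJ la = sf_smult (hook_coeff la) (jackP la)"

definition Qn :: "nat \<Rightarrow> sf" where
  "Qn n = (\<lambda>a. \<Sum>la\<in>partitions n.
      inverse (alpha ^ length la * of_nat (zee la)) * p_list la a)"

fun q_list :: "nat list \<Rightarrow> sf" where
  "q_list [] = sf_one"
| "q_list (k # ks) = sf_mult (Qn k) (q_list ks)"

text \<open>J_lambda = sum_mu v_{lambda mu} m_mu\<close>
definition vcoef :: "nat list \<Rightarrow> nat list \<Rightarrow> F" where
  "vcoef la mu = jackJ la (mono_of mu)"

definition Ccoef :: "nat list \<Rightarrow> nat list \<Rightarrow> F" where
  "Ccoef mu la = coords q_list (sum_list mu) (jackQ mu) la"

text \<open>r^{i+1}_{j+1}(k).lambda  (0-indexed positions i < j)\<close>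
definition moveup :: "nat \<Rightarrow> nat \<Rightarrow> nat \<Rightarrow> nat list \<Rightarrow> nat list" where
  "moveup i j k la = rev (sort (filter (\<lambda>x. x \<noteq> 0) (la[i := la ! i + k, j := la ! j - k])))"

definition moveup_ok :: "nat \<Rightarrow> nat \<Rightarrow> nat \<Rightarrow> nat list \<Rightarrow> bool" where
  "moveup_ok i j k la \<longleftrightarrow> i < j \<and> j < length la \<and> 0 < k \<and> k \<le> la ! j"

definition Mstar :: "nat list \<Rightarrow> nat list set" where
  "Mstar la = {moveup i j k la | i j k. moveup_ok i j k la}"

definition rcoef :: "nat list \<Rightarrow> nat list \<Rightarrow> F" where
  "rcoef la mu = (case SOME (i, j, k). moveup_ok i j k la \<and> mu = moveup i j k la of
     (i, j, k) \<Rightarrow>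
       (let a = la ! i; b = la ! j; d = (if a = b then 1 else 0) in
         inverse (1 + of_nat d) * of_nat (mult la a) * (of_nat (mult la b) - of_nat d)
           * (of_nat a - of_nat b + 2 * of_nat k)))"

text \<open>e'_lambda(alpha), with 1-indexed parts\<close>
definition eprime :: "nat list \<Rightarrow> F" where
  "eprime la = alpha / 2 * (\<Sum>i<length la. of_nat ((la ! i)^2))
      - (\<Sum>i<length la. of_nat ((i + 1) * la ! i))"

definition filtrations :: "nat list \<Rightarrow> nat list \<Rightarrow> nat list list set" where
  "filtrations mu la = {dl. dl \<noteq> [] \<and> hd dl = mu \<and> last dl = la \<and>
      (\<forall>i. i + 1 < length dl \<longrightarrow> dl ! (i + 1) \<in> Mstar (dl ! i))}"

definition f_up :: "nat list \<Rightarrow> nat list list \<Rightarrow> F" where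
  "f_up la dl = (\<Prod>i<length dl - 1.
      rcoef (dl ! i) (dl ! (i + 1)) / (eprime la - eprime (dl ! i)))"

definition f_down :: "nat list \<Rightarrow> nat list list \<Rightarrow> F" where
  "f_down mu dl = (\<Prod>i<length dl - 1.
      rcoef (dl ! i) (dl ! (i + 1)) / (eprime mu - eprime (dl ! (i + 1))))"

end

(* In the monomial basis the Laplace-Beltrami operator acts by
     H m_nu = e'_nu m_nu + sum of r_{mu,nu} m_mu over all mu with nu in M*(mu),
   up to normalization. Comparing coefficients in H P_la = e'_la P_la gives a recursion
   for the coefficients v_{la,mu}, and unrolling it gives the sum over filtrations. As H is
   self-adjoint and the q_la are dual to the m_la, the transposed recursion holds for C_{mu,la}.

   The Jack functions exist and are joint eigenfunctions because of a family of self-adjoint,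
   dominance-triangular operators Ham k containing H (as Ham 1): sums over the variables of powers of the
   Heckman-Dunkl operators. They are triangular by their action on monomials; rewritten in the
   power sums they become sums of p_a (L^k)_{ab} p_b^* for a Lax matrix L with L_{ab}^* = L_{ba},
   so that they are self-adjoint. The leading coefficients in alpha of their eigenvalues are the
   power sums of the parts of the partition, hence the eigenvalues separate partitions.
   Commutativity of the operators is not needed. *)
theory Submission
  imports Defs "HOL-Library.Multiset" "HOL-Library.FuncSet"
begin

section \<open>Power sums as functions of the exponents\<close>

text \<open>The order on \<open>F\<close> compares leading coefficients, so \<open>alpha\<close> is
  positive and every product of power sums with positive indices has positive norm. The scalar
  product is therefore definite over \<open>F\<close> itself, and several identities are proved by
  showing that the difference of the two sides has norm 0. The obstacle is that each description of
  the operators shows only one of the two properties: triangularity is visible on exponents,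
  self-adjointness in power sums. The bridge is a marked variable x. The chain rule turns alpha x
  d/dx into the sum of the x^k times the adjoint of multiplication by \<open>p_k\<close>. A Dunkl
  operator acting on sums of x^a f_a with symmetric f_a then becomes a matrix of power sums and
  their adjoints. Multisets of exponents may contain 0, since lowering an exponent k by k leaves a
  0; \<open>pos_part\<close> discards zeros where partitions are meant. In degree n,
  \<open>Ham 1\<close> is 2 alpha (H + n). The factor alpha comes from the initial derivative, the 2
  from ordered pairs of variables and the 1/2 in e', and n from the fact that e' numbers the rows
  from 1.\<close>

lemma alpha_pos: "0 < alpha"
  by (simp add: alpha_def zero_less_Fract_iff less_poly_def pos_poly_def)

lemma alpha_nonzero [simp]: "alpha \<noteq> 0"
  using alpha_pos by simp

lemma sum_mset_cong_strong:
  assumes "\<And>x. x \<in># A \<Longrightarrow> f x = g x"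
  shows "(\<Sum>x\<in>#A. f x) = (\<Sum>x\<in>#A. g x)"
  using assms by (metis image_mset_cong)

lemma sum_mset_delete:
  fixes f :: "'a \<Rightarrow> 'b::ab_group_add"
  assumes "x \<in># A"
  shows "(\<Sum>y\<in>#A - {#x#}. f y) = (\<Sum>y\<in>#A. f y) - f x"
  using assms by (metis add_diff_cancel_left' insert_DiffM sum_mset.insert image_mset_add_mset)

lemma sum_mset_subtractf:
  fixes f g :: "'a \<Rightarrow> 'b::ab_group_add"
  shows "(\<Sum>x\<in>#A. f x - g x) = (\<Sum>x\<in>#A. f x) - (\<Sum>x\<in>#A. g x)"
  by (induction A) auto

lemma sum_mset_sum_swap:
  "(\<Sum>x\<in>#A. \<Sum>i\<in>I. f x i) = (\<Sum>i\<in>I. \<Sum>x\<in>#A. (f x i :: 'b::comm_monoid_add))"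
  by (induction A) (auto simp: sum.distrib)

lemma sum_mset_pairs_swap:
  fixes G :: "'a \<Rightarrow> 'a \<Rightarrow> 'b::ab_group_add"
  shows "(\<Sum>x\<in>#A. \<Sum>y\<in>#A - {#x#}. G x y) = (\<Sum>x\<in>#A. \<Sum>y\<in>#A - {#x#}. G y x)"
proof -
  have *: "(\<Sum>x\<in>#A. \<Sum>y\<in>#A - {#x#}. H x y) = (\<Sum>x\<in>#A. (\<Sum>y\<in>#A. H x y) - H x x)" for H :: "'a \<Rightarrow> 'a \<Rightarrow> 'b"
    by (intro sum_mset_cong_strong) (simp add: sum_mset_delete)
  show ?thesis unfolding * sum_mset_subtractf
    by (subst sum_mset.swap) simp
qed

text \<open>Symmetric functions are modelled by functions of a multiset of exponents (zeros allowed), whose value is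
  the coefficient of any monomial with these exponents. In this model \<open>pmul k\<close> is multiplication by
  the power sum \<open>p\<^sub>k\<close>.\<close>

definition pmul :: "nat \<Rightarrow> (nat multiset \<Rightarrow> F) \<Rightarrow> nat multiset \<Rightarrow> F" where
  "pmul k f A = (\<Sum>x\<in>#A. if k \<le> x then f (add_mset (x - k) (A - {#x#})) else 0)"

definition pone :: "nat multiset \<Rightarrow> F" where
  "pone A = (if sum_mset A = 0 then 1 else 0)"

lemma pmul_add_mset:
  "pmul k f (add_mset z B) = (if k \<le> z then f (add_mset (z - k) B) else 0)
     + (\<Sum>y\<in>#B. if k \<le> y then f (add_mset z (add_mset (y - k) (B - {#y#}))) else 0)"
proof -
  have "(\<Sum>y\<in>#B. if k \<le> y then f (add_mset (y - k) (add_mset z B - {#y#})) else 0)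
    = (\<Sum>y\<in>#B. if k \<le> y then f (add_mset z (add_mset (y - k) (B - {#y#}))) else 0)"
    by (intro sum_mset_cong_strong) (auto simp: add_mset_commute)
  then show ?thesis by (simp add: pmul_def)
qed

text \<open>The two exponents are lowered either at the same variable (\<open>D\<close>) or at two
  different ones (\<open>G\<close>). The first contribution depends on j + k only, the second is
  symmetric after exchanging the two variables.\<close>

lemma pmul_commute: "pmul j (pmul k f) = pmul k (pmul j f)"
proof
  fix A
  define D where "D j k x = (if j + k \<le> x then f (add_mset (x - (j + k)) (A - {#x#})) else 0)" for j k x
  define G where "G j k x y = (if j \<le> x \<and> k \<le> y then
    f (add_mset (x - j) (add_mset (y - k) (A - {#x#} - {#y#}))) else 0)" for j k x y
  have *: "pmul j (pmul k f) A = (\<Sum>x\<in>#A. D j k x) + (\<Sum>x\<in>#A. \<Sum>y\<in>#A - {#x#}. G j k x y)" for j k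
  proof -
    have "pmul j (pmul k f) A = (\<Sum>x\<in>#A. D j k x + (\<Sum>y\<in>#A - {#x#}. G j k x y))"
      unfolding pmul_def[of j]
    proof (intro sum_mset_cong_strong)
      fix x
      have "(\<Sum>y\<in>#A - {#x#}. if k \<le> y then f (add_mset (x - j) (add_mset (y - k) (A - {#x#} - {#y#}))) else 0)
        = (\<Sum>y\<in>#A - {#x#}. G j k x y)" if "j \<le> x"
        by (intro sum_mset_cong_strong) (auto simp: G_def that)
      then show "(if j \<le> x then pmul k f (add_mset (x - j) (A - {#x#})) else 0) =
         D j k x + (\<Sum>y\<in>#A - {#x#}. G j k x y)"
        by (auto simp: pmul_add_mset D_def G_def)
    qed
    then show ?thesis by (simp add: sum_mset.distrib)
  qed
  have "G j k y x = G k j x y" for x y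
    by (auto simp: G_def add_mset_commute diff_right_commute)
  moreover have "D j k = D k j" by (auto simp: D_def add.commute fun_eq_iff)
  ultimately show "pmul j (pmul k f) A = pmul k (pmul j f) A"
    unfolding * by (subst sum_mset_pairs_swap) simp
qed

lemma pmul_sum: "pmul k (\<lambda>A. \<Sum>i\<in>I. c i * f i A) A = (\<Sum>i\<in>I. c i * pmul k (f i) A)"
  unfolding pmul_def sum_distrib_left
  by (simp add: sum_mset_distrib_left if_distrib flip: sum_mset_sum_swap)
     (auto intro!: sum_mset_cong_strong sum.cong)

definition pm :: "nat multiset \<Rightarrow> nat multiset \<Rightarrow> F" where
  "pm l = fold_mset pmul pone l"

interpretation pmul: comp_fun_commute pmul
  by standard (auto simp: fun_eq_iff pmul_commute)

lemma pm_empty [simp]: "pm {#} = pone"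
  by (simp add: pm_def)

lemma pm_add_mset [simp]: "pm (add_mset k l) = pmul k (pm l)"
  by (simp add: pm_def)

lemma pmul_nonzeroE:
  assumes "pmul k f A \<noteq> 0"
  obtains x where "x \<in># A" "k \<le> x" "f (add_mset (x - k) (A - {#x#})) \<noteq> 0"
proof -
  have "\<exists>x\<in>#A. (if k \<le> x then f (add_mset (x - k) (A - {#x#})) else 0) \<noteq> 0"
  proof (rule ccontr)
    assume *: "\<not> ?thesis"
    have "pmul k f A = (\<Sum>x\<in>#A. 0)"
      unfolding pmul_def by (intro sum_mset_cong_strong) (use * in auto)
    then show False using assms by simp
  qed
  then show ?thesis using that by (auto split: if_splits)
qed

lemma sum_mset_shift:
  assumes "x \<in># A" "k \<le> (x::nat)"
  shows "sum_mset (add_mset (x - k) (A - {#x#})) = sum_mset A - k" "k \<le> sum_mset A"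
proof -
  obtain B where B: "A = add_mset x B" using assms(1) by (metis insert_DiffM)
  show "sum_mset (add_mset (x - k) (A - {#x#})) = sum_mset A - k" "k \<le> sum_mset A"
    using assms(2) by (auto simp: B)
qed

lemma pm_nonzero_degree: "pm l A \<noteq> 0 \<Longrightarrow> sum_mset A = sum_mset l"
proof (induction l arbitrary: A)
  case empty
  then show ?case by (auto simp: pone_def split: if_splits)
next
  case (add k l)
  from add.prems have "pmul k (pm l) A \<noteq> 0" by simp
  then obtain x where x: "x \<in># A" "k \<le> x" "pm l (add_mset (x - k) (A - {#x#})) \<noteq> 0"
    by (rule pmul_nonzeroE)
  from add.IH[OF x(3)] sum_mset_shift[OF x(1,2)] show ?case by auto
qed

text \<open>Coefficient form of x d/dx p_l = sum over k of k x^k dp_l/dp_k, with x the exponent of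
  one singled-out variable. The induction step is the Leibniz rule for multiplication by
  \<open>p_j\<close>.\<close>

lemma pm_chain_rule:
  "of_nat x * pm l (add_mset x A)
    = (\<Sum>k=1..x. of_nat (k * count l k) * pm (l - {#k#}) (add_mset (x - k) A))"
proof (induction l arbitrary: x A)
  case empty
  then show ?case by (simp add: pone_def)
next
  case (add j l)
  define R where "R k = of_nat (k * count l k) * pmul j (pm (l - {#k#})) (add_mset (x - k) A)" for k
  define X where "X k = (if j \<le> x - k then pm (l - {#k#}) (add_mset (x - k - j) A) else 0)" for k
  define Y where "Y k y = (if j \<le> y then pm (l - {#k#}) (add_mset (x - k) (add_mset (y - j) (A - {#y#}))) else 0)" for k y
  have R: "R k = of_nat (k * count l k) * X k + (\<Sum>y\<in>#A. of_nat (k * count l k) * Y k y)" for k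
    unfolding R_def pmul_add_mset X_def Y_def sum_mset_distrib_left[symmetric] distrib_left by (simp add: diff_commute)
  have t1: "(\<Sum>k=1..x. of_nat (k * count l k) * X k) =
      (if j \<le> x then of_nat (x - j) * pm l (add_mset (x - j) A) else 0)"
  proof (cases "j \<le> x")
    case True
    have "of_nat (x - j) * pm l (add_mset (x - j) A)
      = (\<Sum>k=1..x-j. of_nat (k * count l k) * pm (l - {#k#}) (add_mset (x - j - k) A))"
      by (rule add.IH)
    also have "\<dots> = (\<Sum>k=1..x-j. of_nat (k * count l k) * X k)"
      using True by (intro sum.cong) (auto simp: X_def add.commute)
    also have "\<dots> = (\<Sum>k=1..x. of_nat (k * count l k) * X k)"
      by (rule sum.mono_neutral_left) (auto simp: X_def)
    finally show ?thesis using True by simp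
  qed (auto simp: X_def intro!: sum.neutral)
  have t2: "(\<Sum>k=1..x. of_nat (k * count l k) * Y k y) =
      of_nat x * (if j \<le> y then pm l (add_mset x (add_mset (y - j) (A - {#y#}))) else 0)" for y
    by (auto simp: Y_def add.IH)
  have "(\<Sum>k=1..x. of_nat (k * count (add_mset j l) k) * pm (add_mset j l - {#k#}) (add_mset (x - k) A))
     = (\<Sum>k=1..x. R k + (if k = j then of_nat j * pm l (add_mset (x - j) A) else 0))"
  proof (rule sum.cong[OF refl])
    fix k assume "k \<in> {1..x}"
    show "of_nat (k * count (add_mset j l) k) * pm (add_mset j l - {#k#}) (add_mset (x - k) A)
        = R k + (if k = j then of_nat j * pm l (add_mset (x - j) A) else 0)"
    proof (cases "k \<in># l")
      case True
      then obtain l' where l': "l = add_mset k l'" by (metis insert_DiffM)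
      have "add_mset j (add_mset k l') - {#k#} = add_mset j l'"
        by (simp add: add_mset_commute[of j k])
      then show ?thesis by (cases "k = j") (simp_all add: R_def l' distrib_right distrib_left)
    next
      case False
      then show ?thesis by (auto simp: R_def not_in_iff)
    qed
  qed
  \<comment> \<open>The last summand is the derivative of the new factor \<open>p_j\<close>. For j =
    0 the guard removes a term that has the factor j anyway.\<close>
  also have "\<dots> = (\<Sum>k=1..x. R k) + (if 1 \<le> j \<and> j \<le> x then of_nat j * pm l (add_mset (x - j) A) else 0)"
    by (auto simp: sum.distrib sum.delta)
  also have "(\<Sum>k=1..x. R k) = (if j \<le> x then of_nat (x - j) * pm l (add_mset (x - j) A) else 0)
     + of_nat x * (\<Sum>y\<in>#A. if j \<le> y then pm l (add_mset x (add_mset (y - j) (A - {#y#}))) else 0)"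
    unfolding R sum.distrib t1 by (simp only: t2 sum_mset_distrib_left[symmetric] flip: sum_mset_sum_swap) (simp add: sum_mset_distrib_left sum_mset_sum_swap flip: t2)
  also have "(if j \<le> x then of_nat (x - j) * pm l (add_mset (x - j) A) else 0)
     + of_nat x * (\<Sum>y\<in>#A. if j \<le> y then pm l (add_mset x (add_mset (y - j) (A - {#y#}))) else 0)
     + (if 1 \<le> j \<and> j \<le> x then of_nat j * pm l (add_mset (x - j) A) else 0)
     = of_nat x * pmul j (pm l) (add_mset x A)"
    by (auto simp: pmul_add_mset algebra_simps of_nat_diff)
  finally show ?case by simp
qed

section \<open>Power sum coordinates and the scalar product\<close>

definition Par :: "nat \<Rightarrow> nat multiset set" where
  "Par n = {A. sum_mset A = n \<and> 0 \<notin># A}"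

lemma size_le_sum_mset: "0 \<notin># A \<Longrightarrow> size A \<le> sum_mset (A :: nat multiset)"
  by (induction A) auto

lemma finite_Par [simp]: "finite (Par n)"
proof -
  have "Par n \<subseteq> mset ` {xs. set xs \<subseteq> {..n} \<and> length xs \<le> n}"
  proof
    fix A assume A: "A \<in> Par n"
    obtain xs where xs: "A = mset xs" by (metis ex_mset)
    have "x \<le> n" if "x \<in> set xs" for x
      using A that member_le_sum_list[of x xs] by (auto simp: Par_def xs sum_mset_sum_list)
    moreover have "length xs \<le> n"
      using A size_le_sum_mset[of A] by (simp add: Par_def xs)
    ultimately show "A \<in> mset ` {xs. set xs \<subseteq> {..n} \<and> length xs \<le> n}"
      by (auto simp: xs)
  qed
  then show ?thesis
    by (rule finite_subset) (intro finite_imageI finite_lists_length_le, simp)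
qed

lemma sum_Par_remove:
  assumes "1 \<le> k" and "\<And>l. k \<notin># l \<Longrightarrow> F l = (0 :: 'a::comm_monoid_add)"
  shows "(\<Sum>l\<in>Par n. F l) = (if k \<le> n then \<Sum>l\<in>Par (n - k). F (add_mset k l) else 0)"
proof -
  have "(\<Sum>l\<in>Par n. F l) = (\<Sum>l\<in>{l\<in>Par n. k \<in># l}. F l)"
    by (rule sum.mono_neutral_right) (auto simp: assms(2))
  also have "\<dots> = (if k \<le> n then \<Sum>l\<in>Par (n - k). F (add_mset k l) else 0)"
  proof (cases "k \<le> n")
    case True
    have "(\<Sum>l\<in>{l\<in>Par n. k \<in># l}. F l) = (\<Sum>l\<in>Par (n - k). F (add_mset k l))"
    proof (rule sum.reindex_bij_witness[of _ "add_mset k" "\<lambda>l. l - {#k#}"])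
      fix l assume "l \<in> {l \<in> Par n. k \<in># l}"
      then show "add_mset k (l - {#k#}) = l" "F (add_mset k (l - {#k#})) = F l" by auto
      then show "l - {#k#} \<in> Par (n - k)" using \<open>l \<in> {l \<in> Par n. k \<in># l}\<close>
        by (auto simp: Par_def sum_mset_diff dest: in_diffD)
    next
      fix l assume "l \<in> Par (n - k)"
      then show "add_mset k l - {#k#} = l" "add_mset k l \<in> {l \<in> Par n. k \<in># l}"
        using True assms(1) by (auto simp: Par_def)
    qed
    with True show ?thesis by simp
  next
    case False
    have "{l\<in>Par n. k \<in># l} = {}"
      using False by (auto simp: Par_def dest!: multi_member_split)
    with False show ?thesis by (simp only: sum.empty if_False)
  qed
  finally show ?thesis .
qed

text \<open>\<open>ev c\<close> is the symmetric function with power sum coordinates \<open>c\<close>. All degrees are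
  treated at once: no support condition is imposed on \<open>c\<close>.\<close>

definition ev :: "(nat multiset \<Rightarrow> F) \<Rightarrow> nat multiset \<Rightarrow> F" where
  "ev c A = (\<Sum>l\<in>Par (sum_mset A). c l * pm l A)"

definition pcm :: "nat \<Rightarrow> (nat multiset \<Rightarrow> F) \<Rightarrow> nat multiset \<Rightarrow> F" where
  "pcm k c l = (if k \<in># l then c (l - {#k#}) else 0)"

text \<open>This is alpha k d/dp_k, the adjoint of \<open>pcm k\<close>. The number
  \<open>Suc (count l k)\<close> is the multiplicity of k in \<open>add_mset k l\<close>, the
  product that is differentiated.\<close>

definition pdual :: "nat \<Rightarrow> (nat multiset \<Rightarrow> F) \<Rightarrow> nat multiset \<Rightarrow> F" where
  "pdual k c l = alpha * of_nat (k * Suc (count l k)) * c (add_mset k l)"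

lemma ev_pcm:
  assumes "1 \<le> k"
  shows "ev (pcm k c) A = pmul k (ev c) A"
proof -
  let ?n = "sum_mset A"
  have "ev (pcm k c) A = (if k \<le> ?n then \<Sum>l\<in>Par (?n - k). c l * pmul k (pm l) A else 0)"
    unfolding ev_def by (subst sum_Par_remove[OF assms]) (auto simp: pcm_def)
  also have "\<dots> = (\<Sum>l\<in>Par (?n - k). c l * pmul k (pm l) A)"
  proof -
    have "pmul k (pm l) A = 0" if "\<not> k \<le> ?n" for l
      using that sum_mset_shift(2) by (metis pmul_nonzeroE)
    then show ?thesis by simp
  qed
  also have "\<dots> = pmul k (\<lambda>A. \<Sum>l\<in>Par (?n - k). c l * pm l A) A"
    by (rule pmul_sum[symmetric])
  also have "\<dots> = pmul k (ev c) A"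
    unfolding pmul_def
  proof (intro sum_mset_cong_strong)
    fix x assume "x \<in># A"
    then have "sum_mset (add_mset (x - k) (A - {#x#})) = ?n - k" if "k \<le> x"
      using sum_mset_shift(1) that by blast
    then show "(if k \<le> x then \<Sum>l\<in>Par (?n - k). c l * pm l (add_mset (x - k) (A - {#x#})) else 0) =
         (if k \<le> x then ev c (add_mset (x - k) (A - {#x#})) else 0)"
      by (auto simp: ev_def)
  qed
  finally show ?thesis .
qed

text \<open>\<open>pm_chain_rule\<close> summed over all coordinates: differentiation in a single
  variable is expressed by adjoints of power sums alone.\<close>

lemma ev_chain_rule:
  "alpha * of_nat x * ev c (add_mset x A) = (\<Sum>k=1..x. ev (pdual k c) (add_mset (x - k) A))"
proof -
  let ?n = "sum_mset (add_mset x A)"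
  have "(\<Sum>k=1..x. ev (pdual k c) (add_mset (x - k) A))
    = (\<Sum>k=1..x. \<Sum>l\<in>Par ?n. alpha * c l * (of_nat (k * count l k) * pm (l - {#k#}) (add_mset (x - k) A)))"
  proof (rule sum.cong[OF refl])
    fix k assume k: "k \<in> {1..x}"
    have "(\<Sum>l\<in>Par ?n. alpha * c l * (of_nat (k * count l k) * pm (l - {#k#}) (add_mset (x - k) A)))
      = (\<Sum>l\<in>Par (?n - k). alpha * c (add_mset k l) * (of_nat (k * Suc (count l k)) * pm l (add_mset (x - k) A)))"
      using k by (subst sum_Par_remove[of k]) (auto simp: not_in_iff)
    also have "?n - k = sum_mset (add_mset (x - k) A)" using k by auto
    finally show "ev (pdual k c) (add_mset (x - k) A) =
      (\<Sum>l\<in>Par ?n. alpha * c l * (of_nat (k * count l k) * pm (l - {#k#}) (add_mset (x - k) A)))"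
      unfolding ev_def pdual_def by (simp only: mult_ac)
  qed
  also have "\<dots> = (\<Sum>l\<in>Par ?n. alpha * c l * (of_nat x * pm l (add_mset x A)))"
    by (subst sum.swap) (simp only: pm_chain_rule sum_distrib_left)
  also have "\<dots> = alpha * of_nat x * ev c (add_mset x A)"
    unfolding ev_def by (simp only: sum_distrib_left mult_ac)
  finally show ?thesis by simp
qed

text \<open>The norm of \<open>p_l\<close>, that is alpha to the number of parts times z_l.\<close>

definition wt :: "nat multiset \<Rightarrow> F" where
  "wt l = alpha ^ size l * of_nat (\<Prod>i\<in>set_mset l. i ^ count l i * fact (count l i))"

lemma wt_empty [simp]: "wt {#} = 1"
  by (simp add: wt_def)

lemma wt_add_mset: "wt (add_mset k l) = alpha * of_nat (k * Suc (count l k)) * wt l"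
proof -
  define h where "h l i = i ^ count l i * (fact (count l i) :: nat)" for l :: "nat multiset" and i
  have eq: "(\<Prod>i\<in>set_mset l. h l i) = h l k * (\<Prod>i\<in>set_mset l - {k}. h l i)" for l
  proof (cases "k \<in># l")
    case True then show ?thesis by (simp add: prod.remove)
  next
    case False
    then have "h l k = 1" by (simp add: h_def not_in_iff)
    then show ?thesis using False by simp
  qed
  have 2: "(\<Prod>i\<in>set_mset l - {k}. h (add_mset k l) i) = (\<Prod>i\<in>set_mset l - {k}. h l i)"
    by (intro prod.cong) (auto simp: h_def)
  have "(\<Prod>i\<in>set_mset (add_mset k l). h (add_mset k l) i) = k * Suc (count l k) * (\<Prod>i\<in>set_mset l. h l i)"
    unfolding eq by (simp add: 2) (simp add: h_def algebra_simps)
  then show ?thesis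
    unfolding wt_def h_def[symmetric] by simp
qed

lemma wt_pos: "0 \<notin># l \<Longrightarrow> 0 < wt l"
proof (induction l)
  case (add k l)
  then have "(0::F) < of_nat (k * Suc (count l k))" by (subst of_nat_0_less_iff) auto
  with add show ?case unfolding wt_add_mset using alpha_pos by (simp del: of_nat_mult)
qed simp

definition form :: "nat \<Rightarrow> (nat multiset \<Rightarrow> F) \<Rightarrow> (nat multiset \<Rightarrow> F) \<Rightarrow> F" where
  "form n c d = (\<Sum>l\<in>Par n. c l * d l * wt l)"

lemma form_commute: "form n c d = form n d c"
  by (simp add: form_def mult_ac)

lemma form_add_left: "form n (\<lambda>l. c l + c' l) d = form n c d + form n c' d"
  by (simp add: form_def distrib_right sum.distrib)

lemma form_scale_left: "form n (\<lambda>l. s * c l) d = s * form n c d"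
  by (simp add: form_def sum_distrib_left mult_ac)

lemma form_sum_left: "form n (\<lambda>l. \<Sum>i\<in>I. c i l) d = (\<Sum>i\<in>I. form n (c i) d)"
  unfolding form_def sum_distrib_right by (rule sum.swap)

lemma form_add_right: "form n d (\<lambda>l. c l + c' l) = form n d c + form n d c'"
  by (simp add: form_def distrib_right distrib_left sum.distrib)

lemma form_scale_right: "form n d (\<lambda>l. s * c l) = s * form n d c"
  by (simp add: form_def sum_distrib_left mult_ac)

lemma form_sum_right: "form n d (\<lambda>l. \<Sum>i\<in>I. c i l) = (\<Sum>i\<in>I. form n d (c i))"
  by (simp add: form_commute[of n d] form_sum_left)

lemma form_cong:
  "\<lbrakk>\<And>l. l \<in> Par n \<Longrightarrow> c l = c' l; \<And>l. l \<in> Par n \<Longrightarrow> d l = d' l\<rbrakk> \<Longrightarrow> form n c d = form n c' d'"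
  by (simp add: form_def)

text \<open>All weights are positive in the ordered field \<open>F\<close>, so a sum of weighted
  squares vanishes only termwise. This definiteness underlies the projections, the eigenvector
  argument and uniqueness.\<close>

lemma form_self_eq_0:
  assumes "form n c c = 0" "l \<in> Par n"
  shows "c l = 0"
proof -
  have nonneg: "0 \<le> c i * c i * wt i" if "i \<in> Par n" for i
    using that wt_pos[of i] by (intro mult_nonneg_nonneg zero_le_square) (auto simp: Par_def)
  have "\<forall>i\<in>Par n. c i * c i * wt i = 0"
    by (rule iffD1[OF sum_nonneg_eq_0_iff]) (use assms(1) nonneg in \<open>auto simp: form_def\<close>)
  then have "c l * c l * wt l = 0" using assms(2) by blast
  moreover have "wt l \<noteq> 0" using assms(2) wt_pos[of l] by (auto simp: Par_def)
  ultimately show ?thesis by simp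
qed

lemma form_pcm:
  assumes "1 \<le> k" "k \<le> n"
  shows "form n (pcm k c) d = form (n - k) c (pdual k d)"
  unfolding form_def
  by (subst sum_Par_remove[OF assms(1)]) (auto simp: assms(2) pcm_def pdual_def wt_add_mset mult_ac)

section \<open>Self-adjoint operators from a Lax matrix\<close>

text \<open>A sequence \<open>f\<close> stands for \<open>\<Sum>\<^sub>a x^a f\<^sub>a\<close> with one marked variable \<open>x\<close>. The operator \<open>Lax\<close> is a
  Heckman--Dunkl operator of the Calogero--Sutherland model acting on it, in the form of a Lax matrix
  of the Benjamin--Ono hierarchy. Its entries \<open>(a + k, a)\<close> and \<open>(a, a + k)\<close> are adjoint to each other,
  so that it is visibly self-adjoint.\<close>

definition Lax :: "(nat \<Rightarrow> nat multiset \<Rightarrow> F) \<Rightarrow> nat \<Rightarrow> nat multiset \<Rightarrow> F" where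
  "Lax f a l = ((alpha - 1) * of_nat a + 1) * f a l
     + (\<Sum>k=1..<a. pdual k (f (a - k)) l) + (\<Sum>t=1..sum_mset l. pcm t (f (a + t)) l)"

text \<open>The powers of the marked variable count as orthonormal; in total degree n the
  coefficient of x^a has degree n - a.\<close>

definition seqform :: "nat \<Rightarrow> (nat \<Rightarrow> nat multiset \<Rightarrow> F) \<Rightarrow> (nat \<Rightarrow> nat multiset \<Rightarrow> F) \<Rightarrow> F" where
  "seqform n f h = (\<Sum>a=1..n. form (n - a) (f a) (h a))"

lemma seqform_Lax: "seqform n (Lax f) h = seqform n f (Lax h)"
proof -
  define D where "D f h = (\<Sum>a=1..n. ((alpha - 1) * of_nat a + 1) * form (n - a) (f a) (h a))" for f h
  define U where "U f h = (\<Sum>a=1..n. \<Sum>k=1..<a. form (n - a) (pdual k (f (a - k))) (h a))" for f h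
  define V where "V f h = (\<Sum>a=1..n. \<Sum>t=1..n-a. form (n - a) (pcm t (f (a + t))) (h a))" for f h
  have *: "seqform n (Lax f) h = D f h + U f h + V f h" for f h
  proof -
    have "form (n - a) (Lax f a) (h a) = ((alpha - 1) * of_nat a + 1) * form (n - a) (f a) (h a)
       + (\<Sum>k=1..<a. form (n - a) (pdual k (f (a - k))) (h a))
       + (\<Sum>t=1..n-a. form (n - a) (pcm t (f (a + t))) (h a))" for a
    proof -
      have "form (n - a) (Lax f a) (h a) = form (n - a) (\<lambda>l. (((alpha - 1) * of_nat a + 1) * f a l
          + (\<Sum>k=1..<a. pdual k (f (a - k)) l)) + (\<Sum>t=1..n-a. pcm t (f (a + t)) l)) (h a)"
        by (intro form_cong) (auto simp: Lax_def Par_def)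
      then show ?thesis
        by (simp only: form_add_left form_sum_left form_scale_left)
    qed
    then show ?thesis by (simp add: seqform_def D_def U_def V_def sum.distrib)
  qed
  \<comment> \<open>The pair (a, t) stands for the entry of \<open>Lax\<close> leading from a + t to
    a, which is multiplication by \<open>p_t\<close>. Its mirror image leads from a to a + t and is
    the adjoint of \<open>p_t\<close>.\<close>
  have "U f h = V h f" for f h
  proof -
    have "V h f = (\<Sum>(a,t)\<in>Sigma {1..n} (\<lambda>a. {1..n-a}). form (n - a) (pcm t (h (a + t))) (f a))"
      unfolding V_def by (rule sum.Sigma) auto
    also have "\<dots> = (\<Sum>(a,k)\<in>Sigma {1..n} (\<lambda>a. {1..<a}). form (n - a) (pdual k (f (a - k))) (h a))"
    proof (rule sum.reindex_bij_witness[of _ "\<lambda>(a,k). (a - k, k)" "\<lambda>(a,t). (a + t, t)"], goal_cases)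
      case (5 x)
      then show ?case by (auto simp: form_pcm form_commute[of _ "pdual _ _"])
    qed auto
    also have "\<dots> = U f h" unfolding U_def by (rule sum.Sigma[symmetric]) auto
    finally show ?thesis by simp
  qed
  moreover have "D f h = D h f" by (simp add: D_def form_commute)
  ultimately show ?thesis
    using *[of f h] *[of h f] by (simp add: seqform_def form_commute add_ac)
qed

lemma seqform_Lax_funpow: "seqform n ((Lax ^^ k) f) h = seqform n f ((Lax ^^ k) h)"
proof (induction k arbitrary: f h)
  case (Suc k)
  have "seqform n ((Lax ^^ Suc k) f) h = seqform n ((Lax ^^ k) f) (Lax h)"
    by (simp add: seqform_Lax)
  also have "\<dots> = seqform n f ((Lax ^^ Suc k) h)"
    unfolding Suc by (simp add: funpow_swap1)
  finally show ?case .
qed simp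

definition Ham :: "nat \<Rightarrow> (nat multiset \<Rightarrow> F) \<Rightarrow> nat multiset \<Rightarrow> F" where
  "Ham k c l = (\<Sum>a=1..sum_mset l. pcm a ((Lax ^^ k) (\<lambda>b. pdual b c) a) l)"

lemma form_Ham: "form n (Ham k c) d = form n c (Ham k d)"
proof -
  have *: "form n (Ham k c) d = seqform n ((Lax ^^ k) (\<lambda>b. pdual b c)) (\<lambda>b. pdual b d)" for c d
  proof -
    have "form n (Ham k c) d = form n (\<lambda>l. \<Sum>a=1..n. pcm a ((Lax ^^ k) (\<lambda>b. pdual b c) a) l) d"
      by (intro form_cong) (auto simp: Ham_def Par_def)
    also have "\<dots> = seqform n ((Lax ^^ k) (\<lambda>b. pdual b c)) (\<lambda>b. pdual b d)"
      unfolding form_sum_left seqform_def by (intro sum.cong) (auto simp: form_pcm)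
    finally show ?thesis .
  qed
  have "form n c (Ham k d) = seqform n (\<lambda>b. pdual b c) ((Lax ^^ k) (\<lambda>b. pdual b d))"
    unfolding form_commute[of n c] * seqform_def by (simp add: form_commute)
  then show ?thesis using * seqform_Lax_funpow by simp
qed

section \<open>Heckman--Dunkl operators\<close>

lemma ev_add: "ev (\<lambda>l. c l + d l) A = ev c A + ev d A"
  by (simp add: ev_def distrib_right sum.distrib)

lemma ev_scale: "ev (\<lambda>l. s * c l) A = s * ev c A"
  by (simp add: ev_def sum_distrib_left mult_ac)

lemma ev_sum: "ev (\<lambda>l. \<Sum>i\<in>I. c i l) A = (\<Sum>i\<in>I. ev (c i) A)"
  unfolding ev_def sum_distrib_right by (rule sum.swap)

lemma ev_cong: "(\<And>l. l \<in> Par (sum_mset A) \<Longrightarrow> c l = d l) \<Longrightarrow> ev c A = ev d A"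
  by (simp add: ev_def)

lemma ev_Lax:
  "ev (Lax f a) B = ((alpha - 1) * of_nat a + 1) * ev (f a) B
     + (\<Sum>k=1..<a. ev (pdual k (f (a - k))) B) + (\<Sum>t=1..sum_mset B. pmul t (ev (f (a + t))) B)"
proof -
  have "ev (Lax f a) B = ev (\<lambda>l. (((alpha - 1) * of_nat a + 1) * f a l
     + (\<Sum>k=1..<a. pdual k (f (a - k)) l)) + (\<Sum>t=1..sum_mset B. pcm t (f (a + t)) l)) B"
    by (intro ev_cong) (auto simp: Lax_def Par_def)
  then show ?thesis
    by (simp only: ev_add ev_sum ev_scale) (simp add: ev_pcm)
qed

text \<open>\<open>Phi f x A\<close> is the coefficient at (marked exponent \<open>x\<close>, other exponents \<open>A\<close>) of
  \<open>\<Sum>\<^sub>a x^a f\<^sub>a\<close>.\<close>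

definition Phi :: "(nat \<Rightarrow> nat multiset \<Rightarrow> F) \<Rightarrow> nat \<Rightarrow> nat multiset \<Rightarrow> F" where
  "Phi f x A = (\<Sum>a=1..x. ev (f a) (add_mset (x - a) A))"

text \<open>The Heckman--Dunkl operator
  \<open>\<alpha> x\<^sub>0 \<partial>\<^sub>0 + \<Sum>\<^sub>j (x\<^sub>0 / (x\<^sub>0 - x\<^sub>j) (1 - s\<^sub>0\<^sub>j) - 1)\<close> on coefficients; the summand \<open>-1\<close> makes it well defined
  for infinitely many variables.\<close>

definition Dun :: "(nat \<Rightarrow> nat multiset \<Rightarrow> F) \<Rightarrow> nat \<Rightarrow> nat multiset \<Rightarrow> F" where
  "Dun g x A = alpha * of_nat x * g x A + (\<Sum>y\<in>#A.
     (\<Sum>u=Suc (max x y)..x+y. g u (add_mset (x + y - u) (A - {#y#})) - g (x + y - u) (add_mset u (A - {#y#})))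
       - g (min x y) (add_mset (max x y) (A - {#y#})))"

text \<open>Say x <= y. By symmetry the region q < min x y may be replaced by p < x. Inside the
  triangle, q >= y already forces p < x, so removing that part leaves the rectangle.\<close>

lemma sum_symmetric_triangle:
  fixes G :: "nat \<Rightarrow> nat \<Rightarrow> 'a::ab_group_add" and x y :: nat
  assumes sym: "\<And>p q. G p q = G q p"
  defines "S P \<equiv> \<Sum>(p,q)\<in>{(p,q). p + q < x + y \<and> P p q}. G p q"
  shows "S (\<lambda>p q. p < x \<and> q < y) = S (\<lambda>p q. q < min x y) - S (\<lambda>p q. max x y \<le> q)"
proof -
  have fin: "finite {(p,q). p + q < x + y \<and> P p q}" for P
    by (rule finite_subset[of _ "{..x+y} \<times> {..x+y}"]) auto
  have S_sym: "S P = S (\<lambda>p q. P q p)" for P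
    unfolding S_def
    by (rule sum.reindex_bij_witness[of _ prod.swap prod.swap]) (auto simp: sym)
  have S_split: "S P = S (\<lambda>p q. P p q \<and> Q p q) + S (\<lambda>p q. P p q \<and> \<not> Q p q)" for P Q
    unfolding S_def by (subst sum.union_disjoint[symmetric]) (auto intro!: fin sum.cong simp del: sum.union_disjoint)
  have S_cong: "S P = S Q" if "\<And>p q. p + q < x + y \<Longrightarrow> P p q = Q p q" for P Q
    unfolding S_def using that by (intro sum.cong) auto
  show ?thesis
  proof (cases "x \<le> y")
    case True
    have "S (\<lambda>p q. q < min x y) = S (\<lambda>p q. p < x)"
      using True by (subst S_sym) (simp add: min_def)
    also have "\<dots> = S (\<lambda>p q. p < x \<and> q < y) + S (\<lambda>p q. p < x \<and> \<not> q < y)"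
      by (rule S_split)
    also have "S (\<lambda>p q. p < x \<and> \<not> q < y) = S (\<lambda>p q. max x y \<le> q)"
      using True by (intro S_cong) (auto simp: max_def)
    finally show ?thesis by simp
  next
    case False
    have "S (\<lambda>p q. q < min x y) = S (\<lambda>p q. q < y \<and> p < x) + S (\<lambda>p q. q < y \<and> \<not> p < x)"
      using False by (subst S_split) (simp add: min_def)
    also have "S (\<lambda>p q. q < y \<and> \<not> p < x) = S (\<lambda>p q. max x y \<le> p)"
      using False by (intro S_cong) (auto simp: max_def)
    also have "\<dots> = S (\<lambda>p q. max x y \<le> q)" by (rule S_sym)
    finally show ?thesis by (simp add: conj_commute)
  qed
qed

text \<open>Coefficient form of x (x^a - y^a) / (x - y) - x^a = sum of x^c y^t over c + t = a with
  c, t >= 1, multiplied by the symmetric f_a. Expanding 1 / (x - y) and cancelling antisymmetric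
  terms is what leaves only u > max x y.\<close>

lemma Phi_swap_sum:
  fixes x y :: nat
  shows "(\<Sum>c=1..x. \<Sum>t=1..y. ev (f (c + t)) (add_mset (x - c) (add_mset (y - t) B)))
   = (\<Sum>u=Suc (max x y)..x+y. Phi f u (add_mset (x + y - u) B) - Phi f (x + y - u) (add_mset u B))
       - Phi f (min x y) (add_mset (max x y) B)"
proof -
  define G where "G p q = ev (f (x + y - (p + q))) (add_mset p (add_mset q B))" for p q
  define S where "S P = (\<Sum>(p,q)\<in>{(p,q). p + q < x + y \<and> P p q}. G p q)" for P
  have G_sym: "G p q = G q p" for p q by (simp add: G_def add.commute add_mset_commute)
  have Phi_G: "Phi f u (add_mset (x + y - u) B) = (\<Sum>a=1..u. G (u - a) (x + y - u))" if "u \<le> x + y" for u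
    unfolding Phi_def
  proof (rule sum.cong[OF refl])
    fix a assume "a \<in> {1..u}"
    then have "x + y - (u - a + (x + y - u)) = a" using that by auto
    then show "ev (f a) (add_mset (u - a) (add_mset (x + y - u) B)) = G (u - a) (x + y - u)"
      by (simp only: G_def)
  qed
  have "(\<Sum>c=1..x. \<Sum>t=1..y. ev (f (c + t)) (add_mset (x - c) (add_mset (y - t) B)))
      = (\<Sum>(c,t)\<in>{1..x} \<times> {1..y}. ev (f (c + t)) (add_mset (x - c) (add_mset (y - t) B)))"
    by (simp add: sum.cartesian_product)
  also have "\<dots> = S (\<lambda>p q. p < x \<and> q < y)"
    unfolding S_def
  proof (rule sum.reindex_bij_witness[of _ "\<lambda>(p,q). (x - p, y - q)" "\<lambda>(c,t). (x - c, y - t)"], goal_cases)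
    case (5 z)
    obtain c t where z: "z = (c, t)" by (cases z)
    have "x + y - (x - c + (y - t)) = c + t" using 5 by (auto simp: z)
    then show ?case by (simp add: z G_def)
  qed auto
  also have "\<dots> = S (\<lambda>p q. q < min x y) - S (\<lambda>p q. max x y \<le> q)"
    unfolding S_def by (rule sum_symmetric_triangle) (rule G_sym)
  also have "S (\<lambda>p q. q < min x y) = (\<Sum>u=Suc (max x y)..x+y. Phi f u (add_mset (x + y - u) B))"
  proof -
    have "(\<Sum>u=Suc (max x y)..x+y. Phi f u (add_mset (x + y - u) B))
      = (\<Sum>u=Suc (max x y)..x+y. \<Sum>a=1..u. G (u - a) (x + y - u))"
      by (intro sum.cong) (auto simp: Phi_G)
    also have "\<dots> = (\<Sum>(u,a)\<in>Sigma {Suc (max x y)..x+y} (\<lambda>u. {1..u}). G (u - a) (x + y - u))"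
      by (rule sum.Sigma) auto
    also have "\<dots> = S (\<lambda>p q. q < min x y)"
      unfolding S_def
      by (rule sum.reindex_bij_witness[of _ "\<lambda>(p,q). (x + y - q, x + y - p - q)" "\<lambda>(u,a). (u - a, x + y - u)"])
         (auto simp: min_def max_def split: if_splits)
    finally show ?thesis by simp
  qed
  also have "S (\<lambda>p q. max x y \<le> q) = (\<Sum>u=Suc (max x y)..x+y. Phi f (x + y - u) (add_mset u B))
       + Phi f (min x y) (add_mset (max x y) B)"
  proof -
    have "(\<Sum>u=Suc (max x y)..x+y. Phi f (x + y - u) (add_mset u B))
       + Phi f (min x y) (add_mset (max x y) B) = (\<Sum>u=max x y..x+y. Phi f (x + y - u) (add_mset u B))"
    proof -
      have "x + y - max x y = min x y" by (auto simp: max_def min_def)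
      then show ?thesis
        by (subst (2) sum.atLeast_Suc_atMost) auto
    qed
    also have "\<dots> = (\<Sum>v=0..min x y. Phi f v (add_mset (x + y - v) B))"
      by (rule sum.reindex_bij_witness[of _ "\<lambda>v. x + y - v" "\<lambda>u. x + y - u"]) auto
    also have "\<dots> = (\<Sum>v=0..min x y. \<Sum>a=1..v. G (v - a) (x + y - v))"
      by (intro sum.cong) (auto simp: Phi_G)
    also have "\<dots> = (\<Sum>(u,a)\<in>Sigma {0..min x y} (\<lambda>u. {1..u}). G (u - a) (x + y - u))"
      by (rule sum.Sigma) auto
    also have "\<dots> = S (\<lambda>p q. max x y \<le> q)"
      unfolding S_def
      by (rule sum.reindex_bij_witness[of _ "\<lambda>(p,q). (x + y - q, x + y - p - q)" "\<lambda>(u,a). (u - a, x + y - u)"])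
         (auto simp: min_def max_def split: if_splits)
    finally show ?thesis by simp
  qed
  finally show ?thesis by (simp add: sum_subtractf)
qed

text \<open>The derivative in \<open>Dun\<close> yields the \<open>pdual\<close> entries of
  \<open>Lax\<close>. Its exchange terms yield the contribution of the unmarked variables to the
  power sums \<open>p_t\<close>; the contribution of the marked variable only corrects the
  diagonal.\<close>

lemma Phi_Lax: "Phi (Lax f) = Dun (Phi f)"
proof (intro ext)
  fix x A
  define E where "E a = ev (f a) (add_mset (x - a) A)" for a
  define K where "K = (\<Sum>c=1..x. \<Sum>k=1..<c. ev (pdual k (f (c - k))) (add_mset (x - c) A))"
  have K: "K = (\<Sum>a=1..x. \<Sum>k=1..x-a. ev (pdual k (f a)) (add_mset (x - a - k) A))"
  proof -
    have "K = (\<Sum>(c,k)\<in>Sigma {1..x} (\<lambda>c. {1..<c}). ev (pdual k (f (c - k))) (add_mset (x - c) A))"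
      unfolding K_def by (rule sum.Sigma) auto
    also have "\<dots> = (\<Sum>(a,k)\<in>Sigma {1..x} (\<lambda>a. {1..x-a}). ev (pdual k (f a)) (add_mset (x - a - k) A))"
      by (rule sum.reindex_bij_witness[of _ "\<lambda>(a,k). (a + k, k)" "\<lambda>(c,k). (c - k, k)"]) auto
    also have "\<dots> = (\<Sum>a=1..x. \<Sum>k=1..x-a. ev (pdual k (f a)) (add_mset (x - a - k) A))"
      by (rule sum.Sigma[symmetric]) auto
    finally show ?thesis .
  qed
  \<comment> \<open>Leibniz rule: alpha x d/dx hits the power x^a, giving alpha a, or the
    coefficient f_a, giving \<open>K\<close>.\<close>
  have diag: "alpha * of_nat x * Phi f x A = (\<Sum>a=1..x. alpha * of_nat a * E a) + K"
  proof -
    have "alpha * of_nat x * ev (f a) (add_mset (x - a) A) = alpha * of_nat a * E a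
       + (\<Sum>k=1..x-a. ev (pdual k (f a)) (add_mset (x - a - k) A))" if "a \<in> {1..x}" for a
    proof -
      have "(of_nat x :: F) = of_nat a + of_nat (x - a)" using that by (simp flip: of_nat_add)
      then have "alpha * of_nat x * ev (f a) (add_mset (x - a) A) = alpha * of_nat a * E a
         + alpha * of_nat (x - a) * ev (f a) (add_mset (x - a) A)"
        by (simp only: E_def distrib_left distrib_right)
      then show ?thesis by (simp only: ev_chain_rule)
    qed
    then show ?thesis by (simp add: K Phi_def sum_distrib_left sum.distrib)
  qed
  define X where "X c t = (if t \<le> x - c then ev (f (c + t)) (add_mset (x - c - t) A) else 0)" for c t
  define Y where "Y c t y = (if t \<le> y then ev (f (c + t)) (add_mset (x - c) (add_mset (y - t) (A - {#y#}))) else 0)" for c t y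
  have XY: "pmul t (ev (f (c + t))) (add_mset (x - c) A) = X c t + (\<Sum>y\<in>#A. Y c t y)" for c t
    by (simp add: pmul_add_mset X_def Y_def)
  \<comment> \<open>The share x^t of the marked variable in \<open>p_t\<close>. There are a - 1 ways
    to write a = c + t with c, t >= 1, and (alpha - 1) a + 1 + (a - 1) = alpha a: this dictates the
    diagonal of \<open>Lax\<close>.\<close>
  have X: "(\<Sum>c=1..x. \<Sum>t=1..x - c + sum_mset A. X c t) = (\<Sum>a=1..x. (of_nat a - 1) * E a)"
  proof -
    have "(\<Sum>c=1..x. \<Sum>t=1..x - c + sum_mset A. X c t) = (\<Sum>c=1..x. \<Sum>t=1..x - c. X c t)"
      by (intro sum.cong refl sum.mono_neutral_right) (auto simp: X_def)
    also have "\<dots> = (\<Sum>(c,t)\<in>Sigma {1..x} (\<lambda>c. {1..x-c}). X c t)"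
      by (rule sum.Sigma) auto
    also have "\<dots> = (\<Sum>(a,t)\<in>Sigma {1..x} (\<lambda>a. {1..<a}). E a)"
      by (rule sum.reindex_bij_witness[of _ "\<lambda>(a,t). (a - t, t)" "\<lambda>(c,t). (c + t, t)"]) (auto simp: X_def E_def)
    also have "\<dots> = (\<Sum>a=1..x. \<Sum>t=1..<a. E a)"
      by (rule sum.Sigma[symmetric]) auto
    also have "\<dots> = (\<Sum>a=1..x. (of_nat a - 1) * E a)"
      by (intro sum.cong) (auto simp: of_nat_diff)
    finally show ?thesis .
  qed
  have Y: "(\<Sum>c=1..x. \<Sum>t=1..x - c + sum_mset A. Y c t y)
     = (\<Sum>u=Suc (max x y)..x+y. Phi f u (add_mset (x + y - u) (A - {#y#})) - Phi f (x + y - u) (add_mset u (A - {#y#})))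
       - Phi f (min x y) (add_mset (max x y) (A - {#y#}))" if "y \<in># A" for y
  proof -
    have "y \<le> sum_mset A" using that by (auto dest!: multi_member_split)
    then have "(\<Sum>c=1..x. \<Sum>t=1..x - c + sum_mset A. Y c t y) = (\<Sum>c=1..x. \<Sum>t=1..y. Y c t y)"
      by (intro sum.cong refl sum.mono_neutral_right) (auto simp: Y_def)
    also have "\<dots> = (\<Sum>c=1..x. \<Sum>t=1..y. ev (f (c + t)) (add_mset (x - c) (add_mset (y - t) (A - {#y#}))))"
      by (intro sum.cong) (auto simp: Y_def)
    finally show ?thesis by (simp only: Phi_swap_sum)
  qed
  have "Phi (Lax f) x A = (\<Sum>a=1..x. ((alpha - 1) * of_nat a + 1) * E a) + K
      + (\<Sum>c=1..x. \<Sum>t=1..x - c + sum_mset A. X c t + (\<Sum>y\<in>#A. Y c t y))"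
    by (simp add: Phi_def ev_Lax sum.distrib XY E_def K_def)
  also have "\<dots> = (\<Sum>a=1..x. ((alpha - 1) * of_nat a + 1) * E a) + K + (\<Sum>a=1..x. (of_nat a - 1) * E a)
      + (\<Sum>y\<in>#A. \<Sum>c=1..x. \<Sum>t=1..x - c + sum_mset A. Y c t y)"
    by (simp only: sum.distrib X add.assoc flip: sum_mset_sum_swap)
  also have "\<dots> = alpha * of_nat x * Phi f x A
      + (\<Sum>y\<in>#A. \<Sum>c=1..x. \<Sum>t=1..x - c + sum_mset A. Y c t y)"
    unfolding diag by (simp add: algebra_simps flip: sum.distrib)
  also have "\<dots> = Dun (Phi f) x A"
    unfolding Dun_def by (intro arg_cong2[of _ _ _ _ "(+)"] refl sum_mset_cong_strong) (rule Y)
  finally show "Phi (Lax f) x A = Dun (Phi f) x A" .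
qed

lemma Phi_Lax_funpow: "Phi ((Lax ^^ k) f) = (Dun ^^ k) (Phi f)"
  by (induction k) (simp_all add: Phi_Lax)

definition marked :: "(nat multiset \<Rightarrow> F) \<Rightarrow> nat \<Rightarrow> nat multiset \<Rightarrow> F" where
  "marked \<phi> x B = alpha * of_nat x * \<phi> (add_mset x B)"

definition HamM :: "nat \<Rightarrow> (nat multiset \<Rightarrow> F) \<Rightarrow> nat multiset \<Rightarrow> F" where
  "HamM k \<phi> A = (\<Sum>x\<in>#A. (Dun ^^ k) (marked \<phi>) x (A - {#x#}))"

text \<open>Multiplying each f_a by \<open>p_a\<close> and summing over a amounts to substituting
  every variable in turn for the marked one in the sum of x^a f_a. The initial sequence
  \<open>pdual b c\<close> is the marked derivative by \<open>ev_chain_rule\<close>.\<close>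

lemma ev_Ham: "ev (Ham k c) = HamM k (ev c)"
proof
  fix A
  define f where "f = (Lax ^^ k) (\<lambda>b. pdual b c)"
  have "ev (Ham k c) A = ev (\<lambda>l. \<Sum>a=1..sum_mset A. pcm a (f a) l) A"
    by (intro ev_cong) (auto simp: Ham_def f_def Par_def)
  also have "\<dots> = (\<Sum>a=1..sum_mset A. pmul a (ev (f a)) A)"
    by (simp add: ev_sum ev_pcm)
  also have "\<dots> = (\<Sum>x\<in>#A. \<Sum>a=1..sum_mset A. if a \<le> x then ev (f a) (add_mset (x - a) (A - {#x#})) else 0)"
    by (simp add: pmul_def sum_mset_sum_swap)
  also have "\<dots> = (\<Sum>x\<in>#A. Phi f x (A - {#x#}))"
  proof (intro sum_mset_cong_strong)
    fix x assume "x \<in># A"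
    then have "x \<le> sum_mset A" by (auto dest!: multi_member_split)
    then have "(\<Sum>a=1..sum_mset A. if a \<le> x then ev (f a) (add_mset (x - a) (A - {#x#})) else 0)
       = (\<Sum>a=1..x. if a \<le> x then ev (f a) (add_mset (x - a) (A - {#x#})) else 0)"
      by (intro sum.mono_neutral_right) auto
    then show "(\<Sum>a=1..sum_mset A. if a \<le> x then ev (f a) (add_mset (x - a) (A - {#x#})) else 0)
       = Phi f x (A - {#x#})" by (simp add: Phi_def)
  qed
  also have "Phi f = (Dun ^^ k) (marked (ev c))"
  proof -
    have "Phi (\<lambda>b. pdual b c) = marked (ev c)"
      by (simp add: fun_eq_iff Phi_def marked_def ev_chain_rule)
    then show ?thesis by (simp add: f_def Phi_Lax_funpow)
  qed
  finally show "ev (Ham k c) A = HamM k (ev c) A" by (simp add: HamM_def)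
qed

section \<open>Dominance order\<close>

text \<open>Dominance in terms of \<open>\<Sum>\<^sub>i max(\<lambda>\<^sub>i - t, 0)\<close>, the Legendre dual of the partial sums; this version
  does not need sorted sequences.\<close>

definition hinge :: "nat multiset \<Rightarrow> nat \<Rightarrow> nat" where
  "hinge A t = (\<Sum>x\<in>#A. x - t)"

definition dle :: "nat multiset \<Rightarrow> nat multiset \<Rightarrow> bool" where
  "dle A B \<longleftrightarrow> sum_mset A = sum_mset B \<and> (\<forall>t. hinge A t \<le> hinge B t)"

text \<open>\<open>dle\<close> does not see zeros and is only a preorder on multisets, so strictness
  has to mean that the reverse relation fails.\<close>

definition dlt :: "nat multiset \<Rightarrow> nat multiset \<Rightarrow> bool" where
  "dlt A B \<longleftrightarrow> dle A B \<and> \<not> dle B A"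

lemma hinge_add_mset [simp]: "hinge (add_mset x A) t = (x - t) + hinge A t"
  by (simp add: hinge_def)

lemma dle_refl [simp]: "dle A A"
  by (simp add: dle_def)

lemma dle_trans: "dle A B \<Longrightarrow> dle B C \<Longrightarrow> dle A C"
  by (auto simp: dle_def intro: order_trans)

lemma dlt_dle_trans: "dlt A B \<Longrightarrow> dle B C \<Longrightarrow> dlt A C"
  unfolding dlt_def using dle_trans by blast

lemma dle_dlt_trans: "dle A B \<Longrightarrow> dlt B C \<Longrightarrow> dlt A C"
  unfolding dlt_def using dle_trans by blast

lemma dle_shift:
  assumes "max x y \<le> u" "u \<le> x + y"
  shows "dle (add_mset x (add_mset y B)) (add_mset u (add_mset (x + y - u) B))"
  using assms by (auto simp: dle_def)

text \<open>At the threshold max x y the two old exponents have no excess, while u has.\<close>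

lemma dlt_shift:
  assumes "max x y < u" "u \<le> x + y"
  shows "dlt (add_mset x (add_mset y B)) (add_mset u (add_mset (x + y - u) B))"
  unfolding dlt_def
proof
  show "dle (add_mset x (add_mset y B)) (add_mset u (add_mset (x + y - u) B))"
    using assms by (intro dle_shift) auto
  have "hinge (add_mset u (add_mset (x + y - u) B)) (max x y) > hinge (add_mset x (add_mset y B)) (max x y)"
  proof -
    have "x - max x y = 0" "y - max x y = 0" "0 < u - max x y" using assms by auto
    then show ?thesis unfolding hinge_add_mset by linarith
  qed
  then show "\<not> dle (add_mset u (add_mset (x + y - u) B)) (add_mset x (add_mset y B))"
    by (meson dle_def not_le)
qed

lemma hinge_Suc: "hinge A t = hinge A (Suc t) + size (filter_mset (\<lambda>x. t < x) A)"
  by (induction A) (auto simp: hinge_def)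

lemma size_filter_greater: "size (filter_mset (\<lambda>x. t < x) A) = count A (Suc t) + size (filter_mset (\<lambda>x. Suc t < x) A)"
  by (induction A) auto

text \<open>Second differences of \<open>hinge\<close> are multiplicities: a first difference counts
  the parts above t, and consecutive counts differ by the multiplicity of t + 1.\<close>

lemma hinge_inject:
  assumes "\<And>t. hinge A t = hinge B t" "0 \<notin># A" "0 \<notin># B"
  shows "A = B"
proof (rule multiset_eqI)
  fix k
  have s: "size (filter_mset (\<lambda>x. t < x) A) = size (filter_mset (\<lambda>x. t < x) B)" for t
    using hinge_Suc[of A t] hinge_Suc[of B t] assms(1) by simp
  show "count A k = count B k"
    using assms(2,3) s[of "k - 1"] s[of k] size_filter_greater[of "k - 1" A] size_filter_greater[of "k - 1" B]
    by (cases k) (auto simp: not_in_iff)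
qed

lemma dle_antisym: "\<lbrakk>dle A B; dle B A; 0 \<notin># A; 0 \<notin># B\<rbrakk> \<Longrightarrow> A = B"
  by (rule hinge_inject) (auto simp: dle_def intro: antisym)

lemma dlt_iff: "\<lbrakk>0 \<notin># A; 0 \<notin># B\<rbrakk> \<Longrightarrow> dlt A B \<longleftrightarrow> dle A B \<and> A \<noteq> B"
  by (auto simp: dlt_def dest: dle_antisym)

text \<open>With truncated subtraction the sum is x (x - 1) / 2. Sums of squares are thus positive
  combinations of hinges, which makes them strictly monotone for dominance.\<close>

lemma square_eq_sum_hinge: "x \<le> n \<Longrightarrow> x\<^sup>2 = x + 2 * (\<Sum>t=1..n. x - t)" for x n :: nat
proof (induction n arbitrary: x)
  case (Suc n)
  show ?case
  proof (cases x)
    case (Suc m)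
    have "(\<Sum>t=1..Suc n. x - t) = m + (\<Sum>t=1..n. m - t)"
      by (simp only: Suc sum.atLeast_Suc_atMost[of 1 "Suc n"] sum.atLeast_Suc_atMost_Suc_shift) simp
    then show ?thesis using Suc.IH[of m] Suc.prems Suc by (simp add: power2_eq_square)
  qed (auto simp: power2_eq_square)
qed simp

lemma sum_squares_eq: 
  assumes "\<And>x. x \<in># A \<Longrightarrow> x \<le> n"
  shows "(\<Sum>x\<in>#A. x\<^sup>2) = sum_mset A + 2 * (\<Sum>t=1..n. hinge A t)"
proof -
  have "(\<Sum>x\<in>#A. x\<^sup>2) = (\<Sum>x\<in>#A. x + 2 * (\<Sum>t=1..n. x - t))"
    by (intro sum_mset_cong_strong square_eq_sum_hinge assms)
  also have "\<dots> = sum_mset A + 2 * (\<Sum>t=1..n. hinge A t)"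
    by (simp only: sum_mset.distrib sum_mset_distrib_left[symmetric] sum_mset_sum_swap hinge_def) simp
  finally show ?thesis .
qed

lemma member_le_sum_mset: "x \<in># A \<Longrightarrow> x \<le> sum_mset (A :: nat multiset)"
  by (auto dest!: multi_member_split)

lemma dlt_sum_squares:
  assumes "dlt A B"
  shows "(\<Sum>x\<in>#A. x\<^sup>2) < (\<Sum>x\<in>#B. x\<^sup>2)"
proof -
  define n where "n = sum_mset A"
  have n: "sum_mset B = n" and le: "hinge A t \<le> hinge B t" for t
    using assms by (auto simp: dlt_def dle_def n_def)
  obtain t where t: "hinge A t < hinge B t"
    using assms n by (auto simp: dlt_def dle_def n_def not_le)
  have "hinge B t = 0" if "n < t"
    unfolding hinge_def using that member_le_sum_mset[of _ B] n by (fastforce simp: sum_mset_0_iff)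
  with t have "t \<le> n" by (cases "n < t") auto
  moreover have "t \<noteq> 0" using t n by (auto simp: hinge_def n_def intro: gr0I)
  ultimately have "t \<in> {1..n}" by auto
  then have "(\<Sum>t=1..n. hinge A t) < (\<Sum>t=1..n. hinge B t)"
    using le t by (intro sum_strict_mono_ex1) auto
  moreover have "(\<Sum>x\<in>#A. x\<^sup>2) = n + 2 * (\<Sum>t=1..n. hinge A t)"
    using sum_squares_eq[of A n] member_le_sum_mset[of _ A] by (simp add: n_def)
  moreover have "(\<Sum>x\<in>#B. x\<^sup>2) = n + 2 * (\<Sum>t=1..n. hinge B t)"
    using sum_squares_eq[of B n] member_le_sum_mset[of _ B] n by simp
  ultimately show ?thesis by linarith
qed

section \<open>Triangularity and separation of eigenvalues\<close>

text \<open>\<open>P\<close> describes an upper set. Every multiset that \<open>Dun\<close> reads at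
  (x, A) is \<open>add_mset x A\<close> itself or arises from it by spreading two exponents apart,
  so it stays in \<open>P\<close>.\<close>

lemma Dun_eq_0:
  assumes up: "\<And>A B. P A \<Longrightarrow> dle A B \<Longrightarrow> P B"
    and g: "\<And>z B. P (add_mset z B) \<Longrightarrow> g z B = 0" and P: "P (add_mset x A)"
  shows "Dun g x A = 0"
proof -
  have "(\<Sum>y\<in>#A. (\<Sum>u=Suc (max x y)..x+y. g u (add_mset (x + y - u) (A - {#y#})) - g (x + y - u) (add_mset u (A - {#y#})))
       - g (min x y) (add_mset (max x y) (A - {#y#}))) = (\<Sum>y\<in>#A. 0)"
  proof (intro sum_mset_cong_strong)
    fix y assume "y \<in># A"
    then obtain B where A: "A = add_mset y B" by (metis multi_member_split)
    have 1: "P (add_mset u (add_mset (x + y - u) B))" if "max x y \<le> u" "u \<le> x + y" for u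
      using up[OF P[unfolded A] dle_shift[OF that]] .
    then have 2: "P (add_mset (x + y - u) (add_mset u B))" if "max x y \<le> u" "u \<le> x + y" for u
      using that by (simp add: add_mset_commute[of _ u])
    have "x + y - max x y = min x y" by auto
    then have 3: "P (add_mset (min x y) (add_mset (max x y) B))" using 2[of "max x y"] by simp
    have "g u (add_mset (x + y - u) B) - g (x + y - u) (add_mset u B) = 0" if "u \<in> {Suc (max x y)..x+y}" for u
      using that g[OF 1[of u]] g[OF 2[of u]] by (simp add: Suc_le_eq)
    then show "(\<Sum>u=Suc (max x y)..x+y. g u (add_mset (x + y - u) (A - {#y#})) - g (x + y - u) (add_mset u (A - {#y#})))
       - g (min x y) (add_mset (max x y) (A - {#y#})) = 0"
      unfolding A add_mset_remove_trivial g[OF 3] by simp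
  qed
  then show ?thesis using g[OF P] by (simp add: Dun_def)
qed

lemma HamM_eq_0:
  assumes up: "\<And>A B. P A \<Longrightarrow> dle A B \<Longrightarrow> P B"
    and \<phi>: "\<And>B. P B \<Longrightarrow> \<phi> B = 0" and P: "P A"
  shows "HamM k \<phi> A = 0"
proof -
  have *: "(Dun ^^ k) (marked \<phi>) x B = 0" if "P (add_mset x B)" for x B
    using that
  proof (induction k arbitrary: x B)
    case 0 then show ?case by (simp add: marked_def \<phi>)
  next
    case (Suc k)
    have "Dun ((Dun ^^ k) (marked \<phi>)) x B = 0"
      by (rule Dun_eq_0[where P = P]) (use up Suc in auto)
    then show ?case by simp
  qed
  have "(\<Sum>x\<in>#A. (Dun ^^ k) (marked \<phi>) x (A - {#x#})) = (\<Sum>x\<in>#A. 0)"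
    by (intro sum_mset_cong_strong *) (simp add: P)
  then show ?thesis by (simp add: HamM_def)
qed

text \<open>The diagonal part of the powers of \<open>Dun\<close>: if everything strictly above A
  vanishes, another part y contributes only the term in which min x y becomes the marked
  exponent.\<close>

primrec top_coeff :: "nat multiset \<Rightarrow> nat \<Rightarrow> nat \<Rightarrow> F" where
  "top_coeff A 0 x = alpha * of_nat x"
| "top_coeff A (Suc k) x = alpha * of_nat x * top_coeff A k x - (\<Sum>y\<in>#A - {#x#}. top_coeff A k (min x y))"

definition eigval :: "nat \<Rightarrow> nat multiset \<Rightarrow> F" where
  "eigval k A = (\<Sum>x\<in>#A. top_coeff A k x)"

text \<open>The induction carries two claims, vanishing strictly above A and the value at A. The
  first removes all the terms with u > max x y from the computation of the second.\<close>

lemma HamM_diag: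
  assumes \<phi>: "\<And>B. dlt A B \<Longrightarrow> \<phi> B = 0"
  shows "HamM k \<phi> A = eigval k A * \<phi> A"
proof -
  define g where "g k = (Dun ^^ k) (marked \<phi>)" for k
  have *: "(\<forall>x B. dlt A (add_mset x B) \<longrightarrow> g k x B = 0) \<and> (\<forall>x\<in>#A. g k x (A - {#x#}) = top_coeff A k x * \<phi> A)"
  proof (induction k)
    case 0
    then show ?case by (auto simp: g_def marked_def \<phi>)
  next
    case (Suc k)
    have gS: "g (Suc k) = Dun (g k)" by (simp add: g_def)
    have "g (Suc k) x B = 0" if "dlt A (add_mset x B)" for x B
      unfolding gS by (rule Dun_eq_0[where P = "dlt A"]) (use that Suc dlt_dle_trans in auto)
    moreover have "g (Suc k) x (A - {#x#}) = top_coeff A (Suc k) x * \<phi> A" if x: "x \<in># A" for x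
    proof -
      have "(\<Sum>y\<in>#A - {#x#}. (\<Sum>u=Suc (max x y)..x+y. g k u (add_mset (x + y - u) (A - {#x#} - {#y#}))
              - g k (x + y - u) (add_mset u (A - {#x#} - {#y#})))
            - g k (min x y) (add_mset (max x y) (A - {#x#} - {#y#})))
          = (\<Sum>y\<in>#A - {#x#}. - (top_coeff A k (min x y) * \<phi> A))"
      proof (intro sum_mset_cong_strong)
        fix y assume "y \<in># A - {#x#}"
        then obtain B where B: "A - {#x#} = add_mset y B" by (metis multi_member_split)
        then have A: "A = add_mset x (add_mset y B)" using x by (metis insert_DiffM)
        have 1: "dlt A (add_mset u (add_mset (x + y - u) B))" if "max x y < u" "u \<le> x + y" for u
          unfolding A using dlt_shift[OF that] .
        then have 2: "dlt A (add_mset (x + y - u) (add_mset u B))" if "max x y < u" "u \<le> x + y" for u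
          using that by (simp add: add_mset_commute[of _ u])
        have mem: "min x y \<in># A" by (simp add: A min_def)
        have "add_mset (max x y) B = A - {#min x y#}" by (auto simp: A max_def min_def)
        then have 3: "g k (min x y) (add_mset (max x y) B) = top_coeff A k (min x y) * \<phi> A"
          using Suc mem by simp
        have "g k u (add_mset (x + y - u) B) - g k (x + y - u) (add_mset u B) = 0" if "u \<in> {Suc (max x y)..x+y}" for u
          using that Suc 1[of u] 2[of u] by (simp add: Suc_le_eq)
        then have "(\<Sum>u=Suc (max x y)..x+y. g k u (add_mset (x + y - u) B) - g k (x + y - u) (add_mset u B)) = 0"
          by simp
        with 3 show "(\<Sum>u=Suc (max x y)..x+y. g k u (add_mset (x + y - u) (A - {#x#} - {#y#}))
              - g k (x + y - u) (add_mset u (A - {#x#} - {#y#})))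
            - g k (min x y) (add_mset (max x y) (A - {#x#} - {#y#})) = - (top_coeff A k (min x y) * \<phi> A)"
          unfolding B add_mset_remove_trivial by simp
      qed
      also have "\<dots> = - (\<Sum>y\<in>#A - {#x#}. top_coeff A k (min x y)) * \<phi> A"
        using sum_mset_distrib_right[of "\<lambda>y. - top_coeff A k (min x y)" "A - {#x#}" "\<phi> A"]
          sum_mset_distrib_left[of "-1" "\<lambda>y. top_coeff A k (min x y)" "A - {#x#}"] by simp
      finally show ?thesis using Suc x unfolding gS Dun_def by (simp add: algebra_simps)
    qed
    ultimately show ?case by blast
  qed
  have "HamM k \<phi> A = (\<Sum>x\<in>#A. top_coeff A k x * \<phi> A)"
    unfolding HamM_def g_def[symmetric] using * by (intro sum_mset_cong_strong) blast
  then show ?thesis by (simp add: eigval_def sum_mset_distrib_right)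
qed

section \<open>Degrees in \<open>alpha\<close> and separation of the joint eigenvalues\<close>

definition low_degree :: "nat \<Rightarrow> F set" where
  "low_degree k = {Fract p 1 | p. \<forall>i\<ge>k. coeff p i = 0}"

lemma low_degree_add: "a \<in> low_degree k \<Longrightarrow> b \<in> low_degree k \<Longrightarrow> a + b \<in> low_degree k"
  unfolding low_degree_def by clarsimp (metis add_0 coeff_add)

lemma low_degree_minus: "a \<in> low_degree k \<Longrightarrow> - a \<in> low_degree k"
  unfolding low_degree_def by clarsimp (metis coeff_minus minus_zero)

lemma low_degree_0 [simp]: "0 \<in> low_degree k"
  unfolding low_degree_def by (auto simp: Zero_fract_def intro!: exI[of _ 0])

lemma low_degree_sum_mset: "(\<And>x. x \<in># A \<Longrightarrow> f x \<in> low_degree k) \<Longrightarrow> (\<Sum>x\<in>#A. f x) \<in> low_degree k"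
  by (induction A) (auto intro: low_degree_add)

lemma low_degree_Suc: "a \<in> low_degree k \<Longrightarrow> a \<in> low_degree (Suc k)"
  unfolding low_degree_def by auto

lemma low_degree_alpha: "a \<in> low_degree k \<Longrightarrow> alpha * a \<in> low_degree (Suc k)"
  unfolding low_degree_def alpha_def
proof clarsimp
  fix p :: "rat poly" assume p: "\<forall>i\<ge>k. coeff p i = 0"
  have "\<forall>i\<ge>Suc k. coeff (pCons 0 p) i = 0"
    using p by (auto simp: coeff_pCons split: nat.split)
  then show "\<exists>pa. Fract (pCons 0 p) 1 = Fract pa 1 \<and> (\<forall>i\<ge>Suc k. coeff pa i = 0)" by blast
qed

lemma of_nat_eq_Fract: "(of_nat n :: F) = Fract [:of_nat n:] 1"
  by (induction n) (auto simp: Zero_fract_def One_fract_def one_pCons)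

lemma low_degree_of_nat: "a \<in> low_degree k \<Longrightarrow> of_nat n * a \<in> low_degree k"
  by (induction n) (auto simp: distrib_right low_degree_add)

lemma alpha_power_eq_Fract: "alpha ^ k = Fract (monom 1 k) 1"
  by (induction k) (simp_all add: alpha_def One_fract_def monom_Suc)

lemma alpha_power_low_degree: "of_nat n * alpha ^ k \<in> low_degree (Suc k)"
  unfolding low_degree_def of_nat_eq_Fract alpha_power_eq_Fract
  by (auto intro!: exI[of _ "smult (of_nat n) (monom 1 k)"])

lemma of_nat_eq_if_low_degree:
  assumes "of_nat m * alpha ^ k - of_nat n * alpha ^ k \<in> low_degree k"
  shows "m = n"
proof -
  have "of_nat m * alpha ^ k - of_nat n * alpha ^ k = Fract (monom (of_nat m - of_nat n) k) 1"
    by (simp add: of_nat_eq_Fract alpha_power_eq_Fract smult_monom diff_monom)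
  then obtain p where p: "Fract (monom (of_nat m - of_nat n) k) 1 = (Fract p 1 :: F)" "\<forall>i\<ge>k. coeff p i = 0"
    using assms by (auto simp: low_degree_def)
  then have "p = monom (of_nat m - of_nat n) k" by (simp add: eq_fract)
  with p(2) have "(of_nat m :: rat) = of_nat n" by auto
  then show ?thesis by simp
qed

text \<open>Each step multiplies the leading term by alpha x, whereas the subtracted sum keeps the
  degree of the previous step.\<close>

lemma top_coeff_low_degree: "top_coeff A k x - of_nat (x ^ Suc k) * alpha ^ Suc k \<in> low_degree (Suc k)"
proof (induction k arbitrary: x)
  case 0
  then show ?case by (simp add: mult.commute)
next
  case (Suc k)
  have "alpha * (of_nat x * (top_coeff A k x - of_nat (x ^ Suc k) * alpha ^ Suc k)) \<in> low_degree (Suc (Suc k))"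
    by (intro low_degree_alpha low_degree_of_nat Suc)
  moreover have "top_coeff A k z \<in> low_degree (Suc (Suc k))" for z
    using low_degree_add[OF low_degree_Suc[OF Suc] alpha_power_low_degree, of z "z ^ Suc k"] by simp
  then have "- (\<Sum>y\<in>#A - {#x#}. top_coeff A k (min x y)) \<in> low_degree (Suc (Suc k))"
    by (intro low_degree_minus low_degree_sum_mset)
  ultimately have "alpha * (of_nat x * (top_coeff A k x - of_nat (x ^ Suc k) * alpha ^ Suc k))
     + - (\<Sum>y\<in>#A - {#x#}. top_coeff A k (min x y)) \<in> low_degree (Suc (Suc k))"
    by (rule low_degree_add)
  then show ?case by (simp add: algebra_simps)
qed

lemma sum_mset_eq_sum_count:
  fixes f :: "'a \<Rightarrow> 'b::comm_semiring_1"
  assumes "finite S" "set_mset C \<subseteq> S"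
  shows "(\<Sum>x\<in>#C. f x) = (\<Sum>x\<in>S. of_nat (count C x) * f x)"
  using assms(2)
proof (induction C)
  case (add z C)
  have "(\<Sum>x\<in>S. of_nat (count (add_mset z C) x) * f x)
    = (\<Sum>x\<in>S. of_nat (count C x) * f x + (if x = z then f z else 0))"
    by (intro sum.cong) (auto simp: distrib_right add.commute)
  also have "\<dots> = (\<Sum>x\<in>S. of_nat (count C x) * f x) + f z"
    using add.prems assms(1) by (simp add: sum.distrib)
  finally show ?case using add by (simp add: add.commute)
qed simp

text \<open>By linearity, the differences d of the multiplicities satisfy: the sum of d(x) x q(x) is
  0 for every polynomial q. The factor x is there because the exponents start at 1, and it is
  nonzero on parts. Taking for q the polynomial whose roots are the other parts isolates
  d(z).\<close>

lemma power_sums_determine: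
  fixes A B :: "nat multiset"
  assumes eq: "\<And>k. (\<Sum>x\<in>#A. x ^ Suc k) = (\<Sum>x\<in>#B. x ^ Suc k)" and "0 \<notin># A" "0 \<notin># B"
  shows "A = B"
proof (rule multiset_eqI)
  fix z :: nat
  define S where "S = set_mset A \<union> set_mset B"
  define d where "d x = int (count A x) - int (count B x)" for x
  have fin: "finite S" by (simp add: S_def)
  have pow: "(\<Sum>x\<in>S. d x * int x ^ Suc k) = 0" for k
  proof -
    have "int (\<Sum>x\<in>#C. x ^ Suc k) = (\<Sum>x\<in>S. int (count C x) * int x ^ Suc k)"
      if "set_mset C \<subseteq> S" for C
      using sum_mset_eq_sum_count[OF fin that, of "\<lambda>x. x ^ Suc k"] by simp
    then have "(\<Sum>x\<in>S. int (count A x) * int x ^ Suc k) = (\<Sum>x\<in>S. int (count B x) * int x ^ Suc k)"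
      using eq[of k] unfolding S_def by (metis Un_upper1 Un_upper2)
    then show ?thesis by (simp add: d_def left_diff_distrib sum_subtractf)
  qed
  have poly: "(\<Sum>x\<in>S. d x * int x * poly q (int x)) = 0" for q
  proof -
    have "(\<Sum>x\<in>S. d x * int x * poly q (int x)) = (\<Sum>x\<in>S. \<Sum>i\<le>degree q. coeff q i * (d x * int x ^ Suc i))"
      by (simp add: poly_altdef sum_distrib_left mult_ac)
    also have "\<dots> = (\<Sum>i\<le>degree q. coeff q i * (\<Sum>x\<in>S. d x * int x ^ Suc i))"
      by (subst sum.swap) (simp add: sum_distrib_left)
    finally show ?thesis by (simp only: pow) simp
  qed
  show "count A z = count B z"
  proof (cases "z \<in> S")
    case True
    define q where "q = (\<Prod>y\<in>S - {z}. [:- int y, 1:])"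
    have "poly q (int x) = 0" if "x \<in> S - {z}" for x
      using that fin by (auto simp: q_def poly_prod)
    then have "(\<Sum>x\<in>S. d x * int x * poly q (int x)) = d z * int z * poly q (int z)"
      using True fin by (subst sum.remove[of _ z]) auto
    then have "d z * int z * poly q (int z) = 0" by (simp only: poly)
    moreover have "poly q (int z) \<noteq> 0" using fin by (auto simp: q_def poly_prod)
    moreover have "z \<noteq> 0" using True assms(2,3) by (metis S_def Un_iff)
    ultimately show ?thesis by (simp add: d_def)
  next
    case False
    then show ?thesis by (simp add: S_def not_in_iff)
  qed
qed

lemma eigval_inject:
  assumes "\<And>k. eigval k A = eigval k B" and "0 \<notin># A" "0 \<notin># B"
  shows "A = B"
proof (rule power_sums_determine[OF _ assms(2,3)])
  fix k
  have *: "eigval k A - of_nat (\<Sum>x\<in>#A. x ^ Suc k) * alpha ^ Suc k \<in> low_degree (Suc k)" for A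
  proof -
    have "(\<Sum>x\<in>#A. top_coeff A k x - of_nat (x ^ Suc k) * alpha ^ Suc k) \<in> low_degree (Suc k)"
      by (intro low_degree_sum_mset top_coeff_low_degree)
    then show ?thesis
      by (simp add: sum_mset_subtractf eigval_def sum_mset_distrib_right image_mset.compositionality comp_def)
  qed
  have "of_nat (\<Sum>x\<in>#A. x ^ Suc k) * alpha ^ Suc k - of_nat (\<Sum>x\<in>#B. x ^ Suc k) * alpha ^ Suc k \<in> low_degree (Suc k)"
    using low_degree_add[OF low_degree_minus[OF *[of A]] *[of B]] assms(1) by simp
  then show "(\<Sum>x\<in>#A. x ^ Suc k) = (\<Sum>x\<in>#B. x ^ Suc k)" by (rule of_nat_eq_if_low_degree)
qed

lemma HamM_1:
  "HamM 1 \<phi> A = alpha * ((alpha * of_nat (\<Sum>x\<in>#A. x\<^sup>2) - of_nat (\<Sum>x\<in>#A. \<Sum>y\<in>#A - {#x#}. min x y)) * \<phi> A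
    + (\<Sum>x\<in>#A. \<Sum>y\<in>#A - {#x#}. \<Sum>u=Suc (max x y)..x+y.
        (2 * of_nat u - of_nat x - of_nat y) * \<phi> (add_mset u (add_mset (x + y - u) (A - {#x#} - {#y#})))))"
proof -
  define W where "W x y = (\<Sum>u=Suc (max x y)..x+y.
        (2 * of_nat u - of_nat x - of_nat y) * \<phi> (add_mset u (add_mset (x + y - u) (A - {#x#} - {#y#}))))" for x y
  have "HamM 1 \<phi> A = (\<Sum>x\<in>#A. alpha * (alpha * of_nat (x\<^sup>2) * \<phi> A
      + (\<Sum>y\<in>#A - {#x#}. W x y - of_nat (min x y) * \<phi> A)))"
    unfolding HamM_def
  proof (intro sum_mset_cong_strong)
    fix x assume x: "x \<in># A"
    have "(\<Sum>y\<in>#A - {#x#}. (\<Sum>u=Suc (max x y)..x+y. marked \<phi> u (add_mset (x + y - u) (A - {#x#} - {#y#}))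
              - marked \<phi> (x + y - u) (add_mset u (A - {#x#} - {#y#})))
            - marked \<phi> (min x y) (add_mset (max x y) (A - {#x#} - {#y#})))
        = (\<Sum>y\<in>#A - {#x#}. alpha * (W x y - of_nat (min x y) * \<phi> A))"
    proof (intro sum_mset_cong_strong)
      fix y assume y: "y \<in># A - {#x#}"
      then obtain B where B: "A - {#x#} = add_mset y B" by (metis multi_member_split)
      then have A: "A = add_mset x (add_mset y B)" using x by (metis insert_DiffM)
      \<comment> \<open>Marking u or x + y - u refers to the same multiset of exponents, so the
        difference leaves only the factor u - (x + y - u).\<close>
      have *: "(\<Sum>u=Suc (max x y)..x+y. marked \<phi> u (add_mset (x + y - u) B) - marked \<phi> (x + y - u) (add_mset u B))
        = alpha * W x y"
        unfolding W_def B add_mset_remove_trivial sum_distrib_left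
        by (intro sum.cong) (auto simp: marked_def of_nat_diff add_mset_commute[of "x + y - _"] algebra_simps)
      have "add_mset (min x y) (add_mset (max x y) B) = A" by (auto simp: A min_def max_def)
      then show "(\<Sum>u=Suc (max x y)..x+y. marked \<phi> u (add_mset (x + y - u) (A - {#x#} - {#y#}))
              - marked \<phi> (x + y - u) (add_mset u (A - {#x#} - {#y#})))
            - marked \<phi> (min x y) (add_mset (max x y) (A - {#x#} - {#y#})) = alpha * (W x y - of_nat (min x y) * \<phi> A)"
        unfolding B add_mset_remove_trivial * by (simp add: marked_def algebra_simps)
    qed
    then show "(Dun ^^ 1) (marked \<phi>) x (A - {#x#}) = alpha * (alpha * of_nat (x\<^sup>2) * \<phi> A
      + (\<Sum>y\<in>#A - {#x#}. W x y - of_nat (min x y) * \<phi> A))"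
      using x by (simp add: Dun_def marked_def[of _ x] power2_eq_square algebra_simps sum_mset_distrib_left)
  qed
  also have "\<dots> = alpha * ((alpha * of_nat (\<Sum>x\<in>#A. x\<^sup>2) - of_nat (\<Sum>x\<in>#A. \<Sum>y\<in>#A - {#x#}. min x y)) * \<phi> A
    + (\<Sum>x\<in>#A. \<Sum>y\<in>#A - {#x#}. W x y))"
    by (simp add: sum_mset_subtractf sum_mset.distrib sum_mset_distrib_left[symmetric] sum_mset_distrib_right[symmetric]
       image_mset.compositionality comp_def algebra_simps)
  finally show ?thesis by (simp only: W_def)
qed

section \<open>Jack functions in power sum coordinates\<close>

definition pos_part :: "nat multiset \<Rightarrow> nat multiset" where
  "pos_part A = filter_mset (\<lambda>x. 0 < x) A"

lemma pos_part_add_mset [simp]: "pos_part (add_mset x A) = (if x = 0 then pos_part A else add_mset x (pos_part A))"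
  by (simp add: pos_part_def)

lemma pos_part_empty [simp]: "pos_part {#} = {#}"
  by (simp add: pos_part_def)

lemma sum_mset_pos_part [simp]: "sum_mset (pos_part A) = sum_mset A"
  by (induction A) auto

lemma pos_part_Par: "pos_part A \<in> Par (sum_mset A)"
  by (simp add: Par_def) (simp add: pos_part_def)

lemma pos_part_ident: "0 \<notin># A \<Longrightarrow> pos_part A = A"
  by (induction A) auto

lemma hinge_pos_part [simp]: "hinge (pos_part A) t = hinge A t"
  by (induction A) auto

lemma dle_pos_part [simp]: "dle (pos_part A) B \<longleftrightarrow> dle A B" "dle B (pos_part A) \<longleftrightarrow> dle B A"
  by (auto simp: dle_def)

text \<open>A positive k can never be subtracted from the exponent 0; only \<open>p_0\<close> would
  count that variable.\<close>

lemma pm_add_zero: "0 \<notin># l \<Longrightarrow> pm l (add_mset 0 A) = pm l A"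
proof (induction l arbitrary: A)
  case (add k l)
  then have "(\<Sum>y\<in>#A. if k \<le> y then pm l (add_mset 0 (add_mset (y - k) (A - {#y#}))) else 0)
    = (\<Sum>y\<in>#A. if k \<le> y then pm l (add_mset (y - k) (A - {#y#})) else 0)"
    by (intro sum_mset_cong_strong) auto
  moreover have "k \<noteq> 0" using add.prems by auto
  ultimately show ?case by (simp add: pmul_add_mset) (simp add: pmul_def)
qed (simp add: pone_def)

lemma pm_pos_part: "0 \<notin># l \<Longrightarrow> pm l (pos_part A) = pm l A"
proof (induction "size A" arbitrary: A)
  case (Suc n)
  show ?case
  proof (cases "0 \<in># A")
    case True
    then obtain B where "A = add_mset 0 B" by (metis multi_member_split)
    then show ?thesis using Suc by (simp add: pm_add_zero)
  qed (simp add: pos_part_ident)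
qed simp

lemma ev_pos_part [simp]: "ev c (pos_part A) = ev c A"
  unfolding ev_def sum_mset_pos_part by (intro sum.cong) (auto simp: pm_pos_part Par_def)

text \<open>A monomial of \<open>p_l\<close> arises by distributing the parts of l over the
  variables, and parts put on the same variable merge. The number of positive exponents reaches that
  of the parts only if nothing merges.\<close>

lemma pm_triangular:
  assumes "0 \<notin># l" "pm l A \<noteq> 0"
  shows "size (pos_part A) \<le> size l \<and> (size (pos_part A) = size l \<longrightarrow> pos_part A = l)"
  using assms
proof (induction l arbitrary: A)
  case empty
  then have "\<forall>x\<in>#A. x = 0" by (simp add: pone_def split: if_splits)
  then have "pos_part A = {#}" by (induction A) auto
  then show ?case by simp
next
  case (add k l)
  from add.prems have "pmul k (pm l) A \<noteq> 0" by simp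
  then obtain x where x: "x \<in># A" "k \<le> x" "pm l (add_mset (x - k) (A - {#x#})) \<noteq> 0"
    by (rule pmul_nonzeroE)
  then obtain B where A: "A = add_mset x B" by (metis multi_member_split)
  have k: "k \<noteq> 0" using add.prems by auto
  have IH: "size (pos_part (add_mset (x - k) B)) \<le> size l \<and>
     (size (pos_part (add_mset (x - k) B)) = size l \<longrightarrow> pos_part (add_mset (x - k) B) = l)"
    by (rule add.IH) (use x add.prems in \<open>auto simp: A\<close>)
  then show ?case using x k by (auto simp: A split: if_splits)
qed

lemma sum_mset_nonneg:
  fixes f :: "'a \<Rightarrow> 'b::ordered_comm_monoid_add"
  assumes "\<And>x. x \<in># A \<Longrightarrow> 0 \<le> f x"
  shows "0 \<le> (\<Sum>x\<in>#A. f x)"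
  using assms by (induction A) auto

lemma pmul_nonneg: "(\<And>A. 0 \<le> f A) \<Longrightarrow> 0 \<le> pmul k f A"
  unfolding pmul_def by (rule sum_mset_nonneg) auto

lemma pm_nonneg: "0 \<le> pm l A"
  by (induction l arbitrary: A) (auto simp: pone_def intro: pmul_nonneg)

text \<open>No summand is negative, and using the part k on an exponent k leaves a positive one.
  This avoids computing the value, a product of factorials of multiplicities.\<close>

lemma pm_diag_pos: "pos_part A = l \<Longrightarrow> 0 < pm l A"
proof (induction l arbitrary: A)
  case empty
  have "sum_mset A = sum_mset (pos_part A)" by (rule sum_mset_pos_part[symmetric])
  then show ?case using empty by (simp add: pone_def)
next
  case (add k l)
  have "k \<in># pos_part A" by (simp add: add.prems)
  then have k: "0 < k" "k \<in># A" by (auto simp: pos_part_def)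
  then obtain B where A: "A = add_mset k B" by (metis multi_member_split)
  have "pos_part (add_mset 0 B) = l" using add.prems k by (simp add: A)
  then have "0 < pm l (add_mset 0 B)" by (rule add.IH)
  moreover have "0 \<le> (\<Sum>y\<in>#B. if k \<le> y then pm l (add_mset k (add_mset (y - k) (B - {#y#}))) else 0)"
    by (rule sum_mset_nonneg) (auto simp: pm_nonneg)
  ultimately show ?case by (simp add: A pmul_add_mset)
qed

lemma ev_Par: "A \<in> Par n \<Longrightarrow> ev c A = (\<Sum>l\<in>Par n. c l * pm l A)"
  using ev_def[of c A] by (metis (mono_tags, lifting) Par_def mem_Collect_eq)

text \<open>Descending induction on the number of parts: by \<open>pm_triangular\<close>, only l
  itself and partitions with more parts contribute to the coefficient at l.\<close>

lemma ev_inject: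
  assumes "\<And>A. A \<in> Par n \<Longrightarrow> ev c A = 0" "l \<in> Par n"
  shows "c l = 0"
  using assms(2)
proof (induction "n - size l" arbitrary: l rule: less_induct)
  case less
  have "ev c l = c l * pm l l + (\<Sum>l'\<in>Par n - {l}. c l' * pm l' l)"
    unfolding ev_Par[OF less.prems] using less.prems by (subst sum.remove[of _ l]) auto
  also have "(\<Sum>l'\<in>Par n - {l}. c l' * pm l' l) = 0"
  proof (intro sum.neutral ballI)
    fix l' assume l': "l' \<in> Par n - {l}"
    show "c l' * pm l' l = 0"
    proof (cases "pm l' l = 0")
      case False
      have "size l < size l'"
        using pm_triangular[OF _ False] l' less.prems by (auto simp: Par_def pos_part_ident order.order_iff_strict)
      moreover have "size l' \<le> n" using l' size_le_sum_mset[of l'] by (auto simp: Par_def)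
      ultimately show ?thesis using less.hyps[of l'] l' by auto
    qed simp
  qed
  finally have "c l * pm l l = 0" using assms(1)[OF less.prems] by simp
  moreover have "pm l l \<noteq> 0"
    using pm_diag_pos[of l l] less.prems by (auto simp: Par_def pos_part_ident)
  ultimately show ?case by simp
qed

text \<open>The triangular system is solved by descending length: the auxiliary claim assumes that
  the right-hand side already vanishes from length m on.\<close>

lemma ev_surj: "\<exists>c. \<forall>A\<in>Par n. ev c A = \<phi> A"
proof -
  have *: "\<exists>c. \<forall>A\<in>Par n. ev c A = \<phi> A" if "\<And>A. A \<in> Par n \<Longrightarrow> m \<le> size A \<Longrightarrow> \<phi> A = 0" for m \<phi>
    using that
  proof (induction m arbitrary: \<phi>)
    case 0
    then show ?case by (intro exI[of _ "\<lambda>_. 0"]) (simp add: ev_def)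
  next
    case (Suc m)
    \<comment> \<open>Coordinates of length m repair the values at length m. They do not reach
      longer A, and at length m each one contributes only at l = A.\<close>
    define b where "b l = (if size l = m then \<phi> l / pm l l else 0)" for l
    have b: "ev b A = \<phi> A" if A: "A \<in> Par n" "m \<le> size A" for A
    proof -
      have "ev b A = b A * pm A A + (\<Sum>l\<in>Par n - {A}. b l * pm l A)"
        unfolding ev_Par[OF A(1)] using A by (subst sum.remove[of _ A]) auto
      also have "(\<Sum>l\<in>Par n - {A}. b l * pm l A) = 0"
      proof (intro sum.neutral ballI)
        fix l assume l: "l \<in> Par n - {A}"
        show "b l * pm l A = 0"
        proof (cases "pm l A = 0")
          case False
          have "size A < size l"
            using pm_triangular[OF _ False] l A by (auto simp: Par_def pos_part_ident order.order_iff_strict)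
          then show ?thesis using A by (simp add: b_def)
        qed simp
      qed
      also have "b A * pm A A + 0 = \<phi> A"
        using pm_diag_pos[of A A] A Suc.prems[of A] by (auto simp: b_def Par_def pos_part_ident)
      finally show ?thesis .
    qed
    obtain c where c: "\<forall>A\<in>Par n. ev c A = \<phi> A - ev b A"
      using Suc.IH[of "\<lambda>A. \<phi> A - ev b A"] b by auto
    show ?case
      by (intro exI[of _ "\<lambda>l. c l + b l"]) (simp add: c ev_add)
  qed
  show ?thesis
  proof (rule *[of "Suc n"])
    show "\<phi> A = 0" if "A \<in> Par n" "Suc n \<le> size A" for A
      using that size_le_sum_mset[of A] by (simp add: Par_def)
  qed
qed

text \<open>Power sum coordinates of the monomial function m_A. They are determined only within the
  degree of A; elsewhere the choice leaves them unspecified.\<close>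

definition mcoord :: "nat multiset \<Rightarrow> nat multiset \<Rightarrow> F" where
  "mcoord A = (SOME c. \<forall>B\<in>Par (sum_mset A). ev c B = (if B = A then 1 else 0))"

lemma ev_mcoord:
  assumes "A \<in> Par n" "B \<in> Par n"
  shows "ev (mcoord A) B = (if B = A then 1 else 0)"
proof -
  have "\<forall>B\<in>Par (sum_mset A). ev (mcoord A) B = (if B = A then 1 else 0)"
    unfolding mcoord_def by (rule someI_ex[OF ev_surj])
  then show ?thesis using assms by (simp add: Par_def)
qed

lemma ev_inject_eq:
  assumes "\<And>A. A \<in> Par n \<Longrightarrow> ev c A = ev d A" "l \<in> Par n"
  shows "c l = d l"
proof -
  have "ev (\<lambda>l. c l + (-1) * d l) A = 0" if "A \<in> Par n" for A
    by (simp only: ev_add ev_scale) (simp add: assms(1) that)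
  from ev_inject[OF this assms(2)] show ?thesis by simp
qed

lemma mcoord_expansion:
  assumes "l \<in> Par n"
  shows "d l = (\<Sum>B\<in>Par n. ev d B * mcoord B l)"
proof (rule ev_inject_eq[OF _ assms])
  fix A assume A: "A \<in> Par n"
  have "ev (\<lambda>l. \<Sum>B\<in>Par n. ev d B * mcoord B l) A = (\<Sum>B\<in>Par n. if B = A then ev d A else 0)"
    unfolding ev_sum ev_scale by (intro sum.cong) (auto simp: ev_mcoord A)
  then show "ev d A = ev (\<lambda>l. \<Sum>B\<in>Par n. ev d B * mcoord B l) A" using A by simp
qed

text \<open>The values \<open>ev d B\<close> are the monomial coefficients of d, so pairing with d
  reduces to pairing with monomial functions.\<close>

lemma form_expansion: "form n c d = (\<Sum>B\<in>Par n. ev d B * form n c (mcoord B))"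
proof -
  have "form n c d = form n c (\<lambda>l. \<Sum>B\<in>Par n. ev d B * mcoord B l)"
    by (intro form_cong refl mcoord_expansion)
  then show ?thesis by (simp only: form_sum_right form_scale_right)
qed

text \<open>Gram-Schmidt without linear independence of the v. The induction hypothesis is used
  twice: to make c and to make the new vector v w orthogonal to the old ones.\<close>

lemma orthogonal_projection:
  assumes "finite S"
  shows "\<exists>b. \<forall>s\<in>S. form n (\<lambda>l. c l + (\<Sum>t\<in>S. b t * v t l)) (v s) = 0"
  using assms
proof (induction S arbitrary: c rule: finite_induct)
  case (insert w S)
  obtain b where b: "\<forall>s\<in>S. form n (\<lambda>l. c l + (\<Sum>t\<in>S. b t * v t l)) (v s) = 0"
    using insert.IH by blast
  obtain b' where b': "\<forall>s\<in>S. form n (\<lambda>l. v w l + (\<Sum>t\<in>S. b' t * v t l)) (v s) = 0"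
    using insert.IH by blast
  define p where "p = (\<lambda>l. c l + (\<Sum>t\<in>S. b t * v t l))"
  define q where "q = (\<lambda>l. v w l + (\<Sum>t\<in>S. b' t * v t l))"
  have pq: "\<forall>s\<in>S. form n p (v s) = 0" "\<forall>s\<in>S. form n q (v s) = 0"
    using b b' by (simp_all only: p_def q_def)
  \<comment> \<open>If q has norm 0, then q vanishes in degree n by definiteness; division by 0
    gives r = 0, which still satisfies the equation below.\<close>
  define r where "r = - form n p q / form n q q"
  have r: "form n p q + r * form n q q = 0"
  proof (cases "form n q q = 0")
    case True
    then have "q l = 0" if "l \<in> Par n" for l using form_self_eq_0 that by blast
    then show ?thesis by (simp add: form_def)
  qed (simp add: r_def)
  define h where "h l = p l + r * q l" for l
  have hS: "form n h (v s) = 0" if "s \<in> S" for s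
    unfolding h_def form_add_left form_scale_left using pq that by simp
  have hq: "form n h q = 0"
    unfolding h_def form_add_left form_scale_left by (rule r)
  have "form n h q = form n h (v w) + (\<Sum>t\<in>S. b' t * form n h (v t))"
    unfolding q_def by (simp only: form_add_right form_sum_right form_scale_right)
  then have hw: "form n h (v w) = 0" using hq hS by simp
  define b'' where "b'' t = (if t = w then r else b t + r * b' t)" for t
  have "h l = c l + (\<Sum>t\<in>insert w S. b'' t * v t l)" for l
  proof -
    have "(\<Sum>t\<in>S. b'' t * v t l) = (\<Sum>t\<in>S. b t * v t l + r * (b' t * v t l))"
      using insert.hyps by (intro sum.cong) (auto simp: b''_def algebra_simps)
    then show ?thesis using insert.hyps
      by (simp add: h_def p_def q_def b''_def sum.distrib distrib_left flip: sum_distrib_left)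
  qed
  then have "h = (\<lambda>l. c l + (\<Sum>t\<in>insert w S. b'' t * v t l))" by blast
  with hS hw show ?case by auto
qed simp

text \<open>By triangularity e = \<open>Ham k c\<close> - \<open>eigval k A\<close> c lies in the
  span of the m_B with B < A. To this span c is orthogonal, and so is \<open>Ham k c\<close>,
  because the self-adjoint \<open>Ham k\<close> maps the span into itself. Hence e is orthogonal to
  itself.\<close>

lemma Ham_eigenvector:
  assumes A: "A \<in> Par n" and c1: "ev c A = 1"
    and c0: "\<And>B. B \<in> Par n \<Longrightarrow> \<not> dle B A \<Longrightarrow> ev c B = 0"
    and orth: "\<And>B. B \<in> Par n \<Longrightarrow> dlt B A \<Longrightarrow> form n c (mcoord B) = 0"
    and l: "l \<in> Par n"
  shows "Ham k c l = eigval k A * c l"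
proof -
  have sA: "sum_mset A = n" and nA: "0 \<notin># A" using A by (auto simp: Par_def)
  \<comment> \<open>All multisets, also those with zeros, are included, since
    \<open>HamM_eq_0\<close> moves through such multisets; \<open>belowI\<close> reduces the check
    to partitions.\<close>
  define below where "below e \<longleftrightarrow> (\<forall>B. sum_mset B = n \<and> \<not> dlt B A \<longrightarrow> ev e B = 0)" for e
  have belowI: "below e" if "\<And>B. B \<in> Par n \<Longrightarrow> \<not> dlt B A \<Longrightarrow> ev e B = 0" for e
    unfolding below_def
  proof safe
    fix B assume B: "n = sum_mset B" "\<not> dlt B A"
    have "\<not> dlt (pos_part B) A" using B by (simp add: dlt_def)
    then have "ev e (pos_part B) = 0" using that[of "pos_part B"] pos_part_Par[of B] B by simp
    then show "ev e B = 0" by simp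
  qed
  have orth': "form n c e = 0" if "below e" for e
    unfolding form_expansion[of n c e]
  proof (intro sum.neutral ballI)
    fix B assume B: "B \<in> Par n"
    show "ev e B * form n c (mcoord B) = 0"
    proof (cases "dlt B A")
      case False
      then have "ev e B = 0" using that B by (simp add: below_def Par_def)
      then show ?thesis by simp
    qed (simp add: orth B)
  qed
  have below_Ham: "below (Ham k e)" if "below e" for e
    unfolding below_def ev_Ham
  proof safe
    fix B assume B: "n = sum_mset B" "\<not> dlt B A"
    show "HamM k (ev e) B = 0"
    proof (rule HamM_eq_0[where P = "\<lambda>B. sum_mset B = n \<and> \<not> dlt B A"])
      fix B C assume "sum_mset B = n \<and> \<not> dlt B A" "dle B C"
      then show "sum_mset C = n \<and> \<not> dlt C A"
        using dle_dlt_trans[of B C A] dle_def[of B C] by metis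
    qed (use that B in \<open>simp_all add: below_def\<close>)
  qed
  have c0': "ev c B = 0" if "sum_mset B = n" "\<not> dle B A" for B
    using c0[of "pos_part B"] pos_part_Par[of B] that by simp
  define e where "e l = Ham k c l + (- eigval k A) * c l" for l
  have ev_e: "ev e B = HamM k (ev c) B + (- eigval k A) * ev c B" for B
    unfolding e_def ev_add ev_scale by (simp add: ev_Ham)
  have "below e"
  proof (rule belowI)
    fix B assume B: "B \<in> Par n" "\<not> dlt B A"
    show "ev e B = 0"
    proof (cases "B = A")
      case True
      have "HamM k (ev c) A = eigval k A * ev c A"
        by (rule HamM_diag) (auto simp: dlt_def dle_def sA intro!: c0')
      then show ?thesis using True by (simp add: ev_e)
    next
      case False
      then have nle: "\<not> dle B A" using B nA by (auto simp: dlt_iff Par_def)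
      have "HamM k (ev c) B = 0"
      proof (rule HamM_eq_0[where P = "\<lambda>B. sum_mset B = n \<and> \<not> dle B A"])
        fix B C assume "sum_mset B = n \<and> \<not> dle B A" "dle B C"
        then show "sum_mset C = n \<and> \<not> dle C A"
          using dle_trans[of B C A] dle_def[of B C] by metis
      qed (use nle B c0' in \<open>simp_all add: Par_def\<close>)
      then show ?thesis using c0[OF B(1) nle] by (simp add: ev_e)
    qed
  qed
  have "form n e e = form n (Ham k c) e + (- eigval k A) * form n c e"
    unfolding e_def[abs_def] by (simp only: form_add_left form_scale_left)
  also have "\<dots> = 0"
    using orth'[OF \<open>below e\<close>] orth'[OF below_Ham[OF \<open>below e\<close>]] by (simp add: form_Ham)
  finally show ?thesis using form_self_eq_0[OF _ l, of e] by (simp add: e_def)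
qed

section \<open>Existence, dual triangularity and uniqueness of Jack functions\<close>

definition jack_coords :: "nat \<Rightarrow> (nat multiset \<Rightarrow> nat multiset \<Rightarrow> F) \<Rightarrow> bool" where
  "jack_coords n D \<longleftrightarrow> (\<forall>A\<in>Par n. ev (D A) A = 1 \<and> (\<forall>B\<in>Par n. \<not> dle B A \<longrightarrow> ev (D A) B = 0)
     \<and> (\<forall>B\<in>Par n. A \<noteq> B \<longrightarrow> form n (D A) (D B) = 0))"

text \<open>Each \<open>Ham k\<close> is self-adjoint and triangular, hence the Gram--Schmidt vectors are joint
  eigenvectors; the joint eigenvalues separate partitions, which forces orthogonality also for
  incomparable pairs. (The Laplace--Beltrami operator \<open>Ham 1\<close> alone would not suffice, e.g. its
  eigenvalues at (2,2,2) and (3,1,1,1) coincide.)\<close>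

lemma jack_coords_exist: "\<exists>D. jack_coords n D"
proof -
  have "\<exists>c. ev c A = 1 \<and> (\<forall>B\<in>Par n. \<not> dle B A \<longrightarrow> ev c B = 0) \<and>
     (\<forall>k. \<forall>l\<in>Par n. Ham k c l = eigval k A * c l)" if A: "A \<in> Par n" for A
  proof -
    define S where "S = {B \<in> Par n. dlt B A}"
    have "finite S" by (simp add: S_def)
    then obtain b where b: "\<forall>B\<in>S. form n (\<lambda>l. mcoord A l + (\<Sum>t\<in>S. b t * mcoord t l)) (mcoord B) = 0"
      using orthogonal_projection[of S n "mcoord A" mcoord] by blast
    define c where "c l = mcoord A l + (\<Sum>t\<in>S. b t * mcoord t l)" for l
    have ev_c: "ev c B = (if B = A then 1 else 0) + (if B \<in> S then b B else 0)" if B: "B \<in> Par n" for B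
    proof -
      have "ev c B = (if B = A then 1 else 0) + (\<Sum>t\<in>S. if t = B then b B else 0)"
        unfolding c_def[abs_def] ev_add ev_sum ev_scale
        by (intro arg_cong2[of _ _ _ _ "(+)"] sum.cong) (use A B in \<open>auto simp: ev_mcoord S_def\<close>)
      then show ?thesis using \<open>finite S\<close> by simp
    qed
    have 1: "ev c A = 1" using A by (simp add: ev_c S_def dlt_def)
    have 2: "ev c B = 0" if "B \<in> Par n" "\<not> dle B A" for B
      using that by (auto simp: ev_c S_def dlt_def)
    have "form n c (mcoord B) = 0" if "B \<in> Par n" "dlt B A" for B
      using b that unfolding c_def[abs_def] S_def by blast
    then have "\<forall>k. \<forall>l\<in>Par n. Ham k c l = eigval k A * c l"
      using Ham_eigenvector[OF A 1 2] by blast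
    with 1 2 show ?thesis by blast
  qed
  then obtain D where D: "\<And>A. A \<in> Par n \<Longrightarrow> ev (D A) A = 1 \<and> (\<forall>B\<in>Par n. \<not> dle B A \<longrightarrow> ev (D A) B = 0) \<and>
     (\<forall>k. \<forall>l\<in>Par n. Ham k (D A) l = eigval k A * D A l)"
    by metis
  have "form n (D A) (D B) = 0" if AB: "A \<in> Par n" "B \<in> Par n" "A \<noteq> B" for A B
  proof -
    obtain k where k: "eigval k A \<noteq> eigval k B"
      using eigval_inject[of A B] AB by (auto simp: Par_def)
    have "eigval k A * form n (D A) (D B) = form n (Ham k (D A)) (D B)"
      unfolding form_scale_left[symmetric] using D[OF AB(1)] by (intro form_cong) auto
    also have "\<dots> = form n (D A) (Ham k (D B))" by (rule form_Ham)
    also have "\<dots> = eigval k B * form n (D A) (D B)"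
      unfolding form_scale_right[symmetric] using D[OF AB(2)] by (intro form_cong) auto
    finally show ?thesis using k by simp
  qed
  with D have "jack_coords n D" by (auto simp: jack_coords_def)
  then show ?thesis by blast
qed

text \<open>By induction on B: m_B is P_B minus a combination of m_C with C < B, and A <= C would
  imply A <= B. As the q_B are dual to the m_B, this says that P_A involves only q_B with B >=
  A.\<close>

lemma jack_coords_mcoord:
  assumes D: "jack_coords n D" and A: "A \<in> Par n" and B: "B \<in> Par n" "\<not> dle A B"
  shows "form n (D A) (mcoord B) = 0"
  using B
proof (induction "\<Sum>x\<in>#B. x\<^sup>2" arbitrary: B rule: less_induct)
  case less
  have "A \<noteq> B" using less.prems(2) by auto
  then have "0 = form n (D A) (D B)"
    using D A less.prems(1) by (simp add: jack_coords_def)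
  also have "\<dots> = (\<Sum>C\<in>Par n. ev (D B) C * form n (D A) (mcoord C))"
    by (rule form_expansion)
  also have "\<dots> = ev (D B) B * form n (D A) (mcoord B)"
  proof (rule sum.remove[THEN trans])
    have "ev (D B) C * form n (D A) (mcoord C) = 0" if C: "C \<in> Par n - {B}" for C
    proof (cases "dle C B")
      case True
      then have "dlt C B" using C less.prems(1) by (auto simp: dlt_iff Par_def)
      moreover have "\<not> dle A C" using True less.prems(2) dle_trans by blast
      ultimately show ?thesis using less.hyps[of C] dlt_sum_squares[of C B] C by auto
    next
      case False
      then show ?thesis using D less.prems(1) C by (auto simp: jack_coords_def)
    qed
    then have "(\<Sum>C\<in>Par n - {B}. ev (D B) C * form n (D A) (mcoord C)) = 0"
      by (intro sum.neutral ballI)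
    then show "ev (D B) B * form n (D A) (mcoord B) + (\<Sum>C\<in>Par n - {B}. ev (D B) C * form n (D A) (mcoord C)) =
      ev (D B) B * form n (D A) (mcoord B)" by simp
  qed (use less.prems in auto)
  finally show ?case using D less.prems(1) by (simp add: jack_coords_def)
qed

lemma jack_coords_eigenvector:
  assumes D: "jack_coords n D" and A: "A \<in> Par n" and l: "l \<in> Par n"
  shows "Ham k (D A) l = eigval k A * D A l"
proof (rule Ham_eigenvector[OF A _ _ _ l])
  show "form n (D A) (mcoord B) = 0" if "B \<in> Par n" "dlt B A" for B
    using jack_coords_mcoord[OF D A that(1)] that(2) by (auto simp: dlt_def)
qed (use D A in \<open>auto simp: jack_coords_def\<close>)

text \<open>The difference e involves only m_B with B < A. Both candidates are orthogonal to these
  by \<open>jack_coords_mcoord\<close>, so e is orthogonal to itself.\<close>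

lemma jack_coords_unique:
  assumes D: "jack_coords n D" and D': "jack_coords n D'" and A: "A \<in> Par n" and l: "l \<in> Par n"
  shows "D A l = D' A l"
proof -
  define e where "e l = D A l + (-1) * D' A l" for l
  have ev_e: "ev e B = ev (D A) B + (-1) * ev (D' A) B" for B
    unfolding e_def ev_add ev_scale ..
  have "form n (E A) e = 0" if E: "jack_coords n E" for E
    unfolding form_expansion[of n "E A" e]
  proof (intro sum.neutral ballI)
    fix B assume B: "B \<in> Par n"
    show "ev e B * form n (E A) (mcoord B) = 0"
    proof (cases "dle A B")
      case True
      have "ev e B = 0"
      proof (cases "B = A")
        case True then show ?thesis using D D' A by (simp add: ev_e jack_coords_def)
      next
        case False
        then have "\<not> dle B A" using True A B by (auto simp: Par_def dest: dle_antisym)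
        then show ?thesis using D D' A B by (simp add: ev_e jack_coords_def)
      qed
      then show ?thesis by simp
    qed (simp add: jack_coords_mcoord[OF E A B])
  qed
  note this[OF D] this[OF D']
  moreover have "form n e e = form n (D A) e + (-1) * form n (D' A) e"
    unfolding e_def[abs_def] by (simp only: form_add_left form_scale_left)
  ultimately have "form n e e = 0" by simp
  from form_self_eq_0[OF this l] show ?thesis by (simp add: e_def)
qed

section \<open>Power series\<close>

text \<open>Sums over infinite sets are 0 by convention, so finiteness is what gives
  \<open>sf_mult\<close> its meaning. Here b is bounded by a and determined by its values on the
  finite set \<open>keys a\<close>.\<close>

lemma sf_mult_support_finite: "finite {(b, c). b + c = (a :: nat \<Rightarrow>\<^sub>0 nat)}"
proof -
  let ?K = "Poly_Mapping.keys a"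
  let ?B = "{b. \<exists>c. b + c = a}"
  have "inj_on (\<lambda>b. restrict (Poly_Mapping.lookup b) ?K) ?B"
  proof (rule inj_onI)
    fix b b' assume b: "b \<in> ?B" "b' \<in> ?B" and eq: "restrict (Poly_Mapping.lookup b) ?K = restrict (Poly_Mapping.lookup b') ?K"
    have out: "Poly_Mapping.lookup d i = 0" if "d \<in> ?B" "i \<notin> ?K" for d i
      using that by (auto simp: lookup_add in_keys_iff)
    show "b = b'"
    proof (rule poly_mapping_eqI)
      fix i show "Poly_Mapping.lookup b i = Poly_Mapping.lookup b' i"
        using fun_cong[OF eq, of i] out b by (cases "i \<in> ?K") auto
    qed
  qed
  moreover have "(\<lambda>b. restrict (Poly_Mapping.lookup b) ?K) ` ?B \<subseteq> PiE ?K (\<lambda>i. {..Poly_Mapping.lookup a i})"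
    by (auto simp: lookup_add)
  then have "finite ((\<lambda>b. restrict (Poly_Mapping.lookup b) ?K) ` ?B)"
    by (rule finite_subset) (intro finite_PiE, auto)
  ultimately have "finite ?B" by (metis finite_imageD)
  moreover have "{(b, c). b + c = a} \<subseteq> (\<lambda>b. (b, a - b)) ` ?B" by auto
  ultimately show ?thesis by (rule finite_surj)
qed

lemma sf_mult_assoc: "sf_mult (sf_mult f g) h = sf_mult f (sf_mult g h)"
proof
  fix a
  let ?S = "\<lambda>a. {(b, c). b + c = (a :: nat \<Rightarrow>\<^sub>0 nat)}"
  have "sf_mult (sf_mult f g) h a = (\<Sum>z\<in>?S a. \<Sum>w\<in>?S (fst z). f (fst w) * g (snd w) * h (snd z))"
    by (simp add: sf_mult_def sum_distrib_right split_def)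
  also have "\<dots> = (\<Sum>(z,w)\<in>Sigma (?S a) (\<lambda>z. ?S (fst z)). f (fst w) * g (snd w) * h (snd z))"
    by (rule sum.Sigma) (use sf_mult_support_finite in auto)
  also have "\<dots> = (\<Sum>(z,w)\<in>Sigma (?S a) (\<lambda>z. ?S (snd z)). f (fst z) * (g (fst w) * h (snd w)))"
    by (rule sum.reindex_bij_witness[of _ "\<lambda>((b1,d),(b2,c)). ((b1 + b2, c), (b1, b2))" "\<lambda>((d,c),(b1,b2)). ((b1, b2 + c), (b2, c))"])
      (auto simp: add.assoc mult.assoc)
  also have "\<dots> = (\<Sum>z\<in>?S a. \<Sum>w\<in>?S (snd z). f (fst z) * (g (fst w) * h (snd w)))"
    by (rule sum.Sigma[symmetric]) (use sf_mult_support_finite in auto)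
  also have "\<dots> = sf_mult f (sf_mult g h) a"
    by (simp add: sf_mult_def sum_distrib_left split_def)
  finally show "sf_mult (sf_mult f g) h a = sf_mult f (sf_mult g h) a" .
qed

lemma sf_mult_sum_left: "sf_mult (\<lambda>a. \<Sum>i\<in>I. F i a) g a = (\<Sum>i\<in>I. sf_mult (F i) g a)"
  unfolding sf_mult_def by (simp add: sum_distrib_right split_def sum.swap[of _ I])

lemma sf_mult_scale_left: "sf_mult (\<lambda>a. s * f a) g a = s * sf_mult f g a"
  unfolding sf_mult_def by (simp add: sum_distrib_left split_def mult.assoc)

lemma sf_mult_one_left: "sf_mult sf_one g = g"
proof
  fix a
  have "sf_mult sf_one g a = (\<Sum>(b, c)\<in>{(0, a)}. sf_one b * g c)"
    unfolding sf_mult_def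
    by (rule sum.mono_neutral_right) (auto simp: sf_mult_support_finite sf_one_def split: if_splits)
  then show "sf_mult sf_one g a = g a" by (simp add: sf_one_def)
qed

definition parts :: "(nat \<Rightarrow>\<^sub>0 nat) \<Rightarrow> nat multiset" where
  "parts a = image_mset (Poly_Mapping.lookup a) (mset_set (Poly_Mapping.keys a))"

lemma zero_notin_parts: "0 \<notin># parts a"
  by (auto simp: parts_def in_keys_iff)

lemma sum_mset_parts: "sum_mset (parts a) = mdeg a"
  by (simp add: parts_def mdeg_def sum_unfold_sum_mset)

lemma parts_Par: "parts a \<in> Par (mdeg a)"
  by (simp add: Par_def zero_notin_parts sum_mset_parts)

lemma parts_eq_insert:
  assumes "i \<in> Poly_Mapping.keys a"
  shows "parts a = add_mset (Poly_Mapping.lookup a i) (image_mset (Poly_Mapping.lookup a) (mset_set (Poly_Mapping.keys a - {i})))"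
  unfolding parts_def using assms mset_set.remove[of "Poly_Mapping.keys a" i] by simp

lemma pos_part_parts_minus:
  assumes "i \<in> Poly_Mapping.keys a" "1 \<le> k" "k \<le> Poly_Mapping.lookup a i"
  shows "parts (a - Poly_Mapping.single i k) = pos_part (add_mset (Poly_Mapping.lookup a i - k) (parts a - {#Poly_Mapping.lookup a i#}))"
proof -
  let ?b = "a - Poly_Mapping.single i k"
  let ?R = "image_mset (Poly_Mapping.lookup a) (mset_set (Poly_Mapping.keys a - {i}))"
  have lookup_b: "Poly_Mapping.lookup ?b j = (if j = i then Poly_Mapping.lookup a i - k else Poly_Mapping.lookup a j)" for j
    by (simp add: lookup_minus lookup_single when_def)
  have R0: "0 \<notin># ?R" by (auto simp: in_keys_iff)
  have Rb: "image_mset (Poly_Mapping.lookup ?b) (mset_set (Poly_Mapping.keys a - {i})) = ?R"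
    by (intro image_mset_cong) (auto simp: lookup_b)
  have R: "parts a - {#Poly_Mapping.lookup a i#} = ?R" by (simp add: parts_eq_insert[OF assms(1)])
  show ?thesis
  proof (cases "Poly_Mapping.lookup a i = k")
    case True
    then have "Poly_Mapping.keys ?b = Poly_Mapping.keys a - {i}"
      by (intro set_eqI) (simp add: in_keys_iff lookup_b)
    then have "parts ?b = ?R" by (simp only: parts_def Rb)
    then show ?thesis unfolding R using True R0 by (simp add: pos_part_ident)
  next
    case False
    then have k: "Poly_Mapping.keys ?b = Poly_Mapping.keys a"
      using assms by (auto simp: in_keys_iff lookup_b split: if_splits)
    then have "i \<in> Poly_Mapping.keys ?b" using assms by simp
    then have "parts ?b = add_mset (Poly_Mapping.lookup a i - k) ?R"
      using parts_eq_insert[of i ?b] by (simp only: k Rb) (simp add: lookup_b)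
    then show ?thesis unfolding R using False assms(3) R0 by (simp add: pos_part_ident)
  qed
qed

lemma sf_mult_psf:
  assumes "1 \<le> k"
  shows "sf_mult (psf k) f a = (\<Sum>i\<in>{i \<in> Poly_Mapping.keys a. k \<le> Poly_Mapping.lookup a i}. f (a - Poly_Mapping.single i k))"
proof -
  let ?I = "{i \<in> Poly_Mapping.keys a. k \<le> Poly_Mapping.lookup a i}"
  let ?h = "\<lambda>i. (Poly_Mapping.single i k, a - Poly_Mapping.single i k)"
  have add: "Poly_Mapping.single i k + (a - Poly_Mapping.single i k) = a" if "i \<in> ?I" for i
    using that by (intro poly_mapping_eqI) (auto simp: lookup_add lookup_minus lookup_single when_def)
  have "sf_mult (psf k) f a = (\<Sum>(b, c)\<in>?h ` ?I. psf k b * f c)"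
    unfolding sf_mult_def
  proof (rule sum.mono_neutral_right[OF sf_mult_support_finite])
    show "?h ` ?I \<subseteq> {(b, c). b + c = a}" using add by auto
    show "\<forall>z\<in>{(b, c). b + c = a} - ?h ` ?I. (case z of (b, c) \<Rightarrow> psf k b * f c) = 0"
    proof safe
      fix b c assume a: "a = b + c" and nin: "(b, c) \<notin> (\<lambda>i. (Poly_Mapping.single i k, b + c - Poly_Mapping.single i k)) `
          {i \<in> Poly_Mapping.keys (b + c). k \<le> Poly_Mapping.lookup (b + c) i}"
      have "psf k b = 0"
      proof (rule ccontr)
        assume "psf k b \<noteq> 0"
        then obtain i where "b = Poly_Mapping.single i k" by (auto simp: psf_def split: if_splits)
        then show False using nin assms
          by (auto simp: in_keys_iff lookup_add lookup_single intro!: image_eqI[of _ _ i])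
      qed
      then show "psf k b * f c = 0" by simp
    qed
  qed
  also have "\<dots> = (\<Sum>i\<in>?I. psf k (Poly_Mapping.single i k) * f (a - Poly_Mapping.single i k))"
  proof (subst sum.reindex)
    show "inj_on ?h ?I"
      using assms by (auto simp: inj_on_def dest!: arg_cong[where f = Poly_Mapping.keys] split: if_splits)
  qed simp
  also have "\<dots> = (\<Sum>i\<in>?I. f (a - Poly_Mapping.single i k))"
    by (intro sum.cong) (auto simp: psf_def)
  finally show ?thesis .
qed

lemma sf_mult_psf_parts:
  assumes "1 \<le> k" and zinv: "\<And>A. \<phi> (pos_part A) = \<phi> A"
  shows "sf_mult (psf k) (\<lambda>a. \<phi> (parts a)) a = pmul k \<phi> (parts a)"
proof -
  let ?l = "Poly_Mapping.lookup a"
  have "pmul k \<phi> (parts a) = (\<Sum>i\<in>Poly_Mapping.keys a.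
      if k \<le> ?l i then \<phi> (add_mset (?l i - k) (parts a - {#?l i#})) else 0)"
    unfolding pmul_def by (subst (1) parts_def) (simp add: sum_unfold_sum_mset image_mset.compositionality comp_def)
  also have "\<dots> = (\<Sum>i\<in>{i \<in> Poly_Mapping.keys a. k \<le> ?l i}. \<phi> (add_mset (?l i - k) (parts a - {#?l i#})))"
    by (simp add: sum.inter_filter)
  also have "\<dots> = (\<Sum>i\<in>{i \<in> Poly_Mapping.keys a. k \<le> ?l i}. \<phi> (parts (a - Poly_Mapping.single i k)))"
  proof (intro sum.cong refl)
    fix i assume "i \<in> {i \<in> Poly_Mapping.keys a. k \<le> ?l i}"
    then have "parts (a - Poly_Mapping.single i k) = pos_part (add_mset (?l i - k) (parts a - {#?l i#}))"
      using assms(1) by (intro pos_part_parts_minus) auto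
    then show "\<phi> (add_mset (?l i - k) (parts a - {#?l i#})) = \<phi> (parts (a - Poly_Mapping.single i k))"
      by (simp only: zinv)
  qed
  finally show ?thesis using assms(1) by (simp add: sf_mult_psf)
qed

lemma sf_one_parts: "sf_one a = pone (parts a)"
proof -
  have "mdeg a = 0 \<longleftrightarrow> a = 0"
    by (auto simp: mdeg_def in_keys_iff) (metis in_keys_iff keys_eq_empty equals0I)
  then show ?thesis by (simp add: sf_one_def pone_def sum_mset_parts del: sum_mset_0_iff)
qed

lemma p_list_parts: "0 \<notin> set la \<Longrightarrow> p_list la a = pm (mset la) (parts a)"
proof (induction la arbitrary: a)
  case Nil
  then show ?case by (simp add: sf_one_parts)
next
  case (Cons k la)
  then have "p_list la = (\<lambda>a. pm (mset la) (parts a))" by auto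
  then have "p_list (k # la) a = sf_mult (psf k) (\<lambda>a. pm (mset la) (parts a)) a" by simp
  also have "\<dots> = pmul k (pm (mset la)) (parts a)"
    using Cons.prems by (intro sf_mult_psf_parts) (auto simp: pm_pos_part)
  finally show ?case by simp
qed

text \<open>By the Cauchy identity these are the power sum coordinates of \<open>q\<^sub>A\<close>.\<close>

definition qcoord :: "nat multiset \<Rightarrow> nat multiset \<Rightarrow> F" where
  "qcoord A l = pm l A / wt l"

lemma ev_qcoord_degree: "sum_mset A \<noteq> sum_mset B \<Longrightarrow> ev (qcoord A) B = 0"
  unfolding ev_def by (intro sum.neutral) (auto simp: qcoord_def Par_def dest: pm_nonzero_degree)

text \<open>The weight in the form cancels the denominator of \<open>qcoord\<close>: this is the
  duality of the q_A and the m_A.\<close>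

lemma form_qcoord: "A \<in> Par n \<Longrightarrow> form n (qcoord A) d = ev d A"
  unfolding form_def ev_Par
  by (intro sum.cong) (auto simp: qcoord_def Par_def dest: wt_pos)

text \<open>The Newton-type recursion alpha n Q_n = sum of p_k Q_(n-k), with the further factors A
  carried along. In coordinates it is the transpose of \<open>pm_chain_rule\<close>.\<close>

lemma ev_qcoord_recursion:
  "alpha * of_nat x * ev (qcoord (add_mset x A)) B = (\<Sum>k=1..x. pmul k (ev (qcoord (add_mset (x - k) A))) B)"
proof -
  have "alpha * of_nat x * qcoord (add_mset x A) l = (\<Sum>k=1..x. pcm k (qcoord (add_mset (x - k) A)) l)" if l: "0 \<notin># l" for l
  proof -
    have "pcm k (qcoord (add_mset (x - k) A)) l = alpha * (of_nat (k * count l k) * pm (l - {#k#}) (add_mset (x - k) A)) / wt l" for k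
    proof (cases "k \<in># l")
      case True
      then obtain l' where l': "l = add_mset k l'" by (metis multi_member_split)
      define s where "s = (of_nat (k * Suc (count l' k)) :: F)"
      have "k \<noteq> 0" using l l' by auto
      then have s: "s \<noteq> 0" unfolding s_def by (subst of_nat_eq_0_iff) simp
      have "wt l = alpha * s * wt l'" by (simp only: l' wt_add_mset s_def)
      moreover have "of_nat (k * count l k) = s" by (simp add: l' s_def)
      ultimately show ?thesis using s by (simp add: pcm_def qcoord_def True) (simp add: l')
    qed (simp add: pcm_def count_eq_zero_iff)
    then show ?thesis
      by (simp only: qcoord_def flip: sum_divide_distrib sum_distrib_left pm_chain_rule) simp
  qed
  then have "ev (\<lambda>l. alpha * of_nat x * qcoord (add_mset x A) l) B = ev (\<lambda>l. \<Sum>k=1..x. pcm k (qcoord (add_mset (x - k) A)) l) B"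
    by (intro ev_cong) (auto simp: Par_def)
  then show ?thesis by (simp add: ev_scale ev_sum ev_pcm)
qed

section \<open>Translation between multisets, partition lists and power series\<close>

definition SF :: "nat \<Rightarrow> (nat multiset \<Rightarrow> F) \<Rightarrow> sf" where
  "SF n d a = (if mdeg a = n then ev d (parts a) else 0)"

definition part_list :: "nat multiset \<Rightarrow> nat list" where
  "part_list A = rev (sorted_list_of_multiset A)"

lemma mset_part_list [simp]: "mset (part_list A) = A"
  by (simp add: part_list_def)

lemma is_partition_part_list: "0 \<notin># A \<Longrightarrow> is_partition (part_list A)"
  by (auto simp: is_partition_def part_list_def intro: gr0I)

lemma part_list_mset: "is_partition la \<Longrightarrow> part_list (mset la) = la"
  unfolding is_partition_def part_list_def
  by (metis mset_rev rev_rev_ident sorted_list_of_multiset_mset sorted_sort_id)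

lemma partition_eqI: "\<lbrakk>is_partition la; is_partition mu; mset la = mset mu\<rbrakk> \<Longrightarrow> la = mu"
  by (metis part_list_mset)

lemma mset_Par: "is_partition la \<Longrightarrow> mset la \<in> Par (sum_list la)"
  by (auto simp: Par_def is_partition_def sum_mset_sum_list)

lemma part_list_partitions: "A \<in> Par n \<Longrightarrow> part_list A \<in> partitions n"
  using is_partition_part_list[of A] sum_mset_sum_list[of "part_list A"] by (auto simp: Par_def partitions_def)

lemma partitionsD: "la \<in> partitions n \<Longrightarrow> mset la \<in> Par n" "la \<in> partitions n \<Longrightarrow> part_list (mset la) = la"
  by (auto simp: partitions_def part_list_mset mset_Par)

lemma sum_partitions: "(\<Sum>la\<in>partitions n. f la) = (\<Sum>A\<in>Par n. f (part_list A))"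
  by (rule sum.reindex_bij_witness[of _ part_list mset])
    (simp_all add: part_list_partitions partitionsD)

lemma mset_shape: "mset (shape a) = parts a"
  by (simp add: shape_def parts_def flip: sorted_list_of_mset_set)

lemma shape_eq: "shape a = part_list (parts a)"
proof -
  have "is_partition (shape a)"
    unfolding is_partition_def
  proof
    have "set (shape a) = set_mset (parts a)" by (metis mset_shape set_mset_mset)
    then show "\<forall>x\<in>set (shape a). 0 < x" using zero_notin_parts[of a] by (metis gr0I)
  qed (simp add: shape_def)
  then show ?thesis using part_list_mset[of "shape a"] by (simp add: mset_shape)
qed

lemma msf_eq: "is_partition la \<Longrightarrow> msf la a = (if parts a = mset la then 1 else 0)"
  unfolding msf_def shape_eq by (metis mset_part_list part_list_mset)

lemma parts_mono_of:
  assumes "is_partition la"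
  shows "parts (mono_of la) = mset la"
proof -
  have l: "Poly_Mapping.lookup (mono_of la) i = (if i < length la then la ! i else 0)" for i
    unfolding mono_of_def lookup_sum lookup_single when_def
    by (subst sum.delta) auto
  then have k: "Poly_Mapping.keys (mono_of la) = {0..<length la}"
    using assms by (auto simp: in_keys_iff is_partition_def split: if_splits)
  have "parts (mono_of la) = image_mset (\<lambda>i. la ! i) (mset_set {0..<length la})"
    unfolding parts_def k by (intro image_mset_cong) (auto simp: l)
  also have "\<dots> = mset (map (\<lambda>i. la ! i) [0..<length la])" by (simp flip: mset_upt)
  finally show ?thesis by (simp add: map_nth)
qed

lemma mdeg_mono_of: "is_partition la \<Longrightarrow> mdeg (mono_of la) = sum_list la"
  using sum_mset_parts[of "mono_of la"] by (simp add: parts_mono_of sum_mset_sum_list)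

lemma SF_mono_of: "A \<in> Par n \<Longrightarrow> SF n d (mono_of (part_list A)) = ev d A"
  using mdeg_mono_of[of "part_list A"] parts_mono_of[of "part_list A"] sum_mset_sum_list[of "part_list A"] is_partition_part_list[of A]
  by (auto simp: SF_def Par_def)

lemma SF_eq_iff: "SF n c = SF n d \<longleftrightarrow> (\<forall>l\<in>Par n. c l = d l)"
proof
  assume "SF n c = SF n d"
  then have "ev c A = ev d A" if "A \<in> Par n" for A using SF_mono_of[OF that] by metis
  then show "\<forall>l\<in>Par n. c l = d l" using ev_inject_eq by blast
next
  assume "\<forall>l\<in>Par n. c l = d l"
  then show "SF n c = SF n d"
    by (auto simp: fun_eq_iff SF_def sum_mset_parts intro!: ev_cong)
qed

lemma Qn_parts: "Qn n a = ev (qcoord {#n#}) (parts a)"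
proof -
  \<comment> \<open>In one variable every \<open>p_l\<close> is a single power with coefficient 1,
    so in degree n \<open>qcoord {#n#}\<close> has exactly the coefficients 1 / \<open>wt l\<close>
    of \<open>Qn n\<close>.\<close>
  have pm1: "pm l {#x#} = (if x = sum_mset l then 1 else 0)" for l x
    by (induction l arbitrary: x) (auto simp: pone_def pmul_def)
  have "Qn n a = (\<Sum>l\<in>Par n. inverse (wt l) * pm l (parts a))"
    unfolding Qn_def sum_partitions
  proof (intro sum.cong refl)
    fix l assume l: "l \<in> Par n"
    have "wt l = alpha ^ length (part_list l) * of_nat (zee (part_list l))"
      unfolding wt_def zee_def mult_def
      by (metis (no_types, lifting) count_mset mset_part_list prod.cong set_mset_mset size_mset)
    moreover have "p_list (part_list l) a = pm l (parts a)"
      using l set_mset_mset[of "part_list l"] by (subst p_list_parts) (auto simp: Par_def)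
    ultimately show "inverse (alpha ^ length (part_list l) * of_nat (zee (part_list l))) * p_list (part_list l) a
       = inverse (wt l) * pm l (parts a)" by simp
  qed
  also have "\<dots> = ev (qcoord {#n#}) (parts a)"
  proof (cases "mdeg a = n")
    case True
    then show ?thesis unfolding ev_def sum_mset_parts
      by (intro sum.cong) (auto simp: qcoord_def pm1 Par_def divide_inverse)
  next
    case False
    then have "ev (qcoord {#n#}) (parts a) = 0" by (intro ev_qcoord_degree) (simp add: sum_mset_parts)
    moreover have "pm l (parts a) = 0" if "l \<in> Par n" for l
      using False that pm_nonzero_degree[of l "parts a"] by (auto simp: sum_mset_parts Par_def)
    ultimately show ?thesis by simp
  qed
  finally show ?thesis .
qed

lemma ev_qcoord_empty: "ev (qcoord {#}) (parts a) = sf_one a"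
proof (cases "mdeg a = 0")
  case True
  then have "sum_mset (parts a) = 0" "0 \<notin># parts a" by (simp_all add: sum_mset_parts zero_notin_parts del: sum_mset_0_iff)
  then have "parts a = {#}" by (metis multiset_nonemptyE sum_mset_0_iff)
  moreover have "Par 0 = {{#}}" by (auto simp: Par_def) (metis multiset_nonemptyE)
  ultimately show ?thesis by (simp add: ev_def qcoord_def sf_one_parts pone_def)
next
  case False
  then show ?thesis using ev_qcoord_degree[of "{#}" "parts a"]
    by (simp add: sf_one_parts pone_def sum_mset_parts del: sum_mset_0_iff)
qed

text \<open>Both sides satisfy the recursion of \<open>ev_qcoord_recursion\<close>, and for x > 0
  the factor alpha x can be cancelled. The base case is Q_0 = 1.\<close>

lemma sf_mult_Qn: "sf_mult (Qn x) (\<lambda>a. ev (qcoord A) (parts a)) = (\<lambda>a. ev (qcoord (add_mset x A)) (parts a))"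
proof (induction x rule: less_induct)
  case (less x)
  show ?case
  proof (cases "x = 0")
    case True
    have z: "ev (qcoord (add_mset 0 A)) B = ev (qcoord A) B" for A B
      by (intro ev_cong) (auto simp: qcoord_def Par_def pm_add_zero)
    have "Qn 0 = sf_one" by (simp add: fun_eq_iff Qn_parts z ev_qcoord_empty)
    then show ?thesis using True by (simp add: sf_mult_one_left z)
  next
    case False
    let ?g = "\<lambda>a. ev (qcoord A) (parts a)"
    have "(\<lambda>a. alpha * of_nat x * Qn x a) = (\<lambda>a. \<Sum>k=1..x. sf_mult (psf k) (Qn (x - k)) a)"
    proof
      fix a
      have "sf_mult (psf k) (Qn (x - k)) a = pmul k (ev (qcoord {#x - k#})) (parts a)" if "k \<in> {1..x}" for k
        unfolding Qn_parts[abs_def] using that by (intro sf_mult_psf_parts) auto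
      then show "alpha * of_nat x * Qn x a = (\<Sum>k=1..x. sf_mult (psf k) (Qn (x - k)) a)"
        by (simp add: Qn_parts ev_qcoord_recursion)
    qed
    then have "alpha * of_nat x * sf_mult (Qn x) ?g a = (\<Sum>k=1..x. sf_mult (sf_mult (psf k) (Qn (x - k))) ?g a)" for a
      by (simp only: flip: sf_mult_scale_left sf_mult_sum_left)
    also have "(\<Sum>k=1..x. sf_mult (sf_mult (psf k) (Qn (x - k))) ?g a) = (\<Sum>k=1..x. pmul k (ev (qcoord (add_mset (x - k) A))) (parts a))" for a
    proof (intro sum.cong refl)
      fix k assume k: "k \<in> {1..x}"
      then have "sf_mult (Qn (x - k)) ?g = (\<lambda>a. ev (qcoord (add_mset (x - k) A)) (parts a))"
        by (intro less) auto
      then show "sf_mult (sf_mult (psf k) (Qn (x - k))) ?g a = pmul k (ev (qcoord (add_mset (x - k) A))) (parts a)"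
        unfolding sf_mult_assoc using k by (simp add: sf_mult_psf_parts)
    qed
    finally have "alpha * of_nat x * sf_mult (Qn x) ?g a = alpha * of_nat x * ev (qcoord (add_mset x A)) (parts a)" for a
      unfolding ev_qcoord_recursion .
    then show ?thesis using False by auto
  qed
qed

lemma q_list_parts: "q_list la = (\<lambda>a. ev (qcoord (mset la)) (parts a))"
proof (induction la)
  case Nil
  show ?case by (simp add: fun_eq_iff ev_qcoord_empty)
next
  case (Cons k la)
  then show ?case using sf_mult_Qn[of k "mset la"] by simp
qed

section \<open>Jack functions as power series\<close>

text \<open>Each of the first i parts is at most t plus its excess over t. For sorted lists equality
  is attained at a suitable i for given t and at a suitable t for given i, which is the Legendre
  duality.\<close>

lemma psum_le_hinge: "psum la i \<le> i * t + hinge (mset la) t"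
proof (induction la arbitrary: i)
  case Nil
  then show ?case by (simp add: psum_def)
next
  case (Cons x la)
  show ?case
  proof (cases i)
    case (Suc j)
    then show ?thesis using Cons[of j] by (simp add: psum_def)
  qed (simp add: psum_def)
qed

lemma psum_eq_hinge:
  assumes "\<And>x. x \<in> set (take i la) \<Longrightarrow> t \<le> x" "\<And>x. x \<in> set (drop i la) \<Longrightarrow> x \<le> t" "i \<le> length la"
  shows "psum la i = i * t + hinge (mset la) t"
proof -
  have "sum_list xs = length xs * t + hinge (mset xs) t" if "\<And>x. x \<in> set xs \<Longrightarrow> t \<le> x" for xs
    using that
  proof (induction xs)
    case (Cons x xs)
    then have "t \<le> x" "sum_list xs = length xs * t + hinge (mset xs) t" by simp_all
    then show ?case unfolding mset.simps hinge_add_mset sum_list.Cons list.size mult_Suc by simp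
  qed (simp add: hinge_def)
  from this[of "take i la"] assms have "psum la i = i * t + hinge (mset (take i la)) t"
    by (simp add: psum_def)
  moreover have "hinge (mset (drop i la)) t = 0"
    using assms(2) by (auto simp: hinge_def)
  moreover have "hinge (mset la) t = hinge (mset (take i la)) t + hinge (mset (drop i la)) t"
    unfolding hinge_def by (metis append_take_drop_id image_mset_union mset_append sum_mset.union)
  ultimately show ?thesis by simp
qed

lemma sorted_rev_nth: "sorted (rev la) \<Longrightarrow> i \<le> j \<Longrightarrow> j < length la \<Longrightarrow> la ! j \<le> la ! i"
  by (simp add: sorted_rev_iff_nth_mono)

lemma hinge_eq_psum:
  assumes "sorted (rev la)"
  shows "\<exists>i. psum la i = i * t + hinge (mset la) t"
proof -
  have "\<exists>i\<le>length la. (\<forall>x\<in>set (take i la). t \<le> x) \<and> (\<forall>x\<in>set (drop i la). x \<le> t)"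
    using assms
  proof (induction la)
    case (Cons x la)
    show ?case
    proof (cases "t \<le> x")
      case True
      obtain i where "i\<le>length la" "\<forall>x\<in>set (take i la). t \<le> x" "\<forall>x\<in>set (drop i la). x \<le> t"
        using Cons by (auto simp: sorted_append)
      then show ?thesis using True by (intro exI[of _ "Suc i"]) auto
    next
      case False
      then show ?thesis using Cons.prems by (intro exI[of _ 0]) (auto simp: sorted_append intro: order_trans)
    qed
  qed simp
  then show ?thesis using psum_eq_hinge by blast
qed

lemma psum_eq_hinge_ex:
  assumes "sorted (rev la)"
  shows "\<exists>t. psum la i = i * t + hinge (mset la) t"
proof (cases "i < length la")
  case True
  have "la ! i \<le> x" if x: "x \<in> set (take i la)" for x
  proof -
    obtain j where "j < i" "x = la ! j"
      using x True by (auto simp: in_set_conv_nth)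
    then show ?thesis using sorted_rev_nth[OF assms, of j i] True by simp
  qed
  moreover have "x \<le> la ! i" if x: "x \<in> set (drop i la)" for x
  proof -
    obtain j where "j < length la - i" "x = la ! (i + j)"
      using x by (auto simp: in_set_conv_nth)
    then show ?thesis using sorted_rev_nth[OF assms, of i "i + j"] True by simp
  qed
  ultimately show ?thesis using psum_eq_hinge[of i la "la ! i"] True by auto
next
  case False
  then show ?thesis by (intro exI[of _ 0]) (simp add: psum_def hinge_def sum_mset_sum_list)
qed

text \<open>In one direction i is chosen so that the bound \<open>psum_le_hinge\<close> is sharp for
  mu, in the other t is chosen so that it is sharp for la; the other partition only needs the bound
  itself.\<close>

lemma dom_le_iff:
  assumes "is_partition mu" "is_partition la"
  shows "dom_le mu la \<longleftrightarrow> dle (mset mu) (mset la)"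
proof -
  have s: "sorted (rev mu)" "sorted (rev la)" using assms by (auto simp: is_partition_def)
  have "(\<forall>i. psum mu i \<le> psum la i) \<longleftrightarrow> (\<forall>t. hinge (mset mu) t \<le> hinge (mset la) t)"
  proof safe
    fix t assume le: "\<forall>i. psum mu i \<le> psum la i"
    obtain i where "psum mu i = i * t + hinge (mset mu) t" using hinge_eq_psum[OF s(1)] by blast
    then show "hinge (mset mu) t \<le> hinge (mset la) t"
      using le psum_le_hinge[of la i t] by (metis add_le_cancel_left order_trans)
  next
    fix i assume le: "\<forall>t. hinge (mset mu) t \<le> hinge (mset la) t"
    obtain t where "psum la i = i * t + hinge (mset la) t" using psum_eq_hinge_ex[OF s(2)] by blast
    then show "psum mu i \<le> psum la i"
      using le psum_le_hinge[of mu i t] by (metis add_le_cancel_left order_trans)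
  qed
  then show ?thesis using assms by (auto simp: dom_le_def dle_def sum_mset_sum_list)
qed

lemma dom_less_iff: "is_partition mu \<Longrightarrow> is_partition la \<Longrightarrow> dom_less mu la \<longleftrightarrow> dlt (mset mu) (mset la)"
  using dom_le_iff[of mu la] dlt_iff[of "mset mu" "mset la"] partition_eqI[of mu la]
  by (auto simp: dom_less_def is_partition_def)

section \<open>Coordinates in the bases \<open>p_list\<close> and \<open>q_list\<close>, and the
  scalar product\<close>

definition extend :: "nat \<Rightarrow> (nat multiset \<Rightarrow> F) \<Rightarrow> nat list \<Rightarrow> F" where
  "extend n d la = (if la \<in> partitions n then d (mset la) else 0)"

lemma coords_eqI:
  assumes "f = (\<lambda>a. \<Sum>la\<in>partitions n. d (mset la) * b la a)"
    and "\<And>c. f = (\<lambda>a. \<Sum>la\<in>partitions n. c la * b la a) \<Longrightarrow> \<forall>A\<in>Par n. c (part_list A) = d A"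
  shows "coords b n f = extend n d"
  unfolding coords_def
proof (rule the_equality)
  show "(\<forall>la. extend n d la \<noteq> 0 \<longrightarrow> la \<in> partitions n) \<and> f = (\<lambda>a. \<Sum>la\<in>partitions n. extend n d la * b la a)"
    by (auto simp: extend_def assms(1))
next
  fix c assume c: "(\<forall>la. c la \<noteq> 0 \<longrightarrow> la \<in> partitions n) \<and> f = (\<lambda>a. \<Sum>la\<in>partitions n. c la * b la a)"
  show "c = extend n d"
  proof
    fix la show "c la = extend n d la"
      using c assms(2)[of c] partitionsD[of la n] by (cases "la \<in> partitions n") (auto simp: extend_def)
  qed
qed

lemma sum_p_list: "(\<Sum>la\<in>partitions n. c la * p_list la a) = SF n (\<lambda>A. c (part_list A)) a"
proof -
  have "(\<Sum>la\<in>partitions n. c la * p_list la a) = (\<Sum>A\<in>Par n. c (part_list A) * pm A (parts a))"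
    unfolding sum_partitions
  proof (intro sum.cong refl)
    fix A assume A: "A \<in> Par n"
    then show "c (part_list A) * p_list (part_list A) a = c (part_list A) * pm A (parts a)"
      using p_list_parts[of "part_list A"] set_mset_mset[of "part_list A"] by (simp add: Par_def)
  qed
  also have "\<dots> = SF n (\<lambda>A. c (part_list A)) a"
  proof (cases "mdeg a = n")
    case False
    then have "pm A (parts a) = 0" if "A \<in> Par n" for A
      using that pm_nonzero_degree[of A "parts a"] by (auto simp: Par_def sum_mset_parts)
    then show ?thesis using False by (simp add: SF_def)
  qed (simp add: SF_def ev_def sum_mset_parts)
  finally show ?thesis .
qed

lemma coords_p_list: "coords p_list n (SF n d) = extend n d"
proof (rule coords_eqI)
  show "SF n d = (\<lambda>a. \<Sum>la\<in>partitions n. d (mset la) * p_list la a)"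
    by (simp add: sum_p_list)
next
  fix c assume "SF n d = (\<lambda>a. \<Sum>la\<in>partitions n. c la * p_list la a)"
  then have "SF n d = SF n (\<lambda>A. c (part_list A))" unfolding sum_p_list by simp
  then show "\<forall>A\<in>Par n. c (part_list A) = d A" by (simp add: SF_eq_iff)
qed

lemma sum_q_list: "(\<Sum>la\<in>partitions n. c la * q_list la a) = SF n (\<lambda>l. \<Sum>A\<in>Par n. c (part_list A) * qcoord A l) a"
proof -
  have "(\<Sum>la\<in>partitions n. c la * q_list la a) = (\<Sum>A\<in>Par n. c (part_list A) * ev (qcoord A) (parts a))"
    unfolding sum_partitions by (simp add: q_list_parts)
  also have "\<dots> = SF n (\<lambda>l. \<Sum>A\<in>Par n. c (part_list A) * qcoord A l) a"
  proof (cases "mdeg a = n")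
    case False
    then have "ev (qcoord A) (parts a) = 0" if "A \<in> Par n" for A
      using that by (intro ev_qcoord_degree) (auto simp: Par_def sum_mset_parts)
    then show ?thesis using False by (simp add: SF_def)
  qed (simp add: SF_def ev_sum ev_scale)
  finally show ?thesis .
qed

lemma form_sum_qcoord: "form n (\<lambda>l. \<Sum>A\<in>Par n. c A * qcoord A l) d = (\<Sum>A\<in>Par n. c A * ev d A)"
  unfolding form_sum_left form_scale_left by (intro sum.cong) (auto simp: form_qcoord)

text \<open>By duality the coefficient of q_A in d is the product of d with m_A. The error e of this
  expansion is orthogonal to itself, since \<open>form_expansion\<close> and
  \<open>form_sum_qcoord\<close> give the same sum.\<close>

lemma coords_q_list: "coords q_list n (SF n d) = extend n (\<lambda>A. form n d (mcoord A))"
proof (rule coords_eqI)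
  define e where "e l = d l + (-1) * (\<Sum>A\<in>Par n. form n d (mcoord A) * qcoord A l)" for l
  have "form n e e = form n d e + (-1) * (\<Sum>A\<in>Par n. form n d (mcoord A) * ev e A)"
    unfolding form_sum_qcoord[symmetric] form_scale_left[symmetric] form_add_left[symmetric] by (simp only: e_def[abs_def])
  also have "\<dots> = 0" unfolding form_expansion[of n d e] by (simp add: mult.commute)
  finally have "e l = 0" if "l \<in> Par n" for l using form_self_eq_0 that by blast
  then have "SF n d = SF n (\<lambda>l. \<Sum>A\<in>Par n. form n d (mcoord A) * qcoord A l)"
    by (simp add: SF_eq_iff e_def)
  then show "SF n d = (\<lambda>a. \<Sum>la\<in>partitions n. form n d (mcoord (mset la)) * q_list la a)"
    unfolding sum_q_list by (simp add: fun_eq_iff)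
next
  fix c assume "SF n d = (\<lambda>a. \<Sum>la\<in>partitions n. c la * q_list la a)"
  then have "SF n d = SF n (\<lambda>l. \<Sum>A\<in>Par n. c (part_list A) * qcoord A l)"
    unfolding sum_q_list by (simp add: fun_eq_iff)
  then have eq: "d l = (\<Sum>A\<in>Par n. c (part_list A) * qcoord A l)" if "l \<in> Par n" for l
    using that by (simp add: SF_eq_iff)
  show "\<forall>A\<in>Par n. c (part_list A) = form n d (mcoord A)"
  proof
    fix B assume B: "B \<in> Par n"
    have "form n d (mcoord B) = form n (\<lambda>l. \<Sum>A\<in>Par n. c (part_list A) * qcoord A l) (mcoord B)"
      by (intro form_cong eq refl)
    also have "\<dots> = (\<Sum>A\<in>Par n. if A = B then c (part_list B) else 0)"
      unfolding form_sum_qcoord by (intro sum.cong) (auto simp: ev_mcoord[OF B])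
    finally show "c (part_list B) = form n d (mcoord B)" using B by simp
  qed
qed

lemma hom_SF: "hom m (SF n d) = SF m (\<lambda>l. if m = n then d l else 0)"
  by (auto simp: hom_def SF_def ev_def fun_eq_iff)

lemma sprod_SF: "sprod (SF n c) (SF m d) = (if n = m then form n c d else 0)"
proof -
  let ?N = "{k. \<exists>a. mdeg a = k \<and> (SF n c a \<noteq> 0 \<or> SF m d a \<noteq> 0)}"
  have eq: "(\<Sum>la\<in>partitions k. coords p_list k (hom k (SF n c)) la * coords p_list k (hom k (SF m d)) la
          * alpha ^ length la * of_nat (zee la)) = (if n = m \<and> k = n then form n c d else 0)" for k
  proof -
    have "alpha ^ length (part_list l) * of_nat (zee (part_list l)) = wt l" for l
      unfolding wt_def zee_def mult_def
      by (metis (no_types, lifting) count_mset mset_part_list prod.cong set_mset_mset size_mset)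
    then show ?thesis
      unfolding hom_SF coords_p_list sum_partitions form_def
      by (auto simp: extend_def part_list_partitions mult.assoc intro!: sum.neutral sum.cong)
  qed
  have sub: "?N \<subseteq> {n, m}" by (auto simp: SF_def)
  have "sprod (SF n c) (SF m d) = (\<Sum>k\<in>?N. if n = m \<and> k = n then form n c d else 0)"
    unfolding sprod_def eq ..
  also have "\<dots> = (if n = m \<and> n \<in> ?N then form n c d else 0)"
    using finite_subset[OF sub] by (cases "n = m") (auto simp del: mem_Collect_eq)
  \<comment> \<open>For n = m, the degree n is missing from the index set of \<open>sprod\<close>
    only when both functions are zero, and then the form is 0 as well.\<close>
  also have "\<dots> = (if n = m then form n c d else 0)"
  proof (cases "n \<in> ?N \<or> n \<noteq> m")
    case False
    then have "SF n c a = 0" for a by (auto simp: SF_def)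
    then have "SF n c = SF n (\<lambda>_. 0)" by (simp add: fun_eq_iff SF_def ev_def)
    then have "c l = 0" if "l \<in> Par n" for l using that by (simp add: SF_eq_iff)
    then show ?thesis by (simp add: form_def)
  qed auto
  finally show ?thesis .
qed

section \<open>The family of Jack functions as power series\<close>

lemma finite_dom_less: "finite {mu. dom_less mu la}"
proof (rule finite_subset)
  show "{mu. dom_less mu la} \<subseteq> part_list ` Par (sum_list la)"
    using mset_Par part_list_mset by (force simp: dom_less_def dom_le_def)
qed simp

lemma triangular_eval:
  assumes "is_partition la"
  shows "msf la a + (\<Sum>mu\<in>{mu. dom_less mu la}. c mu * msf mu a)
    = (if parts a = mset la then 1 else if dlt (parts a) (mset la) then c (part_list (parts a)) else 0)"
proof -
  have p: "is_partition (part_list (parts a))" by (rule is_partition_part_list[OF zero_notin_parts])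
  have "(\<Sum>mu\<in>{mu. dom_less mu la}. c mu * msf mu a)
     = (\<Sum>mu\<in>{mu. dom_less mu la}. if mu = part_list (parts a) then c mu else 0)"
  proof (intro sum.cong refl)
    fix mu assume "mu \<in> {mu. dom_less mu la}"
    then have "is_partition mu" by (simp add: dom_less_def dom_le_def)
    then show "c mu * msf mu a = (if mu = part_list (parts a) then c mu else 0)"
      using part_list_mset[of mu] by (auto simp: msf_eq)
  qed
  also have "\<dots> = (if dlt (parts a) (mset la) then c (part_list (parts a)) else 0)"
    using dom_less_iff[OF p assms] by (simp add: finite_dom_less)
  finally show ?thesis using assms by (auto simp: msf_eq dlt_def)
qed

lemma jack_family_SF:
  assumes P: "jack_family P"
  shows "\<exists>D. (\<forall>n. jack_coords n (D n)) \<and> (\<forall>la. is_partition la \<longrightarrow> P la = SF (sum_list la) (D (sum_list la) (mset la)))"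
proof -
  \<comment> \<open>One representative monomial per partition suffices: by \<open>tri\<close> below,
    a value of P depends only on the multiset of exponents.\<close>
  have "\<exists>c. \<forall>B\<in>Par n. ev c B = P (part_list A) (mono_of (part_list B))" for n A
    by (rule ev_surj)
  then obtain D where D: "\<And>n A B. B \<in> Par n \<Longrightarrow> ev (D n A) B = P (part_list A) (mono_of (part_list B))"
    by metis
  have tri: "\<exists>c. \<forall>a. P la a = (if parts a = mset la then 1 else if dlt (parts a) (mset la) then c (part_list (parts a)) else 0)"
    if la: "is_partition la" for la
  proof -
    obtain c where "P la = (\<lambda>a. msf la a + (\<Sum>mu\<in>{mu. dom_less mu la}. c mu * msf mu a))"
      using P la unfolding jack_family_def by blast
    then show ?thesis by (simp only: triangular_eval[OF la]) blast
  qed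
  have SF: "P la = SF (sum_list la) (D (sum_list la) (mset la))" if la: "is_partition la" for la
  proof
    fix a
    obtain c where c: "\<And>a. P la a = (if parts a = mset la then 1 else if dlt (parts a) (mset la) then c (part_list (parts a)) else 0)"
      using tri[OF la] by blast
    show "P la a = SF (sum_list la) (D (sum_list la) (mset la)) a"
    proof (cases "mdeg a = sum_list la")
      case True
      have "parts (mono_of (part_list (parts a))) = parts a"
        by (simp add: parts_mono_of is_partition_part_list zero_notin_parts)
      then have "P la (mono_of (part_list (parts a))) = P la a" by (simp only: c)
      then show ?thesis using True D[OF parts_Par[of a]] by (simp add: SF_def part_list_mset la)
    next
      case False
      then have "sum_mset (parts a) \<noteq> sum_mset (mset la)" by (simp add: sum_mset_parts sum_mset_sum_list)
      then have "parts a \<noteq> mset la" "\<not> dlt (parts a) (mset la)" by (auto simp: dlt_def dle_def)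
      then show ?thesis using False by (simp add: c SF_def)
    qed
  qed
  have "jack_coords n (D n)" for n
    unfolding jack_coords_def
  proof (intro ballI conjI impI)
    fix A assume A: "A \<in> Par n"
    have p: "is_partition (part_list C)" "sum_list (part_list C) = n" if "C \<in> Par n" for C
      using part_list_partitions[OF that] by (auto simp: partitions_def)
    obtain c where c: "\<And>a. P (part_list A) a = (if parts a = A then 1 else if dlt (parts a) A then c (part_list (parts a)) else 0)"
      using tri[OF p(1)[OF A]] unfolding mset_part_list by blast
    have ev: "ev (D n A) B = (if B = A then 1 else if dlt B A then c (part_list B) else 0)" if "B \<in> Par n" for B
      using that p[of B] by (simp add: D c parts_mono_of)
    show "ev (D n A) A = 1" using A by (simp add: ev)
    show "ev (D n A) B = 0" if "B \<in> Par n" "\<not> dle B A" for B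
      using that by (auto simp: ev dlt_def)
    show "form n (D n A) (D n B) = 0" if B: "B \<in> Par n" and "A \<noteq> B" for B
    proof -
      have "part_list A \<noteq> part_list B" using \<open>A \<noteq> B\<close> by (metis mset_part_list)
      then have "sprod (P (part_list A)) (P (part_list B)) = 0"
        using P p[OF A] p[OF B] by (simp add: jack_family_def)
      then show ?thesis
        using SF[OF p(1)[OF A]] SF[OF p(1)[OF B]] by (simp add: p A B sprod_SF)
    qed
  qed
  with SF show ?thesis by blast
qed

lemma jack_family_exists: "\<exists>P. jack_family P"
proof -
  obtain D where D: "\<And>n. jack_coords n (D n)" using jack_coords_exist by metis
  define P where "P la = (if is_partition la then SF (sum_list la) (D (sum_list la) (mset la)) else (\<lambda>_. 0))" for la
  have "jack_family P"
    unfolding jack_family_def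
  proof (intro conjI allI impI)
    fix la assume la: "is_partition la"
    let ?n = "sum_list la"
    define c where "c mu = ev (D ?n (mset la)) (mset mu)" for mu
    have "P la a = msf la a + (\<Sum>mu\<in>{mu. dom_less mu la}. c mu * msf mu a)" for a
      unfolding triangular_eval[OF la]
    proof (cases "mdeg a = ?n")
      case True
      then have a: "parts a \<in> Par ?n" using parts_Par by metis
      then have "\<not> dle (parts a) (mset la)" if "parts a \<noteq> mset la" "\<not> dlt (parts a) (mset la)"
        using that mset_Par[OF la] by (auto simp: dlt_iff Par_def)
      then show "P la a = (if parts a = mset la then 1 else if dlt (parts a) (mset la) then c (part_list (parts a)) else 0)"
        using D[of ?n] mset_Par[OF la] a True la by (auto simp: P_def SF_def c_def jack_coords_def)
    next
      case False
      then have "sum_mset (parts a) \<noteq> sum_mset (mset la)" by (simp add: sum_mset_parts sum_mset_sum_list)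
      then have "parts a \<noteq> mset la" "\<not> dlt (parts a) (mset la)" by (auto simp: dlt_def dle_def)
      then show "P la a = (if parts a = mset la then 1 else if dlt (parts a) (mset la) then c (part_list (parts a)) else 0)"
        using False la by (simp add: P_def SF_def)
    qed
    then show "\<exists>c. P la = (\<lambda>a. msf la a + (\<Sum>mu\<in>{mu. dom_less mu la}. c mu * msf mu a))" by blast
  next
    fix la mu assume p: "is_partition la" "is_partition mu" "la \<noteq> mu"
    then have "mset la \<noteq> mset mu" using partition_eqI by blast
    then have "form (sum_list la) (D (sum_list la) (mset la)) (D (sum_list la) (mset mu)) = 0" if "sum_list la = sum_list mu"
      using D[of "sum_list la"] mset_Par[OF p(1)] mset_Par[OF p(2)] that by (simp add: jack_coords_def)
    then show "sprod (P la) (P mu) = 0"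
      using p by (auto simp: P_def sprod_SF)
  qed (simp add: P_def)
  then show ?thesis by blast
qed

lemma jack_family_unique:
  assumes P: "jack_family P" and P': "jack_family P'"
  shows "P = P'"
proof
  fix la
  show "P la = P' la"
  proof (cases "is_partition la")
    case True
    obtain D where D: "\<forall>n. jack_coords n (D n)" "P la = SF (sum_list la) (D (sum_list la) (mset la))"
      using jack_family_SF[OF P] True by blast
    obtain D' where D': "\<forall>n. jack_coords n (D' n)" "P' la = SF (sum_list la) (D' (sum_list la) (mset la))"
      using jack_family_SF[OF P'] True by blast
    show ?thesis unfolding D(2) D'(2) SF_eq_iff
      using D(1) D'(1) mset_Par[OF True] jack_coords_unique by blast
  next
    case False
    then show ?thesis using P P' by (simp add: jack_family_def)
  qed
qed

lemma jackP_SF: "\<exists>D. (\<forall>n. jack_coords n (D n)) \<and> (\<forall>la. is_partition la \<longrightarrow> jackP la = SF (sum_list la) (D (sum_list la) (mset la)))"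
proof (rule jack_family_SF)
  show "jack_family jackP"
    unfolding jackP_def using jack_family_exists jack_family_unique by (metis theI)
qed

section \<open>The Laplace--Beltrami operator and moving up\<close>

lemma sum_mset_mset_nth: "(\<Sum>x\<in>#mset xs. f x) = (\<Sum>i<length xs. f (xs ! i))"
  by (simp add: sum_mset_sum_list sum_list_sum_nth atLeast0LessThan flip: mset_map)

lemma sum_mset_pairs_nth:
  fixes G :: "'a \<Rightarrow> 'a \<Rightarrow> F"
  assumes sym: "\<And>x y. x \<in> set xs \<Longrightarrow> y \<in> set xs \<Longrightarrow> G x y = G y x"
  shows "(\<Sum>x\<in>#mset xs. \<Sum>y\<in>#mset xs - {#x#}. G x y) = 2 * (\<Sum>(i,j)\<in>{(i,j). i < j \<and> j < length xs}. G (xs ! i) (xs ! j))"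
proof -
  let ?n = "length xs"
  let ?g = "\<lambda>(i,j). G (xs ! i) (xs ! j)"
  let ?L = "{(i,j). i < j \<and> j < ?n}" and ?U = "{(i,j). j < i \<and> i < ?n}" and ?D = "{(i,j). i = j \<and> i < ?n}"
  have fin: "finite ?L" "finite ?U" "finite ?D"
    by (rule finite_subset[of _ "{..<?n} \<times> {..<?n}"]; auto)+
  have "(\<Sum>x\<in>#mset xs. \<Sum>y\<in>#mset xs - {#x#}. G x y) = (\<Sum>x\<in>#mset xs. (\<Sum>y\<in>#mset xs. G x y) - G x x)"
    by (intro sum_mset_cong_strong) (simp add: sum_mset_delete)
  also have "\<dots> = (\<Sum>z\<in>{..<?n} \<times> {..<?n}. ?g z) - (\<Sum>i<?n. G (xs ! i) (xs ! i))"
    by (simp only: sum_mset_subtractf sum_mset_mset_nth sum.cartesian_product)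
  also have "{..<?n} \<times> {..<?n} = ?L \<union> (?U \<union> ?D)" by auto
  also have "sum ?g (?L \<union> (?U \<union> ?D)) = sum ?g ?L + (sum ?g ?U + sum ?g ?D)"
    using fin by (subst sum.union_disjoint; auto)+
  also have "sum ?g ?D = (\<Sum>i<?n. G (xs ! i) (xs ! i))"
    by (rule sum.reindex_bij_witness[of _ "\<lambda>i. (i,i)" fst]) auto
  also have "sum ?g ?U = sum ?g ?L"
    by (rule sum.reindex_bij_witness[of _ prod.swap prod.swap]) (auto intro!: sym)
  finally show ?thesis by simp
qed

lemma count_list_eq_count: "count_list xs a = count (mset xs) a"
  by (induction xs) auto

text \<open>The right-hand side is the multiplicity factor of \<open>rcoef\<close>. The symmetric
  indicator \<open>E\<close>, summed over ordered pairs of distinct positions, counts every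
  admissible pair of positions twice; sortedness puts the larger value first.\<close>

lemma card_pairs:
  fixes a b :: nat
  assumes sorted: "sorted (rev la)" and ab: "b \<le> a"
  shows "(of_nat (card {(i,j). i < j \<and> j < length la \<and> la ! i = a \<and> la ! j = b}) :: F)
    = inverse (1 + of_nat (if a = b then 1 else 0)) * of_nat (mult la a) * (of_nat (mult la b) - of_nat (if a = b then 1 else 0))"
proof -
  define E :: "nat \<Rightarrow> nat \<Rightarrow> F" where "E x y = (if x = a \<and> y = b \<or> x = b \<and> y = a then 1 else 0)" for x y
  let ?P = "{(i,j). i < j \<and> j < length la}"
  let ?S = "{(i,j). i < j \<and> j < length la \<and> la ! i = a \<and> la ! j = b}"
  have fin: "finite ?P" by (rule finite_subset[of _ "{..<length la} \<times> {..<length la}"]) auto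
  have "(\<Sum>(i,j)\<in>?P. E (la ! i) (la ! j)) = (\<Sum>z\<in>?P. if z \<in> ?S then 1 else 0)"
  proof (rule sum.cong[OF refl])
    fix z assume "z \<in> ?P"
    then show "(case z of (i,j) \<Rightarrow> E (la ! i) (la ! j)) = (if z \<in> ?S then 1 else 0)"
      using sorted_rev_nth[OF sorted, of "fst z" "snd z"] ab by (cases z) (auto simp: E_def)
  qed
  also have "\<dots> = of_nat (card ?S)"
  proof -
    have "?P \<inter> ?S = ?S" by auto
    then show ?thesis using fin by (simp add: sum.If_cases Int_def)
  qed
  finally have card: "(\<Sum>x\<in>#mset la. \<Sum>y\<in>#mset la - {#x#}. E x y) = 2 * of_nat (card ?S)"
    using sum_mset_pairs_nth[of la E] by (auto simp: E_def)
  have split: "(\<Sum>x\<in>#mset la. \<Sum>y\<in>#mset la - {#x#}. E x y) = (\<Sum>x\<in>#mset la. \<Sum>y\<in>#mset la. E x y) - (\<Sum>x\<in>#mset la. E x x)"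
    unfolding sum_mset_subtractf[symmetric] by (intro sum_mset_cong_strong) (simp add: sum_mset_delete)
  let ?m = "\<lambda>v. of_nat (count (mset la) v) :: F"
  have delta: "(\<Sum>x\<in>#mset la. if x = v then c else 0) = c * ?m v" for v and c :: F
    by (rule sum_mset_delta)
  show ?thesis
  proof (cases "a = b")
    case True
    have "(\<Sum>y\<in>#mset la. E x y) = (if x = a then ?m a else 0)" for x
      using delta[of a 1] True by (auto simp: E_def)
    then have "(\<Sum>x\<in>#mset la. \<Sum>y\<in>#mset la. E x y) = ?m a * ?m a" by (simp only: delta)
    moreover have "(\<Sum>x\<in>#mset la. E x x) = ?m a" using delta[of a 1] True by (simp add: E_def)
    ultimately have "2 * of_nat (card ?S) = ?m a * (?m a - 1)"
      using card split by (simp add: algebra_simps)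
    then have "of_nat (card ?S) = inverse 2 * (?m a * (?m a - 1))" by (simp add: field_simps)
    then show ?thesis using True by (simp add: mult_def count_list_eq_count)
  next
    case False
    have "(\<Sum>y\<in>#mset la. E x y) = (if x = a then ?m b else 0) + (if x = b then ?m a else 0)" for x
      using delta[of a 1] delta[of b 1] False by (auto simp: E_def)
    then have "(\<Sum>x\<in>#mset la. \<Sum>y\<in>#mset la. E x y) = 2 * (?m a * ?m b)"
      by (simp only: sum_mset.distrib delta) simp
    moreover have "E x x = 0" for x using False by (auto simp: E_def)
    then have "(\<Sum>x\<in>#mset la. E x x) = 0" by simp
    ultimately have "2 * of_nat (card ?S) = 2 * (?m a * ?m b)"
      using card split by simp
    then have "of_nat (card ?S) = ?m a * ?m b" by simp
    then show ?thesis using False by (simp add: mult_def count_list_eq_count)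
  qed
qed

section \<open>Moves and how their results determine them\<close>

lemma mset_moveup: "mset (moveup i j k la) = pos_part (mset (la[i := la ! i + k, j := la ! j - k]))"
  by (simp add: moveup_def pos_part_def)

lemma nth_pair_mset:
  assumes "i < j" "j < length la"
  obtains B where "mset la = add_mset (la ! i) (add_mset (la ! j) B)"
proof -
  have "mset la = add_mset (la ! i) (mset (take i la) + mset (drop (Suc i) la))"
    using assms id_take_nth_drop[of i la] by (metis mset.simps(2) mset_append order.strict_trans union_mset_add_mset_right)
  moreover have "la ! j \<in> set (drop (Suc i) la)"
    using assms by (auto simp: in_set_conv_nth intro!: exI[of _ "j - Suc i"])
  then obtain C where "mset (drop (Suc i) la) = add_mset (la ! j) C"
    by (metis multi_member_split set_mset_mset)
  ultimately show ?thesis using that[of "mset (take i la) + C"] by simp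
qed

lemma mset_moveup':
  assumes "i < j" "j < length la" and "mset la = add_mset (la ! i) (add_mset (la ! j) B)"
  shows "mset (moveup i j k la) = pos_part (add_mset (la ! i + k) (add_mset (la ! j - k) B))"
  unfolding mset_moveup using assms
  by (simp add: mset_update)

lemma is_partition_moveup: "is_partition (moveup i j k la)"
  unfolding is_partition_def moveup_def by auto

lemma moveup_partition_eq: "mset (moveup i j k la) = mset (moveup i' j' k' la') \<Longrightarrow> moveup i j k la = moveup i' j' k' la'"
  by (intro partition_eqI is_partition_moveup)

definition move_profile :: "nat \<Rightarrow> nat \<Rightarrow> nat \<Rightarrow> nat \<Rightarrow> int" where
  "move_profile x y k v = of_bool (x + k = v) + of_bool (y - k = v) - of_bool (x = v) - of_bool (y = v)"

text \<open>The move is read off from the changes of multiplicities, from the top: x + k is the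
  largest value that gains a part, then x is the largest that loses one, then y is what remains. The
  tested values are x + k, x' and y'. Exchanging the two moves turns the inequalities into
  equalities.\<close>

lemma move_profile_le:
  fixes x y k x' y' k' :: nat
  assumes v: "y \<le> x" "0 < k" "k \<le> y" "y' \<le> x'" "0 < k'" "k' \<le> y'"
    and eq: "\<And>v. 0 < v \<Longrightarrow> move_profile x y k v = move_profile x' y' k' v"
  shows "x + k \<le> x' + k'" "x + k = x' + k' \<Longrightarrow> x' \<le> x" "x = x' \<Longrightarrow> k = k' \<Longrightarrow> y' \<le> y"
proof -
  show "x + k \<le> x' + k'"
  proof (rule ccontr)
    assume "\<not> ?thesis"
    then have "move_profile x y k (x + k) = 1" "move_profile x' y' k' (x + k) = 0"
      using v by (simp_all add: move_profile_def)
    then show False using eq[of "x + k"] v by simp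
  qed
  show "x' \<le> x" if "x + k = x' + k'"
  proof (rule ccontr)
    assume "\<not> ?thesis"
    then have "x + k \<noteq> x'" "y - k \<noteq> x'" "x \<noteq> x'" "y \<noteq> x'" "x' + k' \<noteq> x'" "y' - k' \<noteq> x'"
      using v that by auto
    then have "move_profile x y k x' = 0" "move_profile x' y' k' x' < 0"
      by (simp_all add: move_profile_def)
    then show False using eq[of x'] v by simp
  qed
  show "y' \<le> y" if "x = x'" "k = k'"
  proof (rule ccontr)
    assume "\<not> ?thesis"
    then have "move_profile x y k y' = - of_bool (x = y')" "move_profile x' y' k' y' = - of_bool (x = y') - 1"
      using v that by (simp_all add: move_profile_def)
    then show False using eq[of y'] v by simp
  qed
qed

lemma move_determined:
  fixes x y k x' y' k' :: nat
  assumes v: "y \<le> x" "0 < k" "k \<le> y" and v': "y' \<le> x'" "0 < k'" "k' \<le> y'"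
    and A: "A = add_mset x (add_mset y B)" "A = add_mset x' (add_mset y' B')"
    and eq: "pos_part (add_mset (x + k) (add_mset (y - k) B)) = pos_part (add_mset (x' + k') (add_mset (y' - k') B'))"
  shows "x = x' \<and> y = y' \<and> k = k'"
proof -
  have count: "int (count (add_mset u (add_mset w C)) z) = of_bool (u = z) + of_bool (w = z) + int (count C z)" for u w z :: nat and C
    by auto
  have f: "move_profile x y k v = move_profile x' y' k' v" if "0 < v" for v
  proof -
    have "count (pos_part (add_mset (x + k) (add_mset (y - k) B))) v = count (pos_part (add_mset (x' + k') (add_mset (y' - k') B'))) v"
      by (simp only: eq)
    then have "int (count (add_mset (x + k) (add_mset (y - k) B)) v) = int (count (add_mset (x' + k') (add_mset (y' - k') B')) v)"
      using that by (simp only: pos_part_def count_filter_mset if_True)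
    moreover have "int (count (add_mset x (add_mset y B)) v) = int (count (add_mset x' (add_mset y' B')) v)"
      using A by simp
    ultimately show ?thesis unfolding count move_profile_def by linarith
  qed
  note le = move_profile_le[OF v v' f] and ge = move_profile_le[OF v' v f[symmetric]]
  have 1: "x + k = x' + k'" using le(1) ge(1) by (simp add: order.antisym)
  then have 2: "x = x'" using le(2) ge(2) by (simp add: order.antisym)
  with 1 have 3: "k = k'" by simp
  with 2 show ?thesis using le(3) ge(3) by (simp add: order.antisym)
qed

definition moves :: "nat list \<Rightarrow> (nat \<times> nat \<times> nat) set" where
  "moves la = {(i, j, k). moveup_ok i j k la}"

lemma finite_pairs: "finite {(i,j). i < j \<and> j < (n::nat)}"
  by (rule finite_subset[of _ "{..<n} \<times> {..<n}"]) auto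

lemma sum_moves:
  "(\<Sum>(i,j,k)\<in>moves la. g i j k) = (\<Sum>(i,j)\<in>{(i,j). i < j \<and> j < length la}. \<Sum>k=1..la ! j. g i j k)"
proof -
  have "(\<Sum>(i,j)\<in>{(i,j). i < j \<and> j < length la}. \<Sum>k=1..la ! j. g i j k)
    = (\<Sum>z\<in>{(i,j). i < j \<and> j < length la}. \<Sum>k\<in>{1..la ! snd z}. g (fst z) (snd z) k)"
    by (simp add: split_def)
  also have "\<dots> = (\<Sum>(z,k)\<in>Sigma {(i,j). i < j \<and> j < length la} (\<lambda>z. {1..la ! snd z}). g (fst z) (snd z) k)"
    by (rule sum.Sigma) (auto simp: finite_pairs)
  also have "\<dots> = (\<Sum>(i,j,k)\<in>moves la. g i j k)"
    by (rule sum.reindex_bij_witness[of _ "\<lambda>(i,j,k). ((i,j),k)" "\<lambda>((i,j),k). (i,j,k)"])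
      (auto simp: moves_def moveup_ok_def)
  finally show ?thesis by simp
qed

lemma finite_moves: "finite (moves la)"
proof (rule finite_subset)
  show "moves la \<subseteq> {..<length la} \<times> {..<length la} \<times> {..sum_list la}"
  proof safe
    fix i j k assume "(i, j, k) \<in> moves la"
    then have ij: "i < j" "j < length la" "k \<le> la ! j" by (auto simp: moves_def moveup_ok_def)
    show "i < length la" "j < length la" using ij by auto
    show "k \<le> sum_list la" using ij member_le_sum_list[of "la ! j" la] by simp
  qed
qed simp

lemma Mstar_image: "Mstar la = (\<lambda>(i,j,k). moveup i j k la) ` moves la"
  by (force simp: Mstar_def moves_def)

lemma finite_Mstar: "finite (Mstar la)"
  by (simp add: Mstar_image finite_moves)

lemma moves_determined:
  assumes la: "is_partition la" and m: "(i,j,k) \<in> moves la" "(i',j',k') \<in> moves la"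
  shows "moveup i j k la = moveup i' j' k' la \<longleftrightarrow> la ! i = la ! i' \<and> la ! j = la ! j' \<and> k = k'"
proof -
  have s: "sorted (rev la)" using la by (simp add: is_partition_def)
  have ij: "i < j" "j < length la" "0 < k" "k \<le> la ! j" "i' < j'" "j' < length la" "0 < k'" "k' \<le> la ! j'"
    using m by (auto simp: moves_def moveup_ok_def)
  obtain B where B: "mset la = add_mset (la ! i) (add_mset (la ! j) B)" using nth_pair_mset ij(1,2) by metis
  obtain B' where B': "mset la = add_mset (la ! i') (add_mset (la ! j') B')" using nth_pair_mset ij(5,6) by metis
  note M = mset_moveup'[OF ij(1,2) B, of k] mset_moveup'[OF ij(5,6) B', of k']
  show ?thesis
  proof
    assume "moveup i j k la = moveup i' j' k' la"
    then have "pos_part (add_mset (la ! i + k) (add_mset (la ! j - k) B)) = pos_part (add_mset (la ! i' + k') (add_mset (la ! j' - k') B'))"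
      using M by simp
    then show "la ! i = la ! i' \<and> la ! j = la ! j' \<and> k = k'"
      using ij sorted_rev_nth[OF s, of i j] sorted_rev_nth[OF s, of i' j']
      by (intro move_determined[OF _ _ _ _ _ _ B B']) auto
  next
    assume eq: "la ! i = la ! i' \<and> la ! j = la ! j' \<and> k = k'"
    then have "B = B'" using B B' by simp
    then show "moveup i j k la = moveup i' j' k' la" using M eq by (intro moveup_partition_eq) simp
  qed
qed

definition move_wt :: "nat list \<Rightarrow> nat \<times> nat \<times> nat \<Rightarrow> F" where
  "move_wt la = (\<lambda>(i,j,k). of_nat (la ! i) - of_nat (la ! j) + 2 * of_nat k)"

text \<open>By \<open>moves_determined\<close> all moves leading to nu share k and the values of the
  two parts, so the arbitrary choice in \<open>rcoef\<close> is harmless and its multiplicity factor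
  counts these moves. The Laplace-Beltrami operator produces the sum on the right.\<close>

lemma rcoef_eq:
  assumes la: "is_partition la" and nu: "nu \<in> Mstar la"
  shows "rcoef la nu = (\<Sum>m\<in>{m \<in> moves la. (\<lambda>(i,j,k). moveup i j k la) m = nu}. move_wt la m)"
proof -
  have s: "sorted (rev la)" using la by (simp add: is_partition_def)
  define t where "t = (SOME (i, j, k). moveup_ok i j k la \<and> nu = moveup i j k la)"
  obtain i j k where t: "t = (i, j, k)" by (metis prod_cases3)
  have "(\<lambda>(i, j, k). moveup_ok i j k la \<and> nu = moveup i j k la) t"
    unfolding t_def by (rule someI_ex) (use nu in \<open>auto simp: Mstar_def\<close>)
  then have m: "(i,j,k) \<in> moves la" and nu_eq: "nu = moveup i j k la" by (auto simp: t moves_def)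
  then have ij: "i < j" "j < length la" "0 < k" "k \<le> la ! j" by (auto simp: moves_def moveup_ok_def)
  define a b where "a = la ! i" and "b = la ! j"
  have ba: "b \<le> a" unfolding a_def b_def using ij by (intro sorted_rev_nth[OF s]) auto
  let ?S = "{(i,j). i < j \<and> j < length la \<and> la ! i = a \<and> la ! j = b}"
  have set_eq: "{m \<in> moves la. (\<lambda>(i,j,k). moveup i j k la) m = nu} = (\<lambda>(i,j). (i,j,k)) ` ?S" (is "?M = ?R")
  proof
    show "?M \<subseteq> ?R"
    proof
      fix m' assume m': "m' \<in> ?M"
      obtain i' j' k' where [simp]: "m' = (i',j',k')" by (metis prod_cases3)
      have "la ! i' = a \<and> la ! j' = b \<and> k' = k"
        using m' moves_determined[OF la _ m, of i' j' k'] by (simp add: nu_eq a_def b_def)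
      then show "m' \<in> ?R" using m' by (auto simp: moves_def moveup_ok_def)
    qed
    show "?R \<subseteq> ?M"
    proof
      fix m' assume "m' \<in> ?R"
      then obtain i' j' where [simp]: "m' = (i',j',k)" and i': "i' < j'" "j' < length la" "la ! i' = a" "la ! j' = b" by auto
      then have m': "(i',j',k) \<in> moves la" using ij by (simp add: moves_def moveup_ok_def b_def)
      then show "m' \<in> ?M" using i' moves_determined[OF la m' m] by (simp add: nu_eq a_def b_def)
    qed
  qed
  have "(\<Sum>m\<in>?M. move_wt la m) = (\<Sum>(i,j)\<in>?S. of_nat a - of_nat b + 2 * of_nat k)"
    by (rule sum.reindex_cong[OF _ set_eq]) (auto simp: inj_on_def move_wt_def)
  also have "\<dots> = of_nat (card ?S) * (of_nat a - of_nat b + 2 * of_nat k)"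
    by (simp add: split_def)
  also have "\<dots> = rcoef la nu"
    unfolding card_pairs[OF s ba] rcoef_def t_def[symmetric] t
    by (simp only: prod.case Let_def a_def b_def mult.assoc)
  finally show ?thesis by simp
qed

lemma sum_min_pairs:
  assumes "sorted (rev la)"
  shows "(\<Sum>(i,j)\<in>{(i,j). i < j \<and> j < length la}. of_nat (min (la ! i) (la ! j)) :: F) = (\<Sum>j<length la. of_nat (j * la ! j))"
proof -
  have "(\<Sum>(i,j)\<in>{(i,j). i < j \<and> j < length la}. of_nat (min (la ! i) (la ! j)) :: F)
    = (\<Sum>(i,j)\<in>{(i,j). i < j \<and> j < length la}. of_nat (la ! j))"
    using sorted_rev_nth[OF assms] by (intro sum.cong) (auto simp: min_def dual_order.antisym)
  also have "\<dots> = (\<Sum>(j,i)\<in>Sigma {..<length la} (\<lambda>j. {..<j}). of_nat (la ! j))"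
    by (rule sum.reindex_bij_witness[of _ prod.swap prod.swap]) auto
  also have "\<dots> = (\<Sum>j<length la. \<Sum>i<j. of_nat (la ! j))"
    by (rule sum.Sigma[symmetric]) auto
  finally show ?thesis by simp
qed

text \<open>Minima over pairs give the sum of the j la_j with rows numbered from 0. Since
  \<open>eprime\<close> numbers them from 1, the size of the partition appears as a shift.\<close>

lemma LB_diag:
  assumes la: "is_partition la"
  shows "alpha * of_nat (\<Sum>x\<in>#mset la. x\<^sup>2) - of_nat (\<Sum>x\<in>#mset la. \<Sum>y\<in>#mset la - {#x#}. min x y)
    = 2 * (eprime la + of_nat (sum_list la))"
proof -
  have s: "sorted (rev la)" using la by (simp add: is_partition_def)
  have 1: "(of_nat (\<Sum>x\<in>#mset la. x\<^sup>2) :: F) = (\<Sum>i<length la. of_nat ((la ! i)^2))"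
    by (simp only: sum_mset_mset_nth of_nat_sum)
  have "(of_nat (\<Sum>x\<in>#mset la. \<Sum>y\<in>#mset la - {#x#}. min x y) :: F) = (\<Sum>x\<in>#mset la. \<Sum>y\<in>#mset la - {#x#}. of_nat (min x y))"
    by (simp add: image_mset.compositionality comp_def del: of_nat_min)
  also have "\<dots> = 2 * (\<Sum>(i,j)\<in>{(i,j). i < j \<and> j < length la}. of_nat (min (la ! i) (la ! j)))"
    by (rule sum_mset_pairs_nth) (simp add: min.commute)
  also have "\<dots> = 2 * (\<Sum>j<length la. of_nat (j * la ! j))" by (simp only: sum_min_pairs[OF s])
  finally have 2: "(of_nat (\<Sum>x\<in>#mset la. \<Sum>y\<in>#mset la - {#x#}. min x y) :: F) = 2 * (\<Sum>j<length la. of_nat (j * la ! j))" .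
  have 3: "(of_nat (sum_list la) :: F) = (\<Sum>i<length la. of_nat (la ! i))"
    by (simp add: sum_list_sum_nth atLeast0LessThan)
  have 4: "(\<Sum>i<length la. of_nat ((i + 1) * la ! i) :: F) = (\<Sum>j<length la. of_nat (j * la ! j)) + (\<Sum>i<length la. of_nat (la ! i))"
    by (simp add: sum.distrib[symmetric] algebra_simps)
  show ?thesis unfolding 1 2 3 eprime_def 4 by (simp add: algebra_simps)
qed

lemma eigval_1: "is_partition la \<Longrightarrow> eigval 1 (mset la) = 2 * alpha * (eprime la + of_nat (sum_list la))"
proof -
  assume la: "is_partition la"
  have "eigval 1 (mset la) = (\<Sum>x\<in>#mset la. alpha * (alpha * of_nat (x\<^sup>2) - (\<Sum>y\<in>#mset la - {#x#}. of_nat (min x y))))"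
    unfolding eigval_def by (intro sum_mset_cong_strong)
      (simp add: power2_eq_square algebra_simps sum_mset_distrib_left del: of_nat_min)
  also have "\<dots> = alpha * (alpha * of_nat (\<Sum>x\<in>#mset la. x\<^sup>2) - of_nat (\<Sum>x\<in>#mset la. \<Sum>y\<in>#mset la - {#x#}. min x y))"
    by (simp add: sum_mset_subtractf sum_mset_distrib_left[symmetric] image_mset.compositionality comp_def del: of_nat_min)
  finally show ?thesis unfolding LB_diag[OF la] by (simp only: mult_ac)
qed

lemma HamM_1_Mstar:
  assumes la: "is_partition la" and zinv: "\<And>A. \<phi> (pos_part A) = \<phi> A"
  shows "HamM 1 \<phi> (mset la) = 2 * alpha * ((eprime la + of_nat (sum_list la)) * \<phi> (mset la)
    + (\<Sum>nu\<in>Mstar la. rcoef la nu * \<phi> (mset nu)))"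
proof -
  let ?A = "mset la"
  have s: "sorted (rev la)" using la by (simp add: is_partition_def)
  define G where "G x y = (\<Sum>u=Suc (max x y)..x+y.
     (2 * of_nat u - of_nat x - of_nat y) * \<phi> (add_mset u (add_mset (x + y - u) (?A - {#x#} - {#y#}))))" for x y
  have "(\<Sum>x\<in>#?A. \<Sum>y\<in>#?A - {#x#}. G x y) = 2 * (\<Sum>(i,j)\<in>{(i,j). i < j \<and> j < length la}. G (la ! i) (la ! j))"
    by (rule sum_mset_pairs_nth) (simp add: G_def add.commute max.commute diff_right_commute[of ?A] algebra_simps)
  also have "(\<Sum>(i,j)\<in>{(i,j). i < j \<and> j < length la}. G (la ! i) (la ! j))
    = (\<Sum>(i,j)\<in>{(i,j). i < j \<and> j < length la}. \<Sum>k=1..la ! j. move_wt la (i,j,k) * \<phi> (mset (moveup i j k la)))"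
  proof (intro sum.cong refl, safe)
    fix i j assume ij: "i < j" "j < length la"
    obtain B where B: "mset la = add_mset (la ! i) (add_mset (la ! j) B)" using nth_pair_mset ij by metis
    have le: "la ! j \<le> la ! i" using sorted_rev_nth[OF s] ij by simp
    have "G (la ! i) (la ! j) = (\<Sum>u=Suc (la ! i)..la ! i + la ! j.
     (2 * of_nat u - of_nat (la ! i) - of_nat (la ! j)) * \<phi> (add_mset u (add_mset (la ! i + la ! j - u) B)))"
      using le by (simp add: G_def B max_def)
    \<comment> \<open>With u = la_i + k the factor 2u - la_i - la_j becomes la_i - la_j + 2k, and u
      <= la_i + la_j is the condition k <= la_j.\<close>
    also have "\<dots> = (\<Sum>k=1..la ! j. move_wt la (i,j,k) * \<phi> (mset (moveup i j k la)))"
      by (rule sum.reindex_bij_witness[of _ "\<lambda>k. la ! i + k" "\<lambda>u. u - la ! i"])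
        (auto simp: move_wt_def mset_moveup'[OF ij B] zinv algebra_simps simp del: pos_part_add_mset)
    finally show "G (la ! i) (la ! j) = (\<Sum>k=1..la ! j. move_wt la (i,j,k) * \<phi> (mset (moveup i j k la)))" .
  qed
  also have "\<dots> = (\<Sum>(i,j,k)\<in>moves la. move_wt la (i,j,k) * \<phi> (mset (moveup i j k la)))"
    by (rule sum_moves[symmetric])
  also have "\<dots> = (\<Sum>m\<in>moves la. move_wt la m * \<phi> (mset ((\<lambda>(i,j,k). moveup i j k la) m)))"
    by (simp add: split_def)
  also have "\<dots> = (\<Sum>nu\<in>Mstar la. \<Sum>m\<in>{m \<in> moves la. (\<lambda>(i,j,k). moveup i j k la) m = nu}.
      move_wt la m * \<phi> (mset ((\<lambda>(i,j,k). moveup i j k la) m)))"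
    unfolding Mstar_image by (rule sum.image_gen[OF finite_moves])
  also have "\<dots> = (\<Sum>nu\<in>Mstar la. rcoef la nu * \<phi> (mset nu))"
    by (intro sum.cong refl) (simp add: rcoef_eq[OF la] sum_distrib_right)
  finally show ?thesis
    unfolding HamM_1 LB_diag[OF la] G_def by (simp add: algebra_simps)
qed

section \<open>Filtrations\<close>

lemma Mstar_props:
  assumes la: "is_partition la" and nu: "nu \<in> Mstar la"
  shows "is_partition nu" "dlt (mset la) (mset nu)" "sum_list nu = sum_list la"
proof -
  obtain i j k where nu_eq: "nu = moveup i j k la" and "moveup_ok i j k la"
    using nu by (auto simp: Mstar_def)
  then have ij: "i < j" "j < length la" "0 < k" "k \<le> la ! j" by (auto simp: moveup_ok_def)
  show "is_partition nu" unfolding nu_eq by (rule is_partition_moveup)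
  obtain B where B: "mset la = add_mset (la ! i) (add_mset (la ! j) B)" using nth_pair_mset ij by metis
  have le: "la ! j \<le> la ! i" using sorted_rev_nth[of la i j] la ij by (simp add: is_partition_def)
  have "dlt (mset la) (add_mset (la ! i + k) (add_mset (la ! i + la ! j - (la ! i + k)) B))"
    unfolding B by (rule dlt_shift) (use le ij in auto)
  then show dlt: "dlt (mset la) (mset nu)"
    unfolding nu_eq mset_moveup'[OF ij(1,2) B] by (simp add: dlt_def del: pos_part_add_mset)
  then show "sum_list nu = sum_list la" by (simp add: dlt_def dle_def sum_mset_sum_list)
qed

text \<open>The coefficient of alpha in e' is half the sum of the squares of the parts, which is
  strictly monotone for dominance. Hence no denominator in the filtration sums vanishes.\<close>

lemma eprime_neq:
  assumes "is_partition la" "is_partition mu" "dlt (mset mu) (mset la)"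
  shows "eprime la \<noteq> eprime mu"
proof
  assume eq: "eprime la = eprime mu"
  define s where "s la = (\<Sum>x\<in>#mset la. x\<^sup>2)" for la :: "nat list"
  define c where "c la = (\<Sum>i<length la. (i + 1) * la ! i)" for la :: "nat list"
  have e: "2 * eprime la = of_nat (s la) * alpha - 2 * of_nat (c la)" for la
  proof -
    have "(of_nat (s la) :: F) = (\<Sum>i<length la. of_nat ((la ! i)^2))"
      by (simp only: s_def sum_mset_mset_nth of_nat_sum)
    moreover have "(of_nat (c la) :: F) = (\<Sum>i<length la. of_nat ((i + 1) * la ! i))"
      by (simp only: c_def of_nat_sum)
    ultimately show ?thesis by (simp only: eprime_def) (simp add: field_simps)
  qed
  have "of_nat (s la) * alpha - 2 * of_nat (c la) = of_nat (s mu) * alpha - 2 * of_nat (c mu)"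
    using eq e[of la] e[of mu] by metis
  then have *: "of_nat (s la) * alpha ^ 1 - of_nat (s mu) * alpha ^ 1 = of_nat (2 * c la) * alpha ^ 0 + - (of_nat (2 * c mu) * alpha ^ 0)"
    by (simp add: algebra_simps)
  have "of_nat m * alpha ^ 0 \<in> low_degree 1" for m
    using alpha_power_low_degree[of m 0] by (simp only: One_nat_def)
  then have "of_nat (s la) * alpha ^ 1 - of_nat (s mu) * alpha ^ 1 \<in> low_degree 1"
    unfolding * by (intro low_degree_add low_degree_minus)
  then have "s la = s mu" by (rule of_nat_eq_if_low_degree)
  then show False using dlt_sum_squares[OF assms(3)] by (simp add: s_def)
qed

lemma successively_conv_nth:
  "successively P xs \<longleftrightarrow> (\<forall>i. i + 1 < length xs \<longrightarrow> P (xs ! i) (xs ! (i + 1)))"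
proof (induction P xs rule: successively.induct)
  case (3 P x y xs)
  have all: "(\<forall>i. Q i) \<longleftrightarrow> Q 0 \<and> (\<forall>i. Q (Suc i))" for Q :: "nat \<Rightarrow> bool"
    by (metis not0_implies_Suc)
  show ?case using 3 by (subst all) simp
qed simp_all

lemma filtrations_iff:
  "dl \<in> filtrations mu la \<longleftrightarrow> dl \<noteq> [] \<and> hd dl = mu \<and> last dl = la \<and> successively (\<lambda>x y. y \<in> Mstar x) dl"
  by (auto simp: filtrations_def successively_conv_nth)

lemma Nil_notin_filtrations: "[] \<notin> filtrations mu la"
  by (simp add: filtrations_iff)

lemma filtrations_Cons:
  "ka # dl \<in> filtrations mu la \<longleftrightarrow> ka = mu \<and> (dl = [] \<and> mu = la \<or> (\<exists>nu\<in>Mstar mu. dl \<in> filtrations nu la))"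
  by (cases dl) (auto simp: filtrations_iff)

lemma filtrations_props:
  "dl \<in> filtrations mu la \<Longrightarrow> is_partition mu \<Longrightarrow>
    dle (mset mu) (mset la) \<and> is_partition la \<and> sum_list la = sum_list mu"
proof (induction dl arbitrary: mu)
  case (Cons ka dl)
  from Cons.prems(1) consider "mu = la" | nu where "nu \<in> Mstar mu" "dl \<in> filtrations nu la"
    by (auto simp: filtrations_Cons)
  then show ?case
  proof cases
    case 2
    then show ?thesis
      using Cons.IH[of nu] Mstar_props[OF Cons.prems(2), of nu] by (auto simp: dlt_def intro: dle_trans)
  qed (use Cons.prems in auto)
qed (simp add: Nil_notin_filtrations)

lemma filtrations_refl:
  assumes "is_partition la"
  shows "filtrations la la = {[la]}"
proof -
  have "dl = [la]" if dl: "dl \<in> filtrations la la" for dl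
  proof (cases dl)
    case (Cons ka dl')
    have "\<not> (\<exists>nu\<in>Mstar la. dl' \<in> filtrations nu la)"
      using filtrations_props[of dl' _ la] Mstar_props[OF assms] by (auto simp: dlt_def)
    then show ?thesis using dl by (auto simp: Cons filtrations_Cons)
  qed (use dl in \<open>simp add: Nil_notin_filtrations\<close>)
  moreover have "[la] \<in> filtrations la la" by (simp add: filtrations_Cons)
  ultimately show ?thesis by blast
qed

lemma filtrations_first_step:
  assumes "mu \<noteq> la"
  shows "filtrations mu la = (\<Union>nu\<in>Mstar mu. (#) mu ` filtrations nu la)"
proof (rule set_eqI)
  fix dl show "dl \<in> filtrations mu la \<longleftrightarrow> dl \<in> (\<Union>nu\<in>Mstar mu. (#) mu ` filtrations nu la)"
    using assms by (cases dl) (auto simp: Nil_notin_filtrations filtrations_Cons)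
qed

text \<open>A filtration starting at a partition stays among partitions of the same size; indexing
  by these keeps the union finite, as summation needs.\<close>

lemma filtrations_last_step:
  assumes mu: "is_partition mu" and "mu \<noteq> la"
  shows "filtrations mu la = (\<Union>nu\<in>{nu \<in> partitions (sum_list mu). la \<in> Mstar nu}. (\<lambda>dl. dl @ [la]) ` filtrations mu nu)"
proof (intro set_eqI iffI)
  fix dl assume dl: "dl \<in> filtrations mu la"
  define dl' where "dl' = butlast dl"
  have dl_eq: "dl = dl' @ [la]" using dl by (auto simp: filtrations_iff dl'_def)
  have "dl' \<noteq> []" using dl assms(2) by (auto simp: dl_eq filtrations_iff)
  then have 1: "dl' \<in> filtrations mu (last dl')" "la \<in> Mstar (last dl')"
    using dl by (auto simp: dl_eq filtrations_iff successively_append_iff)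
  then have "last dl' \<in> partitions (sum_list mu)"
    using filtrations_props[OF 1(1) mu] by (simp add: partitions_def)
  with 1 show "dl \<in> (\<Union>nu\<in>{nu \<in> partitions (sum_list mu). la \<in> Mstar nu}. (\<lambda>dl. dl @ [la]) ` filtrations mu nu)"
    using dl_eq by blast
next
  fix dl assume "dl \<in> (\<Union>nu\<in>{nu \<in> partitions (sum_list mu). la \<in> Mstar nu}. (\<lambda>dl. dl @ [la]) ` filtrations mu nu)"
  then show "dl \<in> filtrations mu la" by (auto simp: filtrations_iff successively_append_iff)
qed

lemma partition_dlt:
  "\<lbrakk>is_partition mu; is_partition la; dle (mset mu) (mset la); mu \<noteq> la\<rbrakk> \<Longrightarrow> dlt (mset mu) (mset la)"
  using dom_less_iff[of mu la] dom_le_iff[of mu la] by (simp add: dom_less_def)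

lemma sum_squares_le: "\<lbrakk>is_partition mu; is_partition la; dle (mset mu) (mset la)\<rbrakk> \<Longrightarrow> (\<Sum>x\<in>#mset mu. x\<^sup>2) \<le> (\<Sum>x\<in>#mset la. x\<^sup>2)"
  using dlt_sum_squares[of "mset mu" "mset la"] partition_dlt[of mu la] by (cases "mu = la") auto

lemma Mstar_sum_squares:
  "\<lbrakk>is_partition mu; nu \<in> Mstar mu\<rbrakk> \<Longrightarrow> (\<Sum>x\<in>#mset mu. x\<^sup>2) < (\<Sum>x\<in>#mset nu. x\<^sup>2)"
  by (rule dlt_sum_squares[OF Mstar_props(2)])

text \<open>Moving up strictly increases \<open>\<Sum>\<^sub>i \<lambda>\<^sub>i\<^sup>2\<close>, which serves as induction measure in both directions.\<close>

lemma finite_filtrations: "is_partition mu \<Longrightarrow> finite (filtrations mu la)"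
proof (induction "(\<Sum>x\<in>#mset la. x\<^sup>2) - (\<Sum>x\<in>#mset mu. x\<^sup>2)" arbitrary: mu rule: less_induct)
  case less
  show ?case
  proof (cases "filtrations mu la = {} \<or> mu = la")
    case True
    then show ?thesis using filtrations_refl less.prems by auto
  next
    case False
    have "finite (filtrations nu la)" if nu: "nu \<in> Mstar mu" for nu
    proof (cases "filtrations nu la = {}")
      case False
      note p = Mstar_props[OF less.prems nu]
      have "dle (mset nu) (mset la)" "is_partition la" using filtrations_props p(1) False by blast+
      then have "(\<Sum>x\<in>#mset nu. x\<^sup>2) \<le> (\<Sum>x\<in>#mset la. x\<^sup>2)" using sum_squares_le p(1) by blast
      then show ?thesis using Mstar_sum_squares[OF less.prems nu] p(1) by (intro less.hyps) auto
    qed simp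
    then show ?thesis using False by (simp add: filtrations_first_step finite_Mstar)
  qed
qed

lemma f_up_Cons: "dl \<noteq> [] \<Longrightarrow> f_up la (mu # dl) = rcoef mu (hd dl) / (eprime la - eprime mu) * f_up la dl"
  by (cases dl) (simp_all add: f_up_def prod.lessThan_Suc_shift del: prod.lessThan_Suc)

lemma f_down_snoc:
  assumes "dl \<noteq> []"
  shows "f_down mu (dl @ [ka]) = f_down mu dl * (rcoef (last dl) ka / (eprime mu - eprime ka))"
proof -
  obtain m where m: "length dl = Suc m" using assms by (cases dl) auto
  have "last dl = dl ! m" using assms m by (simp add: last_conv_nth)
  then show ?thesis by (simp add: f_down_def m nth_append)
qed

lemma sum_f_up_step:
  assumes mu: "is_partition mu" and "mu \<noteq> la"
  shows "(\<Sum>dl\<in>filtrations mu la. f_up la dl)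
    = (\<Sum>nu\<in>Mstar mu. rcoef mu nu / (eprime la - eprime mu) * (\<Sum>dl\<in>filtrations nu la. f_up la dl))"
proof -
  have "(\<Sum>dl\<in>filtrations mu la. f_up la dl) = (\<Sum>nu\<in>Mstar mu. \<Sum>dl\<in>(#) mu ` filtrations nu la. f_up la dl)"
    unfolding filtrations_first_step[OF assms(2)]
  proof (rule sum.UNION_disjoint)
    show "\<forall>nu\<in>Mstar mu. finite ((#) mu ` filtrations nu la)"
      using Mstar_props(1)[OF mu] finite_filtrations by blast
  qed (auto simp: finite_Mstar filtrations_iff)
  also have "\<dots> = (\<Sum>nu\<in>Mstar mu. rcoef mu nu / (eprime la - eprime mu) * (\<Sum>dl\<in>filtrations nu la. f_up la dl))"
    unfolding sum_distrib_left
    by (intro sum.cong refl sum.reindex_cong[OF _ refl]) (auto simp: filtrations_iff f_up_Cons)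
  finally show ?thesis .
qed

lemma finite_partitions: "finite (partitions n)"
proof (rule finite_subset)
  show "partitions n \<subseteq> part_list ` Par n"
    using partitionsD by (metis image_eqI subsetI)
qed simp

lemma sum_f_down_step:
  assumes mu: "is_partition mu" and "mu \<noteq> la"
  shows "(\<Sum>dl\<in>filtrations mu la. f_down mu dl)
    = (\<Sum>nu\<in>{nu \<in> partitions (sum_list mu). la \<in> Mstar nu}.
        rcoef nu la / (eprime mu - eprime la) * (\<Sum>dl\<in>filtrations mu nu. f_down mu dl))"
proof -
  have "(\<Sum>dl\<in>filtrations mu la. f_down mu dl)
     = (\<Sum>nu\<in>{nu \<in> partitions (sum_list mu). la \<in> Mstar nu}. \<Sum>dl\<in>(\<lambda>dl. dl @ [la]) ` filtrations mu nu. f_down mu dl)"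
    unfolding filtrations_last_step[OF assms]
    by (rule sum.UNION_disjoint) (auto simp: finite_partitions finite_filtrations[OF mu] filtrations_iff)
  also have "\<dots> = (\<Sum>nu\<in>{nu \<in> partitions (sum_list mu). la \<in> Mstar nu}.
        rcoef nu la / (eprime mu - eprime la) * (\<Sum>dl\<in>filtrations mu nu. f_down mu dl))"
    unfolding sum_distrib_left
    by (intro sum.cong refl sum.reindex_cong[OF _ refl])
      (auto simp: inj_on_def filtrations_iff f_down_snoc mult.commute)
  finally show ?thesis .
qed

section \<open>Solving the two recursions along filtrations\<close>

lemma filtrations_empty: "is_partition mu \<Longrightarrow> \<not> dle (mset mu) (mset la) \<Longrightarrow> filtrations mu la = {}"
  using filtrations_props by blast

text \<open>Splitting off the first step of a filtration turns the sum over filtrations into the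
  same recursion. Where nu is not below la, both sides are 0: \<open>v0\<close> on the left, no
  filtration on the right.\<close>

lemma solve_upward:
  fixes v :: "nat list \<Rightarrow> F"
  assumes la: "is_partition la"
    and v0: "\<And>mu. mu \<in> partitions (sum_list la) \<Longrightarrow> \<not> dle (mset mu) (mset la) \<Longrightarrow> v mu = 0"
    and rec: "\<And>mu. mu \<in> partitions (sum_list la) \<Longrightarrow>
      (eprime la - eprime mu) * v mu = (\<Sum>nu\<in>Mstar mu. rcoef mu nu * v nu)"
    and "mu \<in> partitions (sum_list la)"
  shows "v mu = v la * (\<Sum>dl\<in>filtrations mu la. f_up la dl)"
  using assms(4)
proof (induction "(\<Sum>x\<in>#mset la. x\<^sup>2) - (\<Sum>x\<in>#mset mu. x\<^sup>2)" arbitrary: mu rule: less_induct)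
  case less
  have mu: "is_partition mu" using less.prems by (simp add: partitions_def)
  consider "mu = la" | "\<not> dle (mset mu) (mset la)" | "mu \<noteq> la" "dle (mset mu) (mset la)" by blast
  then show ?case
  proof cases
    case 1
    then show ?thesis by (simp add: filtrations_refl la f_up_def)
  next
    case 2
    then show ?thesis by (simp add: v0 less.prems filtrations_empty mu)
  next
    case 3
    have ne: "eprime la - eprime mu \<noteq> 0"
      using eprime_neq[OF la mu partition_dlt[OF mu la 3(2,1)]] by simp
    have IH: "v nu = v la * (\<Sum>dl\<in>filtrations nu la. f_up la dl)" if nu: "nu \<in> Mstar mu" for nu
    proof -
      note p = Mstar_props[OF mu nu]
      have mem: "nu \<in> partitions (sum_list la)" using p less.prems by (simp add: partitions_def)
      show ?thesis
      proof (cases "dle (mset nu) (mset la)")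
        case True
        \<comment> \<open>The measure is a difference of natural numbers; it drops strictly only
          because nu <= la keeps the sum of squares of nu below that of la.\<close>
        then show ?thesis
          using sum_squares_le[OF p(1) la] Mstar_sum_squares[OF mu nu] mem by (intro less.hyps) auto
      next
        case False
        then show ?thesis by (simp add: v0 mem filtrations_empty p)
      qed
    qed
    have "v mu = (\<Sum>nu\<in>Mstar mu. rcoef mu nu * v nu) / (eprime la - eprime mu)"
      using rec[OF less.prems] ne by (simp add: field_simps)
    also have "\<dots> = (\<Sum>nu\<in>Mstar mu. v la * (rcoef mu nu / (eprime la - eprime mu) * (\<Sum>dl\<in>filtrations nu la. f_up la dl)))"
      unfolding sum_divide_distrib by (intro sum.cong refl) (simp add: IH)
    finally show ?thesis unfolding sum_f_up_step[OF mu 3(1)] sum_distrib_left .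
  qed
qed

text \<open>The transposed version: here the last step is split off, and the predecessors of la have
  smaller sums of squares.\<close>

lemma solve_downward:
  fixes c :: "nat list \<Rightarrow> F"
  assumes mu: "is_partition mu"
    and c0: "\<And>la. la \<in> partitions (sum_list mu) \<Longrightarrow> \<not> dle (mset mu) (mset la) \<Longrightarrow> c la = 0"
    and rec: "\<And>la. la \<in> partitions (sum_list mu) \<Longrightarrow>
      (eprime mu - eprime la) * c la = (\<Sum>nu\<in>{nu \<in> partitions (sum_list mu). la \<in> Mstar nu}. rcoef nu la * c nu)"
    and "la \<in> partitions (sum_list mu)"
  shows "c la = c mu * (\<Sum>dl\<in>filtrations mu la. f_down mu dl)"
  using assms(4)
proof (induction "\<Sum>x\<in>#mset la. x\<^sup>2" arbitrary: la rule: less_induct)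
  case less
  have la: "is_partition la" using less.prems by (simp add: partitions_def)
  consider "la = mu" | "\<not> dle (mset mu) (mset la)" | "mu \<noteq> la" "dle (mset mu) (mset la)" by blast
  then show ?case
  proof cases
    case 1
    then show ?thesis by (simp add: filtrations_refl mu f_down_def)
  next
    case 2
    then show ?thesis by (simp add: c0 less.prems filtrations_empty mu)
  next
    case 3
    have ne: "eprime mu - eprime la \<noteq> 0"
      using eprime_neq[OF la mu partition_dlt[OF mu la 3(2,1)]] by simp
    have IH: "c nu = c mu * (\<Sum>dl\<in>filtrations mu nu. f_down mu dl)"
      if nu: "nu \<in> partitions (sum_list mu)" "la \<in> Mstar nu" for nu
      using nu Mstar_sum_squares[of nu la] by (intro less.hyps) (auto simp: partitions_def)
    have "c la = (\<Sum>nu\<in>{nu \<in> partitions (sum_list mu). la \<in> Mstar nu}. rcoef nu la * c nu) / (eprime mu - eprime la)"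
      using rec[OF less.prems] ne by (simp add: field_simps)
    also have "\<dots> = (\<Sum>nu\<in>{nu \<in> partitions (sum_list mu). la \<in> Mstar nu}.
        c mu * (rcoef nu la / (eprime mu - eprime la) * (\<Sum>dl\<in>filtrations mu nu. f_down mu dl)))"
      unfolding sum_divide_distrib by (intro sum.cong refl) (simp add: IH)
    finally show ?thesis unfolding sum_f_down_step[OF mu 3(1)] sum_distrib_left .
  qed
qed

text \<open>In the eigenvalue equation of \<open>Ham 1\<close> the common factor 2 alpha cancels,
  and so does the shift n, leaving the differences of e'. The factor v la is 1 by the normalization
  of P.\<close>

lemma jack_coords_upward:
  assumes D: "jack_coords n (D n)" and la: "la \<in> partitions n" and mu: "mu \<in> partitions n"
  shows "ev (D n (mset la)) (mset mu) = (\<Sum>dl\<in>filtrations mu la. f_up la dl)"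
proof -
  define v where "v mu = ev (D n (mset la)) (mset mu)" for mu
  have laP: "is_partition la" "sum_list la = n" using la by (simp_all add: partitions_def)
  have "v mu = v la * (\<Sum>dl\<in>filtrations mu la. f_up la dl)"
  proof (rule solve_upward[OF laP(1)], unfold laP(2))
    show "v mu = 0" if "mu \<in> partitions n" "\<not> dle (mset mu) (mset la)" for mu
      using D partitionsD(1)[OF la] partitionsD(1)[OF that(1)] that(2) by (simp add: v_def jack_coords_def)
    show "(eprime la - eprime mu) * v mu = (\<Sum>nu\<in>Mstar mu. rcoef mu nu * v nu)" if mu: "mu \<in> partitions n" for mu
    proof -
      have muP: "is_partition mu" "sum_list mu = n" using mu by (simp_all add: partitions_def)
      have "HamM 1 (ev (D n (mset la))) (mset mu) = ev (\<lambda>l. eigval 1 (mset la) * D n (mset la) l) (mset mu)"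
        unfolding ev_Ham[symmetric]
        by (intro ev_cong jack_coords_eigenvector[OF D] partitionsD[OF la]) (simp add: muP sum_mset_sum_list)
      then have "2 * alpha * ((eprime mu + of_nat n) * v mu + (\<Sum>nu\<in>Mstar mu. rcoef mu nu * v nu))
         = 2 * alpha * ((eprime la + of_nat n) * v mu)"
        by (simp only: HamM_1_Mstar[where \<phi> = "ev (D n (mset la))", OF muP(1) ev_pos_part] ev_scale eigval_1[OF laP(1)] laP muP v_def mult.assoc)
      then have "(eprime mu + of_nat n) * v mu + (\<Sum>nu\<in>Mstar mu. rcoef mu nu * v nu) = (eprime la + of_nat n) * v mu"
        by simp
      then show ?thesis by (simp add: algebra_simps)
    qed
  qed (rule mu)
  moreover have "v la = 1" using D partitionsD(1)[OF la] by (simp add: v_def jack_coords_def)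
  ultimately show ?thesis by (simp add: v_def)
qed

text \<open>The number c la is the coefficient of q_la in P_mu. Moving \<open>Ham 1\<close> across
  the form lets it act on m_la, which reads its matrix by columns instead of rows.\<close>

lemma jack_coords_downward:
  assumes D: "jack_coords n (D n)" and la: "la \<in> partitions n" and mu: "mu \<in> partitions n"
  defines "c \<equiv> \<lambda>la. form n (D n (mset mu)) (mcoord (mset la))"
  shows "c la = c mu * (\<Sum>dl\<in>filtrations mu la. f_down mu dl)"
proof -
  have muP: "is_partition mu" "sum_list mu = n" using mu by (simp_all add: partitions_def)
  show ?thesis
  proof (rule solve_downward[OF muP(1)], unfold muP(2))
    show "c la = 0" if "la \<in> partitions n" "\<not> dle (mset mu) (mset la)" for la
      unfolding c_def by (rule jack_coords_mcoord[OF D partitionsD(1)[OF mu] partitionsD(1)[OF that(1)] that(2)])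
    show "(eprime mu - eprime la) * c la = (\<Sum>nu\<in>{nu \<in> partitions n. la \<in> Mstar nu}. rcoef nu la * c nu)"
      if la: "la \<in> partitions n" for la
    proof -
      let ?d = "D n (mset mu)"
      have laP: "is_partition la" "sum_list la = n" using la by (simp_all add: partitions_def)
      have "form n ?d (Ham 1 (mcoord (mset la))) = form n (Ham 1 ?d) (mcoord (mset la))"
        by (rule form_Ham[symmetric])
      also have "\<dots> = form n (\<lambda>l. eigval 1 (mset mu) * ?d l) (mcoord (mset la))"
        by (intro form_cong jack_coords_eigenvector[OF D partitionsD(1)[OF mu]] refl)
      also have "\<dots> = 2 * alpha * ((eprime mu + of_nat n) * c la)"
        by (simp only: form_scale_left eigval_1[OF muP(1)] muP(2) c_def mult.assoc)
      finally have 1: "form n ?d (Ham 1 (mcoord (mset la))) = 2 * alpha * ((eprime mu + of_nat n) * c la)" .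
      \<comment> \<open>Column la of the matrix of \<open>Ham 1\<close> in the monomial basis: the
        diagonal entry at nu = la, and r_(nu,la) where la is one move above nu.\<close>
      have H: "HamM 1 (ev (mcoord (mset la))) (mset nu) * c nu = 2 * alpha *
          ((if nu = la then (eprime la + of_nat n) * c la else 0) + (if la \<in> Mstar nu then rcoef nu la * c nu else 0))"
        if nu: "nu \<in> partitions n" for nu
      proof -
        have nuP: "is_partition nu" "sum_list nu = n" using nu by (simp_all add: partitions_def)
        have ev: "ev (mcoord (mset la)) (mset ka) = (if ka = la then 1 else 0)" if "ka \<in> partitions n" for ka
          using ev_mcoord[OF partitionsD(1)[OF la] partitionsD(1)[OF that]] partitionsD(2)[OF la] partitionsD(2)[OF that]
          by metis
        have "(\<Sum>ka\<in>Mstar nu. rcoef nu ka * ev (mcoord (mset la)) (mset ka)) = (\<Sum>ka\<in>Mstar nu. if ka = la then rcoef nu la else 0)"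
          using Mstar_props[OF nuP(1)] nuP(2) by (intro sum.cong refl) (simp add: ev partitions_def)
        also have "\<dots> = (if la \<in> Mstar nu then rcoef nu la else 0)" by (simp add: finite_Mstar)
        finally have "HamM 1 (ev (mcoord (mset la))) (mset nu)
          = 2 * alpha * ((eprime nu + of_nat n) * (if nu = la then 1 else 0) + (if la \<in> Mstar nu then rcoef nu la else 0))"
          using HamM_1_Mstar[OF nuP(1), of "ev (mcoord (mset la))"] nuP(2) by (simp only: ev_pos_part ev[OF nu])
        then show ?thesis by (auto simp: algebra_simps)
      qed
      have "form n ?d (Ham 1 (mcoord (mset la))) = (\<Sum>A\<in>Par n. HamM 1 (ev (mcoord (mset la))) A * form n ?d (mcoord A))"
        unfolding form_expansion[of n ?d "Ham 1 (mcoord (mset la))"] ev_Ham ..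
      also have "\<dots> = (\<Sum>nu\<in>partitions n. HamM 1 (ev (mcoord (mset la))) (mset nu) * c nu)"
        by (simp add: sum_partitions c_def)
      also have "\<dots> = 2 * alpha * ((\<Sum>nu\<in>partitions n. if nu = la then (eprime la + of_nat n) * c la else 0)
           + (\<Sum>nu\<in>partitions n. if la \<in> Mstar nu then rcoef nu la * c nu else 0))"
        by (simp only: H cong: sum.cong) (simp only: sum.distrib sum_distrib_left[symmetric])
      also have "(\<Sum>nu\<in>partitions n. if nu = la then (eprime la + of_nat n) * c la else 0) = (eprime la + of_nat n) * c la"
        using la by (simp add: finite_partitions)
      also have "(\<Sum>nu\<in>partitions n. if la \<in> Mstar nu then rcoef nu la * c nu else 0)
         = (\<Sum>nu\<in>{nu \<in> partitions n. la \<in> Mstar nu}. rcoef nu la * c nu)"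
        by (rule sum.inter_filter[OF finite_partitions, symmetric])
      finally have "2 * alpha * ((eprime mu + of_nat n) * c la) = 2 * alpha * ((eprime la + of_nat n) * c la
         + (\<Sum>nu\<in>{nu \<in> partitions n. la \<in> Mstar nu}. rcoef nu la * c nu))" unfolding 1 .
      then have "(eprime mu + of_nat n) * c la = (eprime la + of_nat n) * c la
         + (\<Sum>nu\<in>{nu \<in> partitions n. la \<in> Mstar nu}. rcoef nu la * c nu)" by simp
      then show ?thesis by (simp add: algebra_simps)
    qed
  qed (rule la)
qed

theorem theorem5p13:
  fixes la mu :: "nat list"
  assumes "is_partition mu" and "is_partition la" and "dom_less mu la"
  shows "vcoef la mu = vcoef la la * (\<Sum>dl\<in>filtrations mu la. f_up la dl)
       \<and> Ccoef mu la = Ccoef mu mu * (\<Sum>dl\<in>filtrations mu la. f_down mu dl)"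
proof
  define n where "n = sum_list la"
  have n: "sum_list mu = n" using assms(3) by (simp add: n_def dom_less_def dom_le_def)
  have la: "la \<in> partitions n" and mu: "mu \<in> partitions n" using assms n by (simp_all add: partitions_def n_def)
  obtain D where D: "\<forall>n. jack_coords n (D n)"
    and P: "\<forall>la. is_partition la \<longrightarrow> jackP la = SF (sum_list la) (D (sum_list la) (mset la))"
    using jackP_SF by blast
  \<comment> \<open>The hook product scales all coefficients of J_la alike, as the inverse norm s
    does for Q_mu; both are absorbed into the leading coefficients v_(la,la) and C_(mu,mu).\<close>
  have v: "vcoef la ka = hook_coeff la * ev (D n (mset la)) (mset ka)" if "ka \<in> partitions n" for ka
    using P assms(2) that
    by (simp add: vcoef_def jackJ_def sf_smult_def SF_def partitions_def mdeg_mono_of parts_mono_of n_def)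
  have "ev (D n (mset la)) (mset la) = 1"
    using D partitionsD(1)[OF la] by (simp add: jack_coords_def)
  then show "vcoef la mu = vcoef la la * (\<Sum>dl\<in>filtrations mu la. f_up la dl)"
    using jack_coords_upward[OF _ la mu, of D] D by (simp add: v la mu)
  define s where "s = inverse (sprod (jackP mu) (jackP mu))"
  have "jackQ mu = SF n (\<lambda>l. s * D n (mset mu) l)"
    using P assms(1) n by (simp add: jackQ_def s_def[symmetric] sf_smult_def SF_def fun_eq_iff ev_scale)
  then have C: "Ccoef mu ka = s * form n (D n (mset mu)) (mcoord (mset ka))" if "ka \<in> partitions n" for ka
    using that by (simp add: Ccoef_def n coords_q_list extend_def form_scale_left)
  show "Ccoef mu la = Ccoef mu mu * (\<Sum>dl\<in>filtrations mu la. f_down mu dl)"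
    using jack_coords_downward[OF _ la mu, of D] D by (simp add: C la mu)
qed

end
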